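(* Let $G$ be a connected graph of order $n\geq 10$, and suppose that $\sigma_2(G)\geq n-2$. Then $G$ has a homeomorphically irreducible spanning tree (HIST) if and only if $G$ is not isomorphic to $D_n$.
   Context: All graphs are finite and simple. For a non-complete graph $G$, $\sigma_2(G)=\min\{d_G(u)+d_G(v): u,v\in V(G),\ u\neq v,\ uv\notin E(G)\}$, where $d_G$ denotes degree; if $G$ is complete, $\sigma_2(G)=\infty$. A HIST of $G$ is a spanning tree of $G$ with no vertex of degree $2$. $D_n$ denotes the graph obtained from a complete graph $K$ of order $n-2$ and a path $P$ on $3$ vertices by identifying one vertex of $K$ with an endvertex of $P$ (so $D_n$ has $n$ vertices). *)

theory Defs
  imports "Graph_Theory.Digraph_Isomorphism" "HOL-Library.Extended_Nat"
begin

text \<open>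
  Finite simple graphs are the locale \<open>pair_graph\<close>: finite, loop-free digraphs with a symmetric
  set of arcs, an edge \<open>uv\<close> being the pair of arcs \<open>(u, v)\<close>, \<open>(v, u)\<close>. In such a graph the
  out-degree is the usual degree.
\<close>

abbreviation degree :: "'a pair_pre_digraph \<Rightarrow> 'a \<Rightarrow> nat" where
  "degree G v \<equiv> out_degree (with_proj G) v"

text \<open>For a complete graph the infimum below is over the empty set, hence \<open>\<infinity>\<close>.\<close>

definition sigma2 :: "'a pair_pre_digraph \<Rightarrow> enat" where
  "sigma2 G = Inf {enat (degree G u + degree G v) | u v.
     u \<in> pverts G \<and> v \<in> pverts G \<and> u \<noteq> v \<and> (u, v) \<notin> parcs G}"

text \<open>
  The library's \<open>tree\<close> is unsuitable for undirected graphs, since its \<open>cycle\<close> includes the closed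
  walk \<open>u, v, u\<close> along a single edge. In a simple graph the cycles in the usual sense are those
  of length at least 3.
\<close>

definition undirected_tree :: "'a pair_pre_digraph \<Rightarrow> bool" where
  "undirected_tree T \<longleftrightarrow> pair_graph T \<and> Digraph_Component.connected (with_proj T) \<and>
     \<not> (\<exists>p. pre_digraph.cycle (with_proj T) p \<and> 3 \<le> length p)"

definition HIST :: "'a pair_pre_digraph \<Rightarrow> 'a pair_pre_digraph \<Rightarrow> bool" where
  "HIST T G \<longleftrightarrow> undirected_tree T \<and> spanning (with_proj T) (with_proj G) \<and>
     (\<forall>v \<in> pverts T. degree T v \<noteq> 2)"

text \<open>
  The complete graph lives on \<open>{0..<n - 2}\<close> and the path is \<open>0, n - 2, n - 1\<close>, the shared vertex
  being \<open>0\<close>; this is meaningful for \<open>n \<ge> 3\<close>.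
\<close>

definition D_graph :: "nat \<Rightarrow> nat pair_pre_digraph" where
  "D_graph n = \<lparr> pverts = {0..<n},
     parcs = {(i, j). i < n - 2 \<and> j < n - 2 \<and> i \<noteq> j} \<union>
       {(0, n - 2), (n - 2, 0), (n - 2, n - 1), (n - 1, n - 2)} \<rparr>"

lemma pair_graph_D_graph:
  assumes "3 \<le> n"
  shows "pair_graph (D_graph n)"
proof
  show "finite (parcs (D_graph n))"
    by (rule finite_subset[of _ "{..n} \<times> {..n}"]) (auto simp: D_graph_def)
  show "symmetric (with_proj (D_graph n))"
    unfolding symmetric_def by (auto simp: D_graph_def sym_def)
qed (use assms in \<open>auto simp: D_graph_def\<close>)

end

theory Submission
  imports Defs
begin

text \<open>
  Let \<open>x\<close> be a vertex of maximum degree, \<open>N\<close> its neighbourhood and \<open>R\<close> the set of remaining vertices. If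
  \<open>R\<close> is empty, the star at \<open>x\<close> is a HIST, and if \<open>R = {y}\<close>, the tree can only fail to exist when all
  neighbours of \<open>y\<close> have degree 2, which forces \<open>D\<^sub>n\<close>.

  If some \<open>y \<in> R\<close> has at most one neighbour in \<open>N\<close>, then the degree sums of \<open>y\<close> with its non-neighbours
  are almost tight, so \<open>G\<close> looks like two overlapping dense parts with hubs \<open>x\<close> and \<open>y\<close>; a HIST is
  obtained by linking the two stars through a short path.

  Otherwise choose a maximal set \<open>D \<subseteq> R\<close> that can be hung below vertices of \<open>N\<close> with no vertex
  receiving a single child. By maximality the neighbours \<open>a\<close> in \<open>N\<close> of an uncovered \<open>y\<close> are unused, are
  adjacent to no other uncovered vertex, and to few vertices of \<open>D\<close>; by the degree sum condition
  they therefore have many neighbours in \<open>N\<close>, and every uncovered \<open>y\<close> can be hung below such an \<open>a\<close>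
  together with a second vertex moved there from \<open>x\<close>. A counting argument of Hall type shows that these
  choices can be made simultaneously, except for three parameter sets with \<open>n = 10\<close>.
\<close>

section \<open>Spanning trees from parent maps\<close>

text \<open>A vertex cannot be attached alone below a leaf, since the leaf would get degree 2. It
  needs a companion, usually a neighbour of \<open>x\<close> moved down from \<open>x\<close>; as
  \<open>x\<close> keeps three children, \<open>card N - 3\<close> bounds the number of such moves.
  The choice of \<open>x\<close> guarantees at least one: all degrees are at most
  \<open>card N\<close>, while a vertex of \<open>R\<close>, being nonadjacent to \<open>x\<close>,
  has degree at least \<open>card R - 1\<close>. Hence \<open>card R \<le> card N + 1\<close>, and
  10 vertices give \<open>4 \<le> card N\<close>. If \<open>y\<close> in \<open>R\<close> has at
  most one neighbour in \<open>N\<close>, its degree is at most \<open>card R\<close>, so its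
  non-neighbours have degree at least \<open>card N - 1\<close>, at most one below the maximum. This
  is the tightness in question: each tree that cannot be built yields further (non-)adjacencies,
  until a degree bound breaks. In the other case the uncovered vertices have disjoint neighbourhoods
  in \<open>N\<close>, each of size at least 2. A Hall violator of more than j vertices thus gives a
  clique of at least 2j+2 vertices, although each has at most j neighbours in \<open>N\<close>. The
  argument fails only if all counts are equalities, that is for (\<open>card N\<close>,
  \<open>card D\<close>, \<open>card U\<close>) = (4,4,1), (5,2,2), (6,0,3).\<close>

lemma pawalk_nth:
  assumes "pcas u p v"
  shows "length (pawalk_verts u p) = Suc (length p)"
    and "pawalk_verts u p ! 0 = u" and "pawalk_verts u p ! length p = v"
    and "i < length p \<Longrightarrow> p ! i = (pawalk_verts u p ! i, pawalk_verts u p ! Suc i)"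
proof -
  have "length (pawalk_verts u p) = Suc (length p) \<and> pawalk_verts u p ! 0 = u \<and>
    pawalk_verts u p ! length p = v \<and>
    (\<forall>i < length p. p ! i = (pawalk_verts u p ! i, pawalk_verts u p ! Suc i))"
    using assms
  proof (induction p arbitrary: u)
    case (Cons e p)
    then show ?case
      by (cases e) (auto simp: nth_Cons split: nat.split)
  qed simp
  then show "length (pawalk_verts u p) = Suc (length p)"
    and "pawalk_verts u p ! 0 = u" and "pawalk_verts u p ! length p = v"
    and "i < length p \<Longrightarrow> p ! i = (pawalk_verts u p ! i, pawalk_verts u p ! Suc i)"
    by auto
qed

lemma degree_conv_card: "degree G v = card {w. (v, w) \<in> parcs G}"
proof -
  have "out_arcs (with_proj G) v = Pair v ` {w. (v, w) \<in> parcs G}"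
    by (auto simp: out_arcs_def)
  then show ?thesis
    by (simp add: out_degree_def card_image inj_on_def)
qed

lemma (in pair_graph) parcs_sym: "(u, v) \<in> parcs G \<Longrightarrow> (v, u) \<in> parcs G"
  using pair_sym_arcs by (auto simp: symmetric_def elim: symE)

lemma (in pair_graph) parcs_mk_symmetric: "parcs (mk_symmetric (with_proj G)) = parcs G"
  using parcs_sym by (auto simp: mk_symmetric_def)

lemma (in pair_graph) connected_arc_leaving:
  assumes "Digraph_Component.connected (with_proj G)" "A \<subseteq> pverts G" "A \<noteq> {}" "A \<noteq> pverts G"
  shows "\<exists>u\<in>A. \<exists>v\<in>pverts G - A. (u, v) \<in> parcs G"
proof (rule ccontr)
  assume no_arc: "\<not> ?thesis"
  obtain u w where "u \<in> A" "w \<in> pverts G" "w \<notin> A" using assms by blast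
  have "(u, w) \<in> rtrancl_on (pverts G) (parcs G)"
    using assms(1,2) \<open>u \<in> A\<close> \<open>w \<in> pverts G\<close> parcs_mk_symmetric
    by (auto simp: Digraph_Component.connected_def strongly_connected_def reachable_def
        mk_symmetric_def)
  then have "w \<in> A"
    by (induction rule: rtrancl_on_induct) (use \<open>u \<in> A\<close> no_arc in auto)
  then show False using \<open>w \<notin> A\<close> by blast
qed

text \<open>
  A spanning tree rooted at \<open>x\<close> is given by a parent map \<open>f\<close> together with a rank \<open>h\<close> that
  decreases along \<open>f\<close>; the degree conditions are then conditions on the numbers of children.
\<close>

lemma (in pair_graph) HIST_of_parent_map:
  fixes h :: "'a \<Rightarrow> nat"
  assumes x: "x \<in> pverts G"
    and par: "\<And>v. v \<in> pverts G - {x} \<Longrightarrow> (v, f v) \<in> parcs G"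
    and rank: "\<And>v. v \<in> pverts G - {x} \<Longrightarrow> h (f v) < h v"
    and inner: "\<And>u. u \<in> pverts G - {x} \<Longrightarrow> card {v \<in> pverts G - {x}. f v = u} \<noteq> 1"
    and root: "card {v \<in> pverts G - {x}. f v = x} \<noteq> 2"
  shows "\<exists>T. HIST T G"
proof -
  define V where "V = pverts G"
  define F where "F = (\<lambda>v. (v, f v)) ` (V - {x}) \<union> (\<lambda>v. (f v, v)) ` (V - {x})"
  define T where "T = \<lparr> pverts = V, parcs = F \<rparr>"
  have finV: "finite V" using pair_finite_verts by (simp add: V_def)
  have FG: "F \<subseteq> parcs G"
    using par parcs_sym by (auto simp: F_def V_def)
  have FV: "u \<in> V \<and> v \<in> V \<and> u \<noteq> v" if "(u, v) \<in> F" for u v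
    using that FG in_arcsD1 in_arcsD2 pair_no_loops unfolding V_def by fastforce
  have symF: "(v, u) \<in> F" if "(u, v) \<in> F" for u v
    using that by (auto simp: F_def)
  interpret T: pair_graph T
  proof
    show "finite (parcs T)" using finV by (simp add: T_def F_def)
    show "symmetric (with_proj T)" unfolding symmetric_def
      using symF by (auto simp: T_def sym_def)
  qed (use finV FV in \<open>auto simp: T_def\<close>)
  have up: "w = f v \<or> (w \<in> V - {x} \<and> f w = v)" if "(v, w) \<in> F" for v w
    using that by (auto simp: F_def)
  have reach: "(v, x) \<in> rtrancl_on V F" if "v \<in> V" for v
    using that
  proof (induction "h v" arbitrary: v rule: less_induct)
    case less
    show ?case
    proof (cases "v = x")
      case False
      then have v: "v \<in> V - {x}" using less.prems by simp
      then have "(v, f v) \<in> F" by (simp add: F_def)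
      moreover from this have "f v \<in> V" using FV by blast
      moreover have "h (f v) < h v" using rank v by (simp add: V_def)
      ultimately show ?thesis
        using less by (meson converse_rtrancl_on_into_rtrancl_on)
    qed (use less.prems in simp)
  qed
  have conn: "Digraph_Component.connected (with_proj T)"
  proof -
    have "(u, v) \<in> rtrancl_on V F" if "u \<in> V" "v \<in> V" for u v
    proof -
      have "sym (rtrancl_on V F)"
        by (rule rtrancl_on_sym) (use symF in \<open>auto simp: sym_def\<close>)
      then show ?thesis
        using reach[OF that(1)] reach[OF that(2)] by (meson rtrancl_on_trans symE)
    qed
    then show ?thesis
      using x T.parcs_mk_symmetric
      by (auto simp: Digraph_Component.connected_def strongly_connected_def reachable_def
          mk_symmetric_def T_def V_def)
  qed
  have acyc: "\<not> (\<exists>p. pre_digraph.cycle (with_proj T) p \<and> 3 \<le> length p)"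
  proof
    assume "\<exists>p. pre_digraph.cycle (with_proj T) p \<and> 3 \<le> length p"
    then obtain p where p: "pre_digraph.cycle (with_proj T) p" "3 \<le> length p" by blast
    then obtain u where u: "T.awalk u p u" "distinct (tl (pawalk_verts u p))"
      by (auto simp: T.cycle_def)
    define vs where "vs = pawalk_verts u p"
    define m where "m = length p"
    have pc: "pcas u p u" and pF: "set p \<subseteq> F"
      using u(1)[unfolded T.awalk_def] by (simp_all add: T_def)
    note nth = pawalk_nth[OF pc, folded vs_def m_def]
    have arc: "(vs ! i, vs ! Suc i) \<in> F" if "i < m" for i
      using pF nth(4)[OF that] that nth_mem unfolding m_def by fastforce
    have inj: "vs ! i \<noteq> vs ! j" if "i \<in> {1..m}" "j \<in> {1..m}" "i \<noteq> j" for i j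
    proof -
      have "vs ! i = tl vs ! (i - 1)" "vs ! j = tl vs ! (j - 1)"
        using that nth(1) by (auto simp: nth_tl)
      then show ?thesis
        using that u(2) nth(1) unfolding vs_def[symmetric]
        by (auto simp: nth_eq_iff_index_eq)
    qed
    have "m \<ge> 3" using p by (simp add: m_def)
    \<comment> \<open>The vertex of maximal rank on the cycle has no child on it, because a child
      has larger rank. Both its cycle neighbours would then be its unique parent.\<close>
    obtain k where k: "k \<in> {1..m}" and kmax: "\<And>i. i \<in> {1..m} \<Longrightarrow> h (vs ! i) \<le> h (vs ! k)"
    proof -
      let ?H = "(\<lambda>i. h (vs ! i)) ` {1..m}"
      have "Max ?H \<in> ?H" using \<open>m \<ge> 3\<close> by (intro Max_in) auto
      then obtain k where "k \<in> {1..m}" "h (vs ! k) = Max ?H" by auto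
      then show ?thesis using that by simp
    qed
    \<comment> \<open>Cyclic predecessor and successor among the positions 1 to \<open>m\<close>;
      position 0 repeats the vertex at \<open>m\<close>. They differ because
      \<open>3 \<le> m\<close>.\<close>
    define i where "i = (if k = 1 then m else k - 1)"
    define j where "j = (if k = m then 1 else Suc k)"
    have ij: "i \<in> {1..m}" "j \<in> {1..m}" "i \<noteq> j"
      using k \<open>m \<ge> 3\<close> by (auto simp: i_def j_def)
    have "(vs ! i, vs ! k) \<in> F"
      using arc[of "k - 1"] k nth(2,3) by (auto simp: i_def)
    then have "(vs ! k, vs ! i) \<in> F" by (rule symF)
    moreover have "(vs ! k, vs ! j) \<in> F"
      using arc[of k] arc[of 0] k nth(2,3) \<open>m \<ge> 3\<close> by (auto simp: j_def)
    ultimately have "vs ! i = f (vs ! k)" "vs ! j = f (vs ! k)"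
      using up kmax ij(1,2) rank unfolding V_def by (metis not_less)+
    then show False using inj[OF ij] by simp
  qed
  have deg: "degree T u \<noteq> 2" if "u \<in> V" for u
  proof (cases "u = x")
    case True
    have "{w. (x, w) \<in> F} = {v \<in> V - {x}. f v = x}"
      by (auto simp: F_def)
    then show ?thesis using root True by (simp add: degree_conv_card T_def V_def)
  next
    case False
    let ?C = "{v \<in> V - {x}. f v = u}"
    have "{w. (u, w) \<in> F} = insert (f u) ?C"
      using False that by (auto simp: F_def)
    moreover have "f u \<notin> ?C"
      using rank[of u] rank[of "f u"] that False by (auto simp: V_def)
    ultimately have "degree T u = Suc (card ?C)"
      using finV by (simp add: degree_conv_card T_def)
    then show ?thesis using inner[of u] that False by (simp add: V_def)
  qed
  have "spanning (with_proj T) (with_proj G)"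
    using FG T.wf_digraph wf_digraph
    by (auto simp: spanning_def subgraph_def compatible_def T_def V_def)
  then have "HIST T G"
    using conn acyc deg T.pair_graph_axioms
    by (auto simp: HIST_def undirected_tree_def T_def)
  then show ?thesis by blast
qed

lemma ex_not_in_of_card_less:
  assumes "finite F" "card F < card A"
  shows "\<exists>b\<in>A. b \<notin> F"
  using assms by (meson card_mono leD subsetI)

lemma ex_member: "0 < card A \<Longrightarrow> \<exists>b. b \<in> A"
  by (metis all_not_in_conv card.empty less_irrefl)

lemma ex_member_ne: "1 < card A \<Longrightarrow> \<exists>b\<in>A. b \<noteq> p"
  using ex_not_in_of_card_less[of "{p}" A] by auto

lemma ex_member_ne2: "2 < card A \<Longrightarrow> \<exists>b\<in>A. b \<noteq> p \<and> b \<noteq> q"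
  using ex_not_in_of_card_less[of "{p, q}" A] card_insert_le_m1[of 2 "{q}" p] by force

lemma ex_member_ne3: "3 < card A \<Longrightarrow> \<exists>b\<in>A. b \<noteq> p \<and> b \<noteq> q \<and> b \<noteq> s"
  using ex_not_in_of_card_less[of "{p, q, s}" A] by (force simp: card_insert_if split: if_splits)

lemma ex_member_ne4: "4 < card A \<Longrightarrow> \<exists>b\<in>A. b \<noteq> p \<and> b \<noteq> q \<and> b \<noteq> s \<and> b \<noteq> t"
  using ex_not_in_of_card_less[of "{p, q, s, t}" A] by (force simp: card_insert_if split: if_splits)

section \<open>Growing irreducible trees rooted at \<open>x\<close>\<close>

context pair_graph
begin

definition nb :: "'a \<Rightarrow> 'a set" where
  "nb v = {w. (v, w) \<in> parcs G}"

lemma nb_commute: "w \<in> nb v \<longleftrightarrow> v \<in> nb w"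
  using parcs_sym by (auto simp: nb_def)

lemma nb_irrefl[simp]: "v \<notin> nb v"
  using pair_no_loops by (fastforce simp: nb_def)

lemma nb_subset: "nb v \<subseteq> pverts G"
  by (auto simp: nb_def dest: in_arcsD2)

lemma finite_nb[simp]: "finite (nb v)"
  using nb_subset pair_finite_verts by (rule finite_subset)

lemma degree_eq_card_nb: "degree G v = card (nb v)"
  by (simp add: degree_conv_card nb_def)

definition kids :: "'a set \<Rightarrow> ('a \<Rightarrow> 'a) \<Rightarrow> 'a \<Rightarrow> 'a \<Rightarrow> 'a set" where
  "kids S f x u = {v \<in> S - {x}. f v = u}"

text \<open>A homeomorphically irreducible tree on the vertex set \<open>S\<close> with root
  \<open>x\<close> and parent map \<open>f\<close>. At the root, at least 3 children are required
  instead of a number different from 2, because only the former survives the addition of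
  children.\<close>

definition hit :: "'a set \<Rightarrow> ('a \<Rightarrow> 'a) \<Rightarrow> 'a \<Rightarrow> bool" where
  "hit S f x \<longleftrightarrow> x \<in> S \<and> S \<subseteq> pverts G \<and> (\<forall>v\<in>S - {x}. f v \<in> S \<and> v \<in> nb (f v)) \<and>
     (\<exists>h::'a \<Rightarrow> nat. \<forall>v\<in>S - {x}. h (f v) < h v) \<and>
     (\<forall>u\<in>S - {x}. card (kids S f x u) \<noteq> 1) \<and> 3 \<le> card (kids S f x x)"

lemma HIST_of_hit:
  assumes "hit (pverts G) f x"
  shows "\<exists>T. HIST T G"
proof -
  obtain h :: "'a \<Rightarrow> nat" where "\<forall>v\<in>pverts G - {x}. h (f v) < h v"
    using assms by (auto simp: hit_def)
  then show ?thesis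
    using assms nb_commute[of "f _"]
    by (intro HIST_of_parent_map[of x f h]) (auto simp: hit_def kids_def nb_def)
qed

lemma hit_star:
  assumes "x \<in> pverts G" "L \<subseteq> nb x" "3 \<le> card L"
  shows "hit (insert x L) (\<lambda>_. x) x"
proof -
  have "x \<notin> L" using assms(2) by auto
  then have "kids (insert x L) (\<lambda>_. x) x u = (if u = x then L else {})" for u
    by (auto simp: kids_def)
  moreover have "\<exists>h::'a \<Rightarrow> nat. \<forall>v\<in>insert x L - {x}. h x < h v"
    by (rule exI[of _ "\<lambda>v. if v = x then 0 else 1"]) auto
  moreover have "L \<subseteq> pverts G" using assms(2) nb_subset by (rule subset_trans)
  ultimately show ?thesis
    using assms by (auto simp: hit_def)
qed

text \<open>Two numbers different from 1 never add up to 1, so \<open>l\<close> may be a leaf or may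
  already have children. The empty set is allowed for \<open>A\<close>, which spares case
  distinctions when a remainder is hung somewhere.\<close>

lemma hit_expand:
  assumes hit: "hit S f x" and l: "l \<in> S" and A: "A \<subseteq> nb l" "A \<inter> S = {}" "card A \<noteq> 1"
  shows "hit (S \<union> A) (\<lambda>v. if v \<in> A then l else f v) x"
proof -
  let ?f = "\<lambda>v. if v \<in> A then l else f v"
  obtain h :: "'a \<Rightarrow> nat" where h: "\<forall>v\<in>S - {x}. h (f v) < h v"
    using hit by (auto simp: hit_def)
  have par: "\<forall>v\<in>S - {x}. f v \<in> S \<and> v \<in> nb (f v)" and x: "x \<in> S" and SV: "S \<subseteq> pverts G"
    using hit by (auto simp: hit_def)
  have finS: "finite S" using SV pair_finite_verts by (rule finite_subset)
  have finA: "finite A" using A(1) finite_nb by (rule finite_subset)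
  have kids: "kids (S \<union> A) ?f x u = kids S f x u \<union> (if u = l then A else {})" for u
    using A x by (auto simp: kids_def)
  have card_kids: "card (kids (S \<union> A) ?f x u) = card (kids S f x u) + (if u = l then card A else 0)" for u
    unfolding kids using finS finA A(2) by (subst card_Un_disjoint) (auto simp: kids_def)
  have leaf: "kids S f x u = {}" if "u \<in> A" for u
    using that par A(2) by (auto simp: kids_def)
  have rank: "\<exists>h::'a \<Rightarrow> nat. \<forall>v\<in>S \<union> A - {x}. h (?f v) < h v"
    by (rule exI[of _ "\<lambda>v. if v \<in> A then Suc (h l) else h v"]) (use h A l par in auto)
  show ?thesis unfolding hit_def
  proof (intro conjI ballI rank)
    show "S \<union> A \<subseteq> pverts G" using SV A(1) nb_subset[of l] by blast
    fix u assume u: "u \<in> S \<union> A - {x}"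
    show "?f u \<in> S \<union> A" "u \<in> nb (?f u)" using u l A(1) par by auto
    show "card (kids (S \<union> A) ?f x u) \<noteq> 1"
    proof (cases "u \<in> A")
      case True
      then show ?thesis using leaf card_kids[of u] l A(2) by auto
    next
      case False
      then have "card (kids S f x u) \<noteq> 1" using u hit unfolding hit_def by blast
      then show ?thesis using A(3) card_kids[of u] by (auto split: if_splits)
    qed
  next
    show "3 \<le> card (kids (S \<union> A) ?f x x)" using hit card_kids[of x] by (auto simp: hit_def)
  qed (use x in simp)
qed

end

section \<open>The neighbourhood of a vertex of maximum degree\<close>

text \<open>\<open>ore\<close> is the hypothesis on \<open>sigma2\<close> without truncated
  subtraction.\<close>

locale ore_graph = pair_graph G for G :: "'a pair_pre_digraph" +
  fixes x :: 'a
  assumes xV: "x \<in> pverts G"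
    and conn: "Digraph_Component.connected (with_proj G)"
    and ore: "\<And>u v. \<lbrakk>u \<in> pverts G; v \<in> pverts G; u \<noteq> v; v \<notin> nb u\<rbrakk>
      \<Longrightarrow> card (pverts G) \<le> card (nb u) + card (nb v) + 2"
    and maxdeg: "\<And>v. v \<in> pverts G \<Longrightarrow> card (nb v) \<le> card (nb x)"
    and ten: "10 \<le> card (pverts G)"
begin

definition N :: "'a set" where "N = nb x"
definition R :: "'a set" where "R = pverts G - insert x N"
definition dN :: "'a \<Rightarrow> nat" where "dN v = card (nb v \<inter> N)"
definition dR :: "'a \<Rightarrow> nat" where "dR v = card (nb v \<inter> R)"

lemma finN[simp]: "finite N" by (simp add: N_def)
lemma finR[simp]: "finite R" using pair_finite_verts by (simp add: R_def)

lemma V_eq: "pverts G = insert x (N \<union> R)"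
  using nb_subset[of x] xV by (auto simp: N_def R_def)

lemma sep[simp]: "x \<notin> N" "x \<notin> R" "N \<inter> R = {}" "R \<inter> N = {}"
  by (auto simp: R_def N_def)

lemma N_D: "v \<in> N \<Longrightarrow> v \<notin> R \<and> v \<noteq> x" and R_D: "v \<in> R \<Longrightarrow> v \<notin> N \<and> v \<noteq> x"
  by (auto simp: R_def N_def)

lemma nb_x[simp]: "nb x = N" by (simp add: N_def)

lemma x_nb[simp]: "x \<in> nb v \<longleftrightarrow> v \<in> N"
  using nb_commute[of x v] by simp

lemma cardV: "card (pverts G) = Suc (card N + card R)"
  unfolding V_eq by (simp add: card_Un_disjoint)

lemma big: "9 \<le> card N + card R"
  using ten by (simp add: cardV)

lemma nb_eq: "nb v = (if v \<in> N then {x} else {}) \<union> (nb v \<inter> N) \<union> (nb v \<inter> R)"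
  using nb_subset[of v] V_eq by auto

lemma nb_cases: "w \<in> nb v \<Longrightarrow> w \<noteq> x \<Longrightarrow> w \<notin> N \<Longrightarrow> w \<in> R"
  using nb_subset[of v] V_eq by auto

lemma deg_split: "card (nb v) = (if v \<in> N then 1 else 0) + dN v + dR v"
proof -
  have "card (nb v) = card ((if v \<in> N then {x} else {}) \<union> ((nb v \<inter> N) \<union> (nb v \<inter> R)))"
    by (rule arg_cong[OF nb_eq[of v, unfolded Un_assoc], of card])
  also have "\<dots> = (if v \<in> N then 1 else 0) + card ((nb v \<inter> N) \<union> (nb v \<inter> R))"
    by (subst card_Un_disjoint) auto
  also have "card ((nb v \<inter> N) \<union> (nb v \<inter> R)) = dN v + dR v"
    unfolding dN_def dR_def by (subst card_Un_disjoint) (auto dest: R_D)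
  finally show ?thesis by simp
qed

lemma degN: "v \<in> N \<Longrightarrow> card (nb v) = Suc (dN v + dR v)" by (simp add: deg_split)
lemma degR: "v \<in> R \<Longrightarrow> card (nb v) = dN v + dR v" by (simp add: deg_split R_D)

lemma ore_NR: "\<lbrakk>u \<in> N \<union> R; v \<in> N \<union> R; u \<noteq> v; v \<notin> nb u\<rbrakk>
    \<Longrightarrow> card N + card R \<le> card (nb u) + card (nb v) + 1"
  using ore[of u v] cardV V_eq by auto

lemma deg_R_ge: "v \<in> R \<Longrightarrow> card R \<le> dN v + dR v + 1"
  using ore[of x v] cardV V_eq degR[of v] R_D[of v] by auto

lemma deg_le: "v \<in> N \<union> R \<Longrightarrow> card (nb v) \<le> card N"
  using maxdeg V_eq by auto

text \<open>The degree of a vertex of \<open>R\<close> lies between \<open>card R - 1\<close>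
  (degree sum with \<open>x\<close>) and \<open>card N\<close> (maximality of \<open>x\<close>).
  With \<open>big\<close> this gives \<open>N4\<close>, so at least one child of \<open>x\<close>
  can always be moved.\<close>

lemma card_R_le: "card R \<le> card N + 1"
proof (cases "R = {}")
  case False
  then obtain v where "v \<in> R" by blast
  then show ?thesis using deg_R_ge[of v] deg_le[of v] degR[of v] by auto
qed simp

lemma N4: "4 \<le> card N" using big card_R_le by linarith

lemma dR_le: "v \<in> R \<Longrightarrow> dR v < card R"
proof -
  assume "v \<in> R"
  then have "nb v \<inter> R \<subset> R" using nb_irrefl[of v] by blast
  then show ?thesis unfolding dR_def by (intro psubset_card_mono) auto
qed

text \<open>
  Explicit trees are given by the set \<open>F\<close> of neighbours of \<open>x\<close> that are not children of \<open>x\<close> and a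
  list of pairs \<open>(l, A)\<close>: starting from the star on \<open>x\<close> and \<open>N - F\<close>, the set \<open>A\<close> is hung below the
  vertex \<open>l\<close> of the tree built so far.
\<close>

primrec expands :: "'a set \<Rightarrow> 'a set \<Rightarrow> ('a \<times> 'a set) list \<Rightarrow> bool" where
  "expands F S [] \<longleftrightarrow> F \<subseteq> S \<and> R \<subseteq> S"
| "expands F S (p # ps) \<longleftrightarrow> fst p \<in> S \<and> snd p \<subseteq> nb (fst p) \<and> snd p \<inter> S = {} \<and> card (snd p) \<noteq> 1 \<and>
     expands F (S \<union> snd p) ps"

lemma HIST_by_expansions:
  assumes "card F + 3 \<le> card N" "expands F (insert x (N - F)) ps" "finite F"
  shows "\<exists>T. HIST T G"
proof -
  have "\<exists>T. HIST T G" if "expands F S ps" "hit S f x" "N - F \<subseteq> S" for S f ps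
    using that
  proof (induction ps arbitrary: S f)
    case Nil
    have "S \<subseteq> pverts G" "x \<in> S" using Nil.prems by (auto simp: hit_def)
    then have "S = pverts G" using Nil.prems V_eq by auto
    then show ?case using Nil.prems HIST_of_hit by blast
  next
    case (Cons p ps)
    then show ?case using hit_expand[of S f x "fst p" "snd p"] by (meson expands.simps(2) le_supI1)
  qed
  moreover have "hit (insert x (N - F)) (\<lambda>_. x) x"
  proof (rule hit_star)
    show "3 \<le> card (N - F)" using assms(1,3) diff_card_le_card_Diff[of F N] by linarith
  qed (use xV in auto)
  ultimately show ?thesis using assms(2) by blast
qed

section \<open>At most one vertex outside the closed neighbourhood of \<open>x\<close>\<close>

lemma HIST_if_R_empty: "R = {} \<Longrightarrow> \<exists>T. HIST T G"
  by (rule HIST_by_expansions[of "{}" "[]"]) (use N4 in auto)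

lemma R_linked: "R \<noteq> {} \<Longrightarrow> \<exists>c\<in>N. \<exists>v\<in>R. v \<in> nb c"
proof -
  assume "R \<noteq> {}"
  moreover have "R \<noteq> pverts G" using xV by (auto simp: R_def)
  ultimately obtain v u where "v \<in> R" "u \<in> pverts G - R" "(v, u) \<in> parcs G"
    using connected_arc_leaving[OF conn, of R] V_eq by auto
  then have "u \<in> nb v" "u \<in> insert x N" using V_eq by (auto simp: nb_def)
  then show ?thesis using \<open>v \<in> R\<close> R_D[of v] nb_commute[of u v] by auto
qed

text \<open>A neighbour \<open>a\<close> of \<open>y\<close> with a further neighbour
  \<open>c\<close> could take \<open>y\<close> and \<open>c\<close> as children, so all neighbours
  of \<open>y\<close> have degree 2. Two of them would be nonadjacent with degree sum 4, too small.
  Hence \<open>y\<close> has degree 1, and its degree sum with any other \<open>c\<close> in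
  \<open>N\<close> forces \<open>c\<close> to see everything except \<open>a\<close> and
  \<open>y\<close>.\<close>

lemma structure_if_R_singleton:
  assumes R: "R = {y}" and no_hist: "\<nexists>T. HIST T G"
  shows "\<exists>a\<in>N. nb y = {a} \<and> nb a = {x, y} \<and> (\<forall>c\<in>N - {a}. nb c = insert x (N - {a, c}))"
proof -
  have yR: "y \<in> R" and RS: "R \<subseteq> {y}" using R by simp_all
  have dead: "nb a = {x, y}" if a: "a \<in> N" "a \<in> nb y" for a
  proof (rule ccontr)
    assume "nb a \<noteq> {x, y}"
    moreover have "{x, y} \<subseteq> nb a" using a nb_commute[of a y] by simp
    ultimately obtain c where c: "c \<in> nb a" "c \<noteq> x" "c \<noteq> y" by blast
    then have "c \<in> N" using nb_cases[of c a] R by blast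
    have "c \<noteq> a" using c by auto
    have "\<exists>T. HIST T G"
      by (rule HIST_by_expansions[of "{c}" "[(a, {y, c})]"])
        (use N4 a c R_D[OF yR] RS \<open>c \<in> N\<close> \<open>c \<noteq> a\<close> nb_commute[of y a] in auto)
    then show False using no_hist by blast
  qed
  obtain a where a: "a \<in> N" "a \<in> nb y"
    using R_linked R nb_commute[of y] by fastforce
  have nba: "nb a = {x, y}" using dead a by blast
  have "a' = a" if "a' \<in> N" "a' \<in> nb y" for a'
  proof (rule ccontr)
    assume "a' \<noteq> a"
    then have "card N + card R \<le> card (nb a) + card (nb a') + 1"
      by (intro ore_NR) (use a that R_D[OF yR] nba in auto)
    also have "\<dots> \<le> 5" using nba dead[OF that] by (simp add: card_insert_if)
    finally show False using big by simp
  qed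
  moreover have "w \<in> N" if "w \<in> nb y" for w
  proof (rule ccontr)
    assume "w \<notin> N"
    moreover have "w \<noteq> x" using that R_D[OF yR] by auto
    ultimately have "w = y" using nb_cases[OF that] R by blast
    then show False using that by simp
  qed
  ultimately have nby: "nb y = {a}" using a by blast
  have "nb c = insert x (N - {a, c})" if c: "c \<in> N - {a}" for c
  proof (rule card_subset_eq)
    have "y \<notin> nb c" using nby c nb_commute[of y c] by auto
    have "a \<notin> nb c" using nba c R_D[OF yR] nb_commute[of a c] by auto
    show sub: "nb c \<subseteq> insert x (N - {a, c})"
    proof
      fix w assume w: "w \<in> nb c"
      then have "w \<noteq> c" "w \<noteq> a" "w \<noteq> y" using \<open>a \<notin> nb c\<close> \<open>y \<notin> nb c\<close> by auto
      then show "w \<in> insert x (N - {a, c})" using nb_cases[OF w] R by blast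
    qed
    have "card N + card R \<le> card (nb y) + card (nb c) + 1"
      by (intro ore_NR) (use c yR R_D[OF yR] nby in auto)
    then have "card N - 1 \<le> card (nb c)" using R nby by simp
    moreover have "card (insert x (N - {a, c})) = card N - 1"
      using c a N4 by (auto simp: card_Diff_subset)
    ultimately show "card (nb c) = card (insert x (N - {a, c}))"
      using card_mono[OF _ sub] by simp
  qed simp
  then show ?thesis using a nby nba by blast
qed

end

lemma card_2_with:
  assumes "card A = 2" "p \<in> A"
  shows "\<exists>q. A = {p, q} \<and> q \<noteq> p"
proof -
  have "card (A - {p}) = 1" using assms by simp
  then obtain q where "A - {p} = {q}" by (meson card_1_singletonE)
  then show ?thesis using assms(2) by blast
qed

lemma card_3_with:
  assumes "card A = 3" "p \<in> A" "q \<in> A" "p \<noteq> q"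
  shows "\<exists>s. A = {p, q, s} \<and> s \<noteq> p \<and> s \<noteq> q"
proof -
  have "card (A - {p}) = 2" "q \<in> A - {p}" using assms by auto
  then obtain s where "A - {p} = {q, s}" "s \<noteq> q" using card_2_with by metis
  then show ?thesis using assms(2) by blast
qed

context ore_graph
begin

lemma nb_R: "v \<in> R \<Longrightarrow> nb v \<subseteq> N \<union> R"
  using nb_cases[of _ v] x_nb[of v] R_D[of v] by fast

lemma nb_N: "nb v \<subseteq> insert x (N \<union> R)"
  using nb_cases[of _ v] by fast

lemma dN_pos: "c \<in> N \<Longrightarrow> c \<in> nb v \<Longrightarrow> 0 < dN v"
  unfolding dN_def by (auto simp: card_gt_0_iff)

lemma dR_pos: "c \<in> R \<Longrightarrow> c \<in> nb v \<Longrightarrow> 0 < dR v"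
  unfolding dR_def by (auto simp: card_gt_0_iff)

lemma ex_nb_N: "0 < dN v \<Longrightarrow> \<exists>c\<in>N. c \<in> nb v"
  using ex_member[of "nb v \<inter> N"] unfolding dN_def by blast

lemma ex_nb_N_ne: "1 < dN v \<Longrightarrow> \<exists>c\<in>N. c \<in> nb v \<and> c \<noteq> p"
  using ex_member_ne[of "nb v \<inter> N"] unfolding dN_def by blast

lemma ex_nb_N_ne2: "2 < dN v \<Longrightarrow> \<exists>c\<in>N. c \<in> nb v \<and> c \<noteq> p \<and> c \<noteq> q"
  using ex_member_ne2[of "nb v \<inter> N"] unfolding dN_def by blast

lemma ex_nb_N_ne3: "3 < dN v \<Longrightarrow> \<exists>c\<in>N. c \<in> nb v \<and> c \<noteq> p \<and> c \<noteq> q \<and> c \<noteq> s"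
  using ex_member_ne3[of "nb v \<inter> N"] unfolding dN_def by blast

lemma dR_mono: "nb v \<inter> R \<subseteq> B \<Longrightarrow> finite B \<Longrightarrow> dR v \<le> card B"
  unfolding dR_def by (rule card_mono)

lemma dN_mono: "nb v \<inter> N \<subseteq> B \<Longrightarrow> finite B \<Longrightarrow> dN v \<le> card B"
  unfolding dN_def by (rule card_mono)

lemma dR_full: "nb v \<inter> R \<subseteq> B \<Longrightarrow> finite B \<Longrightarrow> card B \<le> dR v \<Longrightarrow> B \<subseteq> nb v"
  unfolding dR_def using card_seteq[of B "nb v \<inter> R"] by blast

lemma dN_full: "nb v \<inter> N \<subseteq> B \<Longrightarrow> finite B \<Longrightarrow> card B \<le> dN v \<Longrightarrow> B \<subseteq> nb v"
  unfolding dN_def using card_seteq[of B "nb v \<inter> N"] by blast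

section \<open>A vertex of \<open>R\<close> with at most one neighbour in \<open>N\<close>\<close>

lemma nb_y_of_dN_zero:
  assumes "y \<in> R" "dN y = 0"
  shows "nb y = R - {y}"
proof -
  have "nb y \<inter> R \<subseteq> R - {y}" by auto
  moreover have "card (R - {y}) \<le> dR y" using deg_R_ge[of y] assms by simp
  ultimately have "R - {y} \<subseteq> nb y" using dR_full[of y "R - {y}"] by simp
  moreover have "nb y \<inter> N = {}" using assms(2) by (simp add: dN_def)
  moreover have "nb y \<subseteq> N \<union> R" using assms(1) by (rule nb_R)
  moreover have "y \<notin> nb y" by simp
  ultimately show ?thesis by blast
qed

text \<open>\<open>y\<close> has degree exactly \<open>card R - 1\<close> and misses
  \<open>c\<close>, so the degree sum condition pushes \<open>c\<close> up to the maximum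
  degree.\<close>

lemma deg_N_of_dN_zero:
  assumes y: "y \<in> R" "nb y = R - {y}" and c: "c \<in> N"
  shows "Suc (dN c + dR c) = card N"
proof -
  have "card N + card R \<le> card (nb y) + card (nb c) + 1"
    by (rule ore_NR) (use y c R_D[OF y(1)] N_D[OF c] in auto)
  moreover have "Suc (card (nb y)) = card R" unfolding y(2) using card_Suc_Diff1[OF finR y(1)] .
  moreover have "card (nb c) \<le> card N" using deg_le c by blast
  ultimately show ?thesis using degN[OF c] by linarith
qed

text \<open>The path from \<open>x\<close> over \<open>c1\<close> and \<open>v\<close> to
  \<open>y\<close> becomes a tree once \<open>c1\<close> and \<open>v\<close> get companions from
  \<open>N\<close>. If \<open>v\<close> had no neighbour in \<open>N\<close> besides
  \<open>c1\<close>, all other vertices of \<open>N\<close> would need the whole of \<open>N\<close>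
  to reach degree \<open>card N\<close>; then \<open>c1\<close> would see \<open>x\<close>,
  \<open>v\<close> and the rest of \<open>N\<close>, exceeding the maximum degree.\<close>

lemma HIST_separated_2:
  assumes y: "y \<in> R" "nb y = R - {y}" and r: "card R = 2"
  shows "\<exists>T. HIST T G"
proof -
  obtain v where R: "R = {y, v}" and vy: "v \<noteq> y"
    using card_2_with[OF r y(1)] by blast
  have vR: "v \<in> R" and RS: "R \<subseteq> {y, v}" using R by simp_all
  have yv: "y \<in> nb v" "v \<in> nb y" using y R vy nb_commute[of y v] by auto
  have N7: "7 \<le> card N" using big r by simp
  have yN: "y \<notin> nb b" if "b \<in> N" for b
    using N_D[OF that] y(2) nb_commute[of y b] by auto
  have dR1: "nb b \<inter> R \<subseteq> {v}" if "b \<in> N" for b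
    using yN[OF that] R by auto
  obtain c1 where c1: "c1 \<in> N" "c1 \<in> nb v"
    using R_linked R dR1 nb_commute by (metis IntI empty_iff insert_not_empty singletonD subsetD)
  have dNc1: "5 \<le> dN c1"
    using deg_N_of_dN_zero[OF y c1(1)] N7 dR_mono[OF dR1[OF c1(1)]] by simp
  show ?thesis
  proof (cases "1 < dN v")
    case True
    obtain c2 where c2: "c2 \<in> N" "c2 \<in> nb v" "c2 \<noteq> c1" using ex_nb_N_ne[OF True] by blast
    obtain c' where c': "c' \<in> N" "c' \<in> nb c1" "c' \<noteq> c2"
      using ex_nb_N_ne[of c1 c2] dNc1 by auto
    have "c' \<noteq> c1" using c' by auto
    then show ?thesis
      by (intro HIST_by_expansions[of "{c', c2}" "[(c1, {v, c'}), (v, {y, c2})]"])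
        (use N7 c1 c2 c' N_D[OF c1(1)] N_D[OF c2(1)] N_D[OF c'(1)] yv vy R_D[OF vR] R_D[OF y(1)] RS in \<open>auto simp: nb_commute card_insert_if\<close>)
  next
    case False
    have nbv: "nb v \<inter> N = {c1}"
      using False c1 by (intro card_seteq[symmetric]) (auto simp: dN_def)
    have "b \<in> nb c1" if b: "b \<in> N - {c1}" for b
    proof -
      have "nb b \<inter> R = {}" using dR1[of b] b nbv nb_commute[of b v] by auto
      then have "card (N - {b}) \<le> dN b"
        using deg_N_of_dN_zero[OF y, of b] b by (simp add: dR_def)
      then have "N - {b} \<subseteq> nb b" by (intro dN_full) auto
      then show ?thesis using b c1 nb_commute[of b c1] by auto
    qed
    then have "card (N - {c1}) \<le> dN c1" unfolding dN_def by (intro card_mono) auto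
    moreover have "0 < dR c1" using dR_pos[of v c1] vR c1 nb_commute[of v c1] by simp
    ultimately show ?thesis using deg_N_of_dN_zero[OF y c1(1)] c1 by simp
  qed
qed

text \<open>Either of the two vertices other than \<open>y\<close> may serve as the link
  \<open>v\<close> to \<open>y\<close>. If they are adjacent, \<open>v\<close> takes both
  \<open>y\<close> and \<open>z\<close>. Otherwise their degree sum gives them at least
  \<open>card N\<close> neighbours in \<open>N\<close> altogether, so one of them has two and can be
  \<open>v\<close>. The worst tree moves three children of \<open>x\<close>, which
  \<open>6 \<le> card N\<close> just permits.\<close>

lemma HIST_separated_3:
  assumes y: "y \<in> R" "nb y = R - {y}" and r: "card R = 3"
  shows "\<exists>T. HIST T G"
proof -
  have N6: "6 \<le> card N" using big r by simp
  have yN: "y \<notin> nb b" if "b \<in> N" for b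
    using N_D[OF that] y(2) nb_commute[of y b] by auto
  have dN3: "3 \<le> dN b" if "b \<in> N" for b
  proof -
    have "dR b \<le> card (R - {y})" by (rule dR_mono) (use yN[OF that] in auto)
    then show ?thesis using deg_N_of_dN_zero[OF y that] N6 r y(1) by simp
  qed
  have main: "\<exists>T. HIST T G"
    if R: "R = {y, v, z}" and ne: "v \<noteq> y" "z \<noteq> y" "v \<noteq> z" and c: "c \<in> N" "c \<in> nb v"
      and alt: "z \<in> nb v \<or> 1 < dN v \<and> 0 < dN z" for v z c
  proof -
    have RR: "v \<in> R" "z \<in> R" and RS: "R \<subseteq> {y, v, z}" using R by auto
    note RD = R_D[OF RR(1)] R_D[OF RR(2)] R_D[OF y(1)]
    have adj: "y \<in> nb v" "y \<in> nb z" using y R ne nb_commute[of y] by auto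
    show ?thesis
    proof (cases "z \<in> nb v")
      case True
      obtain c' where c': "c' \<in> N" "c' \<in> nb c" using ex_nb_N[of c] dN3[OF c(1)] by auto
      have "c' \<noteq> c" using c' by auto
      then show ?thesis
        by (intro HIST_by_expansions[of "{c'}" "[(c, {v, c'}), (v, {y, z})]"])
          (use N6 c c' N_D[OF c(1)] N_D[OF c'(1)] True ne adj RD RS in \<open>auto simp: nb_commute card_insert_if\<close>)
    next
      case False
      then have d: "1 < dN v" "0 < dN z" using alt by auto
      have common: "\<exists>T. HIST T G"
        if c1: "c1 \<in> N" "c1 \<in> nb v" "c1 \<in> nb z" for c1
      proof -
        obtain c2 where c2: "c2 \<in> N" "c2 \<in> nb v" "c2 \<noteq> c1" using ex_nb_N_ne[OF d(1)] by blast
        show ?thesis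
          by (rule HIST_by_expansions[of "{c2}" "[(c1, {v, z}), (v, {y, c2})]"])
            (use N6 c1 c2 N_D[OF c1(1)] N_D[OF c2(1)] ne adj RD RS in \<open>auto simp: nb_commute card_insert_if\<close>)
      qed
      show ?thesis
      proof (cases "\<exists>c1\<in>N. c1 \<in> nb v \<and> c1 \<in> nb z")
        case True
        then show ?thesis using common by blast
      next
        case no_common: False
        obtain c2 where c2: "c2 \<in> N" "c2 \<in> nb v" "c2 \<noteq> c" using ex_nb_N_ne[OF d(1)] by blast
        obtain b where b: "b \<in> N" "b \<in> nb z" using ex_nb_N[OF d(2)] by blast
        have bv: "b \<notin> nb v" using no_common b by blast
        then have "nb b \<inter> R \<subseteq> {z}" using R yN[OF b(1)] nb_commute[of b v] by auto
        then have dNb: "4 \<le> dN b"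
          using dR_mono[of b "{z}"] deg_N_of_dN_zero[OF y b(1)] N6 by simp
        obtain c' where c': "c' \<in> N" "c' \<in> nb c" "c' \<noteq> c2" "c' \<noteq> b"
          using ex_nb_N_ne2[of c c2 b] dN3[OF c(1)] by auto
        obtain b' where b': "b' \<in> N" "b' \<in> nb b" "b' \<noteq> c" "b' \<noteq> c2" "b' \<noteq> c'"
          using ex_nb_N_ne3[of b c c2 c'] dNb by auto
        have ne': "c' \<noteq> c" "b' \<noteq> b" "b \<noteq> c" "b \<noteq> c2" using c' b' bv c c2 by auto
        show ?thesis
          by (rule HIST_by_expansions[of "{c', b', c2}" "[(b, {z, b'}), (c, {v, c'}), (v, {y, c2})]"])
            (use N6 c c2 c' b b' N_D[OF c(1)] N_D[OF c2(1)] N_D[OF c'(1)] N_D[OF b(1)] N_D[OF b'(1)] ne ne' adj RD RS in \<open>auto simp: nb_commute card_insert_if\<close>)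
      qed
    qed
  qed
  obtain c w where cw: "c \<in> N" "w \<in> R" "w \<in> nb c" using R_linked y(1) by auto
  have wy: "w \<noteq> y" using cw yN by auto
  then obtain z where R: "R = {y, w, z}" and ne: "z \<noteq> y" "z \<noteq> w"
    using card_3_with[OF r y(1) cw(2)] by metis
  show ?thesis
  proof (cases "z \<in> nb w")
    case True
    then show ?thesis using main[of w z c] R ne cw wy nb_commute[of c w] by auto
  next
    case False
    have RR: "w \<in> R" "z \<in> R" using R by auto
    have "nb w \<inter> R \<subseteq> {y}" "nb z \<inter> R \<subseteq> {y}" using False R nb_commute[of w z] by auto
    then have dRwz: "dR w \<le> 1" "dR z \<le> 1"
      using dR_mono[of w "{y}"] dR_mono[of z "{y}"] by simp_all
    have "card N + card R \<le> card (nb w) + card (nb z) + 1"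
      by (rule ore_NR) (use RR False ne in auto)
    then have sum: "card N \<le> dN w + dN z" using degR RR dRwz r by auto
    have "0 < dN w" using dN_pos[of c w] cw nb_commute[of c w] by auto
    have "0 < dN z" using deg_R_ge[OF RR(2)] dRwz r by simp
    show ?thesis
    proof (cases "1 < dN w")
      case True
      then show ?thesis using main[of w z c] \<open>0 < dN z\<close> R ne cw wy nb_commute[of c w] by auto
    next
      case F: False
      then have "1 < dN z" using sum N6 by simp
      obtain b where "b \<in> N" "b \<in> nb z" using ex_nb_N[OF \<open>0 < dN z\<close>] by blast
      then show ?thesis
        using main[of z w b] \<open>0 < dN w\<close> \<open>1 < dN z\<close> R ne wy by auto
    qed
  qed
qed

lemma nb_third:
  assumes "v \<in> R" "4 \<le> card R"
  shows "\<exists>t\<in>nb v. t \<noteq> p \<and> t \<noteq> q \<and> (t \<in> N \<and> t \<noteq> x \<and> t \<notin> R \<or> t \<in> R \<and> t \<notin> N \<and> t \<noteq> x)"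
proof -
  have "2 < card (nb v)" using deg_R_ge[OF assms(1)] degR[OF assms(1)] assms(2) by simp
  then obtain t where t: "t \<in> nb v" "t \<noteq> p" "t \<noteq> q" using ex_member_ne2[of "nb v" p q] by auto
  then have "t \<in> N \<or> t \<in> R" using nb_R[OF assms(1)] by auto
  then show ?thesis using t N_D[of t] R_D[of t] by auto
qed

text \<open>Since \<open>c\<close> has degree \<open>card N\<close> but at most one neighbour in
  \<open>N\<close>, it sees at least \<open>card N - 2\<close> vertices of \<open>R\<close>. With
  \<open>card_R_le\<close>, at most two vertices of \<open>R\<close> besides \<open>y\<close> escape
  it, collected in \<open>Z\<close>. So \<open>c\<close> takes (almost) all of \<open>Vc\<close>,
  some \<open>v\<close> in \<open>Vc\<close> takes \<open>y\<close> with a companion, and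
  \<open>Z\<close> goes below \<open>v\<close>, \<open>y\<close> or, in one subcase, a vertex of
  \<open>N\<close>.\<close>

lemma HIST_separated_low:
  assumes y: "y \<in> R" "nb y = R - {y}" and r: "4 \<le> card R"
    and c: "c \<in> N" "0 < dR c" "dN c \<le> 1"
  shows "\<exists>T. HIST T G"
proof -
  define Vc where "Vc = nb c \<inter> R"
  define Z where "Z = R - Vc - {y}"
  note yx = R_D[OF y(1)]
  note cx = N_D[OF c(1)]
  have yc: "y \<notin> nb c" using cx y(2) nb_commute[of y c] by auto
  have Vc: "Vc \<subseteq> R" "Vc \<subseteq> nb c" "y \<notin> Vc" "Vc \<inter> N = {}" "x \<notin> Vc" "c \<notin> Vc" "finite Vc"
    using yc sep cx by (auto simp: Vc_def dest: R_D)
  have cVc: "card Vc = dR c" by (simp add: Vc_def dR_def)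
  have dc: "Suc (dN c + dR c) = card N" by (rule deg_N_of_dN_zero[OF y c(1)])
  have Vc2: "2 \<le> card Vc" using cVc dc c(3) N4 by simp
  have "card (R - Vc) = card R - card Vc" using Vc by (simp add: card_Diff_subset)
  then have cZ: "card Z + card Vc + 1 = card R"
    using y(1) Vc card_mono[OF finR Vc(1)] card_Suc_Diff1[of "R - Vc" y] unfolding Z_def by simp
  then have Z2: "card Z \<le> 2" using cVc dc c(3) card_R_le by simp
  have Z: "Z \<inter> N = {}" "x \<notin> Z" "Z \<subseteq> nb y" "Z \<subseteq> R" "R \<subseteq> insert y (Vc \<union> Z)" "Z \<inter> Vc = {}" "y \<notin> Z" "c \<notin> Z" "finite Z"
    using y Vc c(1) by (auto simp: Z_def dest: R_D)
  obtain v where v: "v \<in> Vc" using Vc2 by fastforce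
  have vd: "w \<in> R" "w \<notin> N" "w \<noteq> x" "w \<in> nb c" "c \<in> nb w" "w \<noteq> y" "y \<in> nb w" "w \<in> nb y" "w \<notin> Z" "w \<noteq> c"
    if "w \<in> Vc" for w
    using that Vc Z R_D[of w] nb_commute[of w c] nb_commute[of w y] y by auto
  note facts = yx cx c(1) Vc Z N4
  consider "card Z = 0" | "card Z = 1" | "card Z = 2" using Z2 by linarith
  then show ?thesis
  proof cases
    case 1
    then have Z0: "Z = {}" using Z by simp
    have Vc3: "3 \<le> card Vc" using cZ 1 r by simp
    obtain t where t: "t \<in> nb v" "t \<noteq> c" "t \<noteq> y"
      and tc: "t \<in> N \<and> t \<noteq> x \<and> t \<notin> R \<or> t \<in> R \<and> t \<notin> N \<and> t \<noteq> x"
      using nb_third[OF vd(1)[OF v] r] by blast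
    have tv: "t \<noteq> v" using t by auto
    show ?thesis
    proof (cases "t \<in> N")
      case True
      then show ?thesis
        by (intro HIST_by_expansions[of "{t}" "[(c, Vc), (v, {y, t})]"])
          (use facts Z0 Vc3 t tc v vd[OF v] in \<open>auto simp: card_insert_if\<close>)
    next
      case False
      then have "t \<in> Vc" using tc t Z Z0 by blast
      then have "card (Vc - {t}) \<noteq> 1" using Vc3 by simp
      then show ?thesis using \<open>t \<in> Vc\<close>
        by (intro HIST_by_expansions[of "{}" "[(c, Vc - {t}), (v, {y, t})]"])
          (use facts Z0 Vc3 t tv tc v vd[OF v] in \<open>auto simp: card_insert_if\<close>)
    qed
  next
    case 2
    then obtain z where Zz: "Z = {z}" by (meson card_1_singletonE)
    have z: "z \<in> R" "z \<notin> N" "z \<noteq> x" "z \<noteq> y" "z \<notin> Vc" "z \<in> nb y" "z \<noteq> c" "y \<in> nb z" "R \<subseteq> insert z (insert y Vc)"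
      using Z Zz R_D[of z] nb_commute[of z y] by auto
    show ?thesis
    proof (cases "\<exists>v\<in>Vc. z \<in> nb v")
      case True
      then obtain v where v: "v \<in> Vc" "z \<in> nb v" by blast
      have "v \<noteq> z" using v by auto
      then show ?thesis
        by (intro HIST_by_expansions[of "{}" "[(c, Vc), (v, {y, z})]"])
          (use N4 c(1) cx yx Vc Vc2 v vd[OF v(1)] z in \<open>auto simp: card_insert_if\<close>)
    next
      case nozV: False
      have r5: "5 \<le> card R"
      proof (rule ccontr)
        assume "\<not> ?thesis"
        then have "card R = 4" using r by simp
        moreover from this have "card Vc = 2" using cZ 2 by simp
        ultimately show False using cVc dc c(3) big by simp
      qed
      then have Vc3: "3 \<le> card Vc" using cZ 2 by simp
      show ?thesis
      proof (cases "\<exists>v\<in>Vc. \<exists>t\<in>N. t \<in> nb v \<and> t \<noteq> c")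
        case True
        then obtain v t where v: "v \<in> Vc" and t: "t \<in> N" "t \<in> nb v" "t \<noteq> c" by blast
        obtain v' where v': "v' \<in> Vc" "v' \<noteq> v" using ex_member_ne[of Vc v] Vc3 by auto
        have "card (Vc - {v'}) \<noteq> 1" using Vc3 v' by simp
        moreover have "v \<noteq> z" "v' \<noteq> z" using v v' z by auto
        ultimately show ?thesis
          by (intro HIST_by_expansions[of "{t}" "[(c, Vc - {v'}), (v, {y, t}), (y, {z, v'})]"])
            (use N4 c(1) cx yx Vc v vd[OF v] v' vd[OF v'(1)] t N_D[OF t(1)] z in \<open>auto simp: card_insert_if\<close>)
      next
        case noN: False
        have subN: "nb w \<inter> N \<subseteq> {c}" if "w \<in> Vc" for w using noN that by blast
        have subR: "nb w \<inter> R \<subseteq> insert y (Vc - {w})" if "w \<in> Vc" for w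
          using that nozV z(9) nb_irrefl[of w] by blast
        have dw: "dN w \<le> 1" "dR w \<le> card Vc" if "w \<in> Vc" for w
          using dN_mono[OF subN[OF that]] dR_mono[OF subR[OF that]] Vc that Vc3 by (auto simp: card_insert_if)
        have "nb z \<inter> R \<subseteq> {y}"
        proof
          fix w assume w: "w \<in> nb z \<inter> R"
          then have "w \<noteq> z" by auto
          moreover have "w \<notin> Vc" using nozV w nb_commute[of w z] by blast
          ultimately show "w \<in> {y}" using w z(9) by blast
        qed
        then have dRz: "dR z \<le> 1" using dR_mono[of z "{y}"] by simp
        have cz: "c \<notin> nb z" using z nb_commute[of c z] by (auto simp: Vc_def)
        have subz: "nb z \<inter> N \<subseteq> N - {c}" using cz by blast
        \<comment> \<open>Vertices of \<open>Vc\<close> see at most \<open>c\<close> in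
          \<open>N\<close> and miss \<open>z\<close>, while \<open>z\<close> sees at most
          \<open>y\<close> in \<open>R\<close>. The degree sum is therefore tight: \<open>z\<close>
          sees all of \<open>N - {c}\<close> and \<open>v\<close> all of
          \<open>Vc - {v}\<close>.\<close>
        have orevz: "card N + card R \<le> card (nb w) + card (nb z) + 1" if "w \<in> Vc" for w
          by (rule ore_NR) (use vd[OF that] z nozV that in auto)
        have dNz_le: "dN z \<le> card N - 1" using dN_mono[OF subz] c(1) by simp
        have "card (N - {c}) \<le> dN z"
          using orevz[OF v] degR[OF z(1)] degR[OF vd(1)[OF v]] dw[OF v] dRz cZ 2 c(1) by simp
        then have zN: "N - {c} \<subseteq> nb z" using dN_full[OF subz] by simp
        have full: "card (insert y (Vc - {v})) \<le> dR v"
          using orevz[OF v] degR[OF z(1)] degR[OF vd(1)[OF v]] dw[OF v] dRz dNz_le cZ 2 Vc v Vc3 N4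
          by (simp add: card_insert_if)
        then have vV: "Vc - {v} \<subseteq> nb v" using dR_full[OF subR[OF v]] Vc by simp
        obtain v' where v': "v' \<in> Vc" "v' \<noteq> v" using ex_member_ne[of Vc v] Vc3 by auto
        obtain b where b: "b \<in> N" "b \<noteq> c" using ex_member_ne[of N c] N4 by auto
        have "nb b \<inter> R \<subseteq> {z}"
        proof
          fix w assume w: "w \<in> nb b \<inter> R"
          then have "w \<noteq> y" using b y(2) nb_commute[of y b] N_D[OF b(1)] by auto
          moreover have "w \<notin> Vc" using subN[of w] w b nb_commute[of w b] by blast
          ultimately show "w \<in> {z}" using w z(9) by blast
        qed
        then have "2 \<le> dN b"
          using dR_mono[of b "{z}"] deg_N_of_dN_zero[OF y b(1)] N4 by simp
        then obtain s where s: "s \<in> N" "s \<in> nb b" "s \<noteq> c" using ex_nb_N_ne[of b c] by auto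
        have "s \<noteq> b" using s by auto
        moreover have "card (Vc - {v'}) \<noteq> 1" using Vc3 v' by simp
        moreover have "v \<noteq> z" "v' \<noteq> z" using v v' z by auto
        moreover have "v' \<in> nb v" "z \<in> nb b" using vV v' zN b nb_commute[of z b] by auto
        ultimately show ?thesis
          by (intro HIST_by_expansions[of "{s}" "[(c, Vc - {v'}), (v, {y, v'}), (b, {z, s})]"])
            (use N4 c(1) cx yx Vc v vd[OF v] v' vd[OF v'(1)] s N_D[OF s(1)] b N_D[OF b(1)] z in \<open>auto simp: card_insert_if\<close>)
      qed
    qed
  next
    case 3
    then obtain z1 z2 where Zz: "Z = {z1, z2}" "z1 \<noteq> z2" by (meson card_2_iff)
    have r5: "5 \<le> card R" and N1: "dN c = 1" using cZ 3 cVc dc c(3) card_R_le N4 by linarith+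
    have z: "z1 \<notin> N" "z1 \<noteq> x" "z1 \<noteq> y" "z1 \<notin> Vc" "z1 \<in> nb y" "z1 \<noteq> c" "y \<in> nb z1"
       "z2 \<notin> N" "z2 \<noteq> x" "z2 \<noteq> y" "z2 \<notin> Vc" "z2 \<in> nb y" "z2 \<noteq> c" "y \<in> nb z2"
       "R \<subseteq> insert z1 (insert z2 (insert y Vc))" "z1 \<noteq> z2" "v \<noteq> z1" "v \<noteq> z2"
      using Z Zz R_D[of z1] R_D[of z2] nb_commute[of z1 y] nb_commute[of z2 y] v by auto
    obtain c' where c': "c' \<in> N" "c' \<in> nb c" using ex_nb_N[of c] N1 by auto
    have c'c: "c' \<noteq> c" using c' by auto
    show ?thesis
    proof (cases "z1 \<in> nb v \<and> z2 \<in> nb v")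
      case True
      then show ?thesis
        by (intro HIST_by_expansions[of "{}" "[(c, Vc), (v, {y, z1, z2})]"])
          (use N4 c(1) cx yx Vc Vc2 v vd[OF v] z in \<open>auto simp: card_insert_if\<close>)
    next
      case False
      have "3 < card (nb v)" using deg_R_ge[OF vd(1)[OF v]] degR[OF vd(1)[OF v]] r5 by simp
      then obtain t where t: "t \<in> nb v" "t \<noteq> c" "t \<noteq> y" "t \<noteq> z1" "t \<noteq> z2"
        using ex_member_ne3[of "nb v" c y z1] ex_member_ne3[of "nb v" c y z2] False by metis
      have tv: "t \<noteq> v" using t by auto
      have "t \<in> N \<or> t \<in> R" using nb_R[OF vd(1)[OF v]] t by blast
      then show ?thesis
      proof
        assume "t \<in> N"
        then show ?thesis
          by (intro HIST_by_expansions[of "{t}" "[(c, Vc), (v, {y, t}), (y, {z1, z2})]"])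
            (use N4 c(1) cx yx Vc Vc2 v vd[OF v] z t N_D[of t] in \<open>auto simp: card_insert_if\<close>)
      next
        assume "t \<in> R"
        then have tV: "t \<in> Vc" using z t by blast
        \<comment> \<open>\<open>c'\<close> replaces \<open>t\<close> below \<open>c\<close>, as
          \<open>Vc - {t}\<close> may be a single vertex.\<close>
        have "c' \<notin> Vc" using c' Vc by blast
        then have "card (insert c' (Vc - {t})) \<noteq> 1" using Vc2 Vc tV by (simp add: card_insert_if)
        then show ?thesis using \<open>c' \<notin> Vc\<close>
          by (intro HIST_by_expansions[of "{c'}" "[(c, insert c' (Vc - {t})), (v, {y, t}), (y, {z1, z2})]"])
            (use N4 c(1) cx yx Vc v vd[OF v] z t tv tV vd[OF tV] c' c'c N_D[OF c'(1)] in \<open>auto simp: card_insert_if\<close>)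
      qed
    qed
  qed
qed

text \<open>Outside the previous lemma every \<open>c\<close> with a neighbour in \<open>R\<close>
  has two neighbours in \<open>N\<close>, so a companion for \<open>v\<close> below \<open>c\<close>
  is available. The companion \<open>t\<close> of \<open>y\<close> below \<open>v\<close> comes from
  \<open>N\<close> (\<open>hub_N\<close>, two moves from \<open>x\<close>, hence
  \<open>5 \<le> card N\<close>) or from \<open>R\<close> (\<open>hub_R\<close>, where the remainder
  below \<open>y\<close> must not be a single vertex, hence \<open>5 \<le> card R\<close>).\<close>

lemma HIST_separated_ge4:
  assumes y: "y \<in> R" "nb y = R - {y}" and r: "4 \<le> card R"
  shows "\<exists>T. HIST T G"
proof (cases "\<exists>c\<in>N. 0 < dR c \<and> dN c \<le> 1")
  case True
  then show ?thesis using HIST_separated_low[OF y r] by blast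
next
  case False
  then have dN2: "1 < dN c" if "c \<in> N" "v \<in> R" "v \<in> nb c" for c v
    using that dR_pos[of v c] by (auto simp: not_le)
  note yx = R_D[OF y(1)]
  have yN: "y \<notin> nb b" if "b \<in> N" for b
    using N_D[OF that] y(2) nb_commute[of y b] by auto
  have hub_N: "\<exists>T. HIST T G"
    if v: "v \<in> R" "v \<noteq> y" and c: "c \<in> N" "c \<in> nb v" and t: "t \<in> N" "t \<in> nb v" "t \<noteq> c"
      and N5: "5 \<le> card N" for v c t
  proof -
    obtain c' where c': "c' \<in> N" "c' \<in> nb c" "c' \<noteq> t"
      using ex_nb_N_ne[of c t] dN2[OF c(1) v(1)] c nb_commute[of c v] by auto
    have "c' \<noteq> c" using c' by auto
    moreover have "card (R - {y, v}) \<noteq> 1" using r v y(1) by (auto simp: card_Diff_subset)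
    moreover have "v \<in> nb y" "R - {y, v} \<subseteq> nb y" "y \<in> nb v" using v y nb_commute[of y v] by auto
    ultimately show ?thesis
      by (intro HIST_by_expansions[of "{c', t}" "[(c, {v, c'}), (v, {y, t}), (y, R - {y, v})]"])
        (use N5 yx v R_D[OF v(1)] c N_D[OF c(1)] c' N_D[OF c'(1)] t N_D[OF t(1)]
          nb_commute[of v c] in \<open>auto simp: card_insert_if dest: R_D\<close>)
  qed
  obtain c v where cv: "c \<in> N" "v \<in> R" "v \<in> nb c" using R_linked y(1) by auto
  show ?thesis
  proof (cases "card R = 4")
    case True
    then have N5: "5 \<le> card N" using big by simp
    show ?thesis
    proof (cases "\<exists>v\<in>R. v \<noteq> y \<and> 1 < dN v")
      case True
      then obtain v where v: "v \<in> R" "v \<noteq> y" "1 < dN v" by blast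
      obtain c where c: "c \<in> N" "c \<in> nb v" using ex_nb_N[of v] v by auto
      obtain t where "t \<in> N" "t \<in> nb v" "t \<noteq> c" using ex_nb_N_ne[OF v(3)] by blast
      then show ?thesis using hub_N[of v c t] v c N5 by blast
    next
      case few: False
      have vy: "v \<noteq> y" using cv yN by auto
      have v1: "dN v \<le> 1" using few cv(2) vy by (auto simp: not_less)
      obtain c' where c': "c' \<in> N" "c' \<in> nb c" using ex_nb_N[of c] dN2[OF cv] by auto
      have c'c: "c' \<noteq> c" using c' by auto
      have yv: "v \<in> nb y" "y \<in> nb v" using vy y cv nb_commute[of y v] by auto
      show ?thesis
      proof (cases "R - {v} \<subseteq> nb v")
        case True
        have "card (R - {v}) \<noteq> 1" using cv(2) r by simp
        then show ?thesis
          by (intro HIST_by_expansions[of "{c'}" "[(c, {v, c'}), (v, R - {v})]"])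
            (use N5 yx cv N_D[OF cv(1)] R_D[OF cv(2)] c' c'c N_D[OF c'(1)] True
              in \<open>auto simp: card_insert_if dest: R_D\<close>)
      next
        case miss: False
        then obtain z where z: "z \<in> R" "z \<noteq> v" "z \<notin> nb v" by blast
        have zy: "z \<noteq> y" using z yv by auto
        have z1: "dN z \<le> 1" using few z zy by (auto simp: not_less)
        \<comment> \<open>Both \<open>v\<close> and \<open>z\<close> have degree at most 1 + 2, too
          little for nonadjacent vertices.\<close>
        have "dR v \<le> card (R - {v, z})" by (rule dR_mono) (use z in auto)
        moreover have "dR z \<le> card (R - {v, z})"
          by (rule dR_mono) (use z nb_commute[of v z] in auto)
        moreover have "card (R - {v, z}) = 2" using z cv(2) \<open>card R = 4\<close> by (auto simp: card_Diff_subset)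
        moreover have "card N + card R \<le> card (nb v) + card (nb z) + 1"
          by (rule ore_NR) (use z cv in auto)
        ultimately show ?thesis
          using degR[OF cv(2)] degR[OF z(1)] z1 v1 big by linarith
      qed
    qed
  next
    case False
    then have r5: "5 \<le> card R" using r by simp
    have hub_R: "\<exists>T. HIST T G"
      if v: "v \<in> R" "v \<noteq> y" and c: "c \<in> N" "c \<in> nb v" and t: "t \<in> R" "t \<in> nb v" "t \<noteq> y" for v c t
    proof -
      obtain c' where c': "c' \<in> N" "c' \<in> nb c"
        using ex_nb_N[of c] dN2[OF c(1) v(1)] c nb_commute[of c v] by auto
      have "c' \<noteq> c" "t \<noteq> v" using c' t by auto
      moreover from this have "card (R - {y, v, t}) \<noteq> 1" using r5 v t y(1) by (auto simp: card_Diff_subset)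
      moreover have "v \<in> nb y" "R - {y, v, t} \<subseteq> nb y" "y \<in> nb v" using v y nb_commute[of y v] by auto
      ultimately show ?thesis
        by (intro HIST_by_expansions[of "{c'}" "[(c, {v, c'}), (v, {y, t}), (y, R - {y, v, t})]"])
          (use N4 yx v R_D[OF v(1)] c N_D[OF c(1)] c' N_D[OF c'(1)] t R_D[OF t(1)]
            nb_commute[of v c] in \<open>auto simp: card_insert_if dest: R_D\<close>)
    qed
    show ?thesis
    proof (cases "\<exists>c\<in>N. \<exists>v\<in>R. c \<in> nb v \<and> (\<exists>t\<in>R. t \<in> nb v \<and> t \<noteq> y)")
      case True
      then obtain c v t where *: "c \<in> N" "v \<in> R" "c \<in> nb v" "t \<in> R" "t \<in> nb v" "t \<noteq> y" by blast
      moreover have "v \<noteq> y" using yN[of c] * nb_commute[of c v] by auto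
      ultimately show ?thesis using hub_R[of v c t] by blast
    next
      case no: False
      have noR: "nb w \<inter> R \<subseteq> {y}" if "c \<in> N" "w \<in> R" "c \<in> nb w" for c w
        using no that by blast
      have vy: "v \<noteq> y" using cv yN by auto
      have cnv: "c \<in> nb v" using cv nb_commute[of c v] by simp
      have linked: "3 \<le> dN w" if w: "w \<in> R" "w \<noteq> y" for w
      proof (cases "\<exists>c\<in>N. c \<in> nb w")
        case True
        then have "dR w \<le> 1" using noR[OF _ w(1)] dR_mono[of w "{y}"] by auto
        then show ?thesis using deg_R_ge[OF w(1)] r5 by simp
      next
        case False
        have "w \<noteq> v" using False cv cnv by blast
        have "dN w = 0" using False ex_nb_N[of w] by auto
        then have "card (R - {w}) \<le> dR w" using deg_R_ge[OF w(1)] w by simp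
        then have "R - {w} \<subseteq> nb w" by (intro dR_full) auto
        then have "v \<in> nb w" using cv \<open>w \<noteq> v\<close> by blast
        then have "w \<in> nb v \<inter> R" using w nb_commute[of v w] by blast
        then show ?thesis using noR[OF cv(1,2) cnv] w by blast
      qed
      show ?thesis
      proof (cases "5 \<le> card N")
        case True
        obtain t where "t \<in> N" "t \<in> nb v" "t \<noteq> c"
          using ex_nb_N_ne[of v c] linked[OF cv(2) vy] by auto
        then show ?thesis using hub_N[OF cv(2) vy cv(1) cnv _ _ _ True] by blast
      next
        case False
        then have N4': "card N = 4" "card R = 5" using N4 r5 card_R_le by auto
        \<comment> \<open>Double counting of the edges between \<open>R - {y}\<close> and
          \<open>N\<close>: the four vertices of \<open>R - {y}\<close> send at least 3 each, while
          each of the four vertices of \<open>N\<close> receives at most one.\<close>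
        have "(\<Sum>w\<in>R - {y}. dN w) \<le> (\<Sum>c\<in>N. dR c)"
        proof -
          have "(\<Sum>w\<in>R - {y}. dN w) = (\<Sum>w\<in>R - {y}. card {c \<in> N. w \<in> nb c})"
            by (rule sum.cong) (auto simp: dN_def nb_commute intro!: arg_cong[of _ _ card])
          also have "\<dots> = (\<Sum>c\<in>N. card {w \<in> R - {y}. w \<in> nb c})"
            by (rule sum_multicount_gen) auto
          also have "\<dots> \<le> (\<Sum>c\<in>N. dR c)"
            unfolding dR_def by (intro sum_mono card_mono) auto
          finally show ?thesis .
        qed
        moreover have "(\<Sum>w\<in>R - {y}. dN w) \<ge> 3 * card (R - {y})"
          using sum_bounded_below[of "R - {y}" 3 dN] linked by auto
        moreover have "dR c \<le> 1" if "c \<in> N" for c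
          using deg_N_of_dN_zero[OF y that] N4' dN2[OF that] dR_def
            ex_member[of "nb c \<inter> R"] by (cases "dR c = 0") auto
        then have "(\<Sum>c\<in>N. dR c) \<le> card N * 1" using sum_bounded_above[of N dR 1] by auto
        ultimately show ?thesis using N4' y(1) by simp
      qed
    qed
  qed
qed

lemma HIST_separated:
  assumes "y \<in> R" "dN y = 0" "2 \<le> card R"
  shows "\<exists>T. HIST T G"
proof -
  have nby: "nb y = R - {y}" using nb_y_of_dN_zero assms by blast
  consider "card R = 2" | "card R = 3" | "4 \<le> card R" using assms(3) by linarith
  then show ?thesis
    using HIST_separated_2[OF assms(1) nby] HIST_separated_3[OF assms(1) nby] HIST_separated_ge4[OF assms(1) nby] by cases
qed

section \<open>A vertex \<open>y\<close> whose only neighbour in \<open>N\<close> is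
  \<open>a\<close>, adjacent to all of \<open>R\<close>\<close>

lemma nb_misses_one:
  assumes "nb v \<subseteq> B" "finite B" "card B \<le> card (nb v) + 1" "p \<in> B" "q \<in> B" "p \<noteq> q"
  shows "p \<in> nb v \<or> q \<in> nb v"
proof (rule ccontr)
  assume "\<not> ?thesis"
  then have "nb v \<subseteq> B - {p, q}" using assms(1) by auto
  then have "card (nb v) \<le> card (B - {p, q})" using assms(2) by (intro card_mono) auto
  also have "\<dots> = card B - 2" using assms by (auto simp: card_Diff_subset)
  finally show False using assms card_mono[of B "{p, q}"] by auto
qed

text \<open>Because \<open>a\<close> has degree 2, every vertex other than \<open>x\<close>,
  \<open>y\<close>, \<open>a\<close> has degree at least \<open>card N + card R - 3\<close>, one
  less than the number of its possible neighbours. Thus some \<open>b\<close> takes all of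
  \<open>R - {y}\<close> except at most one \<open>z\<close>, and a \<open>v\<close> below
  \<open>b\<close> takes \<open>y\<close> together with \<open>z\<close> or with a vertex of
  \<open>N\<close>. The vertex \<open>a\<close> remains a leaf at \<open>x\<close>.\<close>

lemma HIST_linked_degree_2:
  assumes y: "y \<in> R" "nb y \<inter> N = {a}" "R - {y} \<subseteq> nb y" and a: "a \<in> N" "nb a = {x, y}"
    and r: "2 \<le> card R"
  shows "\<exists>T. HIST T G"
proof -
  note yx = R_D[OF y(1)]
  note ax = N_D[OF a(1)]
  have an: "a \<notin> nb w" if "w \<noteq> x" "w \<noteq> y" for w using a that nb_commute[of a w] by auto
  have big_deg: "card N + card R \<le> card (nb w) + 3" if w: "w \<in> N \<union> R" "w \<noteq> a" "w \<noteq> y" for w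
  proof -
    have "w \<noteq> x" using w(1) N_D[of w] R_D[of w] by auto
    then have "card N + card R \<le> card (nb a) + card (nb w) + 1"
      by (intro ore_NR) (use w a in auto)
    moreover have "card (nb a) \<le> 2" using a by (simp add: card_insert_if)
    ultimately show ?thesis by linarith
  qed
  have Rw: "card N \<le> dN v + 2" if v: "v \<in> R" "v \<noteq> y" for v
  proof -
    have "v \<noteq> a" using v ax by auto
    then show ?thesis using big_deg[of v] v degR[OF v(1)] dR_le[OF v(1)] by simp
  qed
  have yb: "y \<notin> nb b" if "b \<in> N" "b \<noteq> a" for b using y(2) that nb_commute[of y b] by auto
  show ?thesis
  proof (cases "card R = 2")
    case True
    then obtain v where R: "R = {y, v}" "v \<noteq> y" using card_2_with y(1) by metis
    then have v: "v \<in> R" and RS: "R \<subseteq> {y, v}" by auto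
    have N7: "7 \<le> card N" using big True by simp
    obtain b where b: "b \<in> N" "b \<in> nb v" using ex_nb_N[of v] Rw[OF v R(2)] N7 by auto
    have ba: "b \<noteq> a" using an[of v] b R_D[OF v] R(2) by auto
    have "dR b \<le> 1" using dR_mono[of b "{v}"] yb[OF b(1) ba] RS by auto
    moreover have "b \<noteq> y" using N_D[OF b(1)] y(1) by auto
    ultimately have "1 < dN b" using big_deg[of b] b ba degN[OF b(1)] N7 True by simp
    then obtain b' where b': "b' \<in> N" "b' \<in> nb b" using ex_nb_N[of b] by auto
    obtain t where t: "t \<in> N" "t \<in> nb v" "t \<noteq> b" "t \<noteq> b'"
      using ex_nb_N_ne2[of v b b'] Rw[OF v R(2)] N7 by auto
    have "b' \<noteq> b" using b' by auto
    then show ?thesis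
      by (intro HIST_by_expansions[of "{b', t}" "[(b, {v, b'}), (v, {y, t})]"])
        (use N7 yx R_D[OF v] RS R(2) v y b N_D[OF b(1)] b' N_D[OF b'(1)] t N_D[OF t(1)]
          nb_commute[of v b] nb_commute[of v y] in \<open>auto simp: card_insert_if\<close>)
  next
    case False
    then have r3: "3 \<le> card R" using r by simp
    obtain b where b: "b \<in> N" "b \<noteq> a" using ex_member_ne[of N a] N4 by auto
    note bx = N_D[OF b(1)]
    have b_y: "b \<noteq> y" using bx y(1) by auto
    have b_misses: "p \<in> nb b \<or> q \<in> nb b"
      if "p \<in> (N - {a, b}) \<union> (R - {y})" "q \<in> (N - {a, b}) \<union> (R - {y})" "p \<noteq> q" for p q
    proof (rule nb_misses_one)
      let ?B = "insert x ((N - {a, b}) \<union> (R - {y}))"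
      show "nb b \<subseteq> ?B" using nb_N[of b] yb[OF b] an[of b] b bx b_y by auto
      have "card ((N - {a, b}) \<union> (R - {y})) = card (N - {a, b}) + card (R - {y})"
        by (rule card_Un_disjoint) (auto dest: R_D)
      also have "\<dots> = (card N - 2) + (card R - 1)" using a b y(1) by (auto simp: card_Diff_subset)
      finally have "card ?B \<le> card N + card R - 2" using N4 r3 by (simp add: card_insert_if)
      then show "card ?B \<le> card (nb b) + 1" using big_deg[of b] b b_y by auto
    qed (use that in auto)
    show ?thesis
    proof (cases "R - {y} \<subseteq> nb b")
      case True
      have cR: "card (R - {y}) \<noteq> 1" "0 < card (R - {y})" using r3 y(1) by auto
      then obtain v where v: "v \<in> R" "v \<noteq> y" using ex_member[of "R - {y}"] by blast
      obtain t where t: "t \<in> N" "t \<in> nb v" "t \<noteq> b" using ex_nb_N_ne[of v b] Rw[OF v] N4 by auto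
      show ?thesis
        by (rule HIST_by_expansions[of "{t}" "[(b, R - {y}), (v, {y, t})]"])
          (use N4 cR True yx v R_D[OF v(1)] y(1,3) b bx t N_D[OF t(1)] nb_commute[of v y]
            in \<open>auto simp: card_insert_if dest: R_D\<close>)
    next
      case False
      then obtain z where z: "z \<in> R" "z \<noteq> y" "z \<notin> nb b" by blast
      have sub: "R - {y, z} \<subseteq> nb b" using b_misses[of z] z by blast
      have "card (R - {y, z}) = card R - 2" using z y(1) by (auto simp: card_Diff_subset)
      then have "0 < card (R - {y, z})" using r3 by simp
      then obtain v where v: "v \<in> R" "v \<noteq> y" "v \<noteq> z" using ex_member[of "R - {y, z}"] by blast
      have "v \<in> nb z"
      proof -
        let ?B = "(N - {a}) \<union> (R - {z})"
        have "b \<in> nb z \<or> v \<in> nb z"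
        proof (rule nb_misses_one)
          show "nb z \<subseteq> ?B" using nb_R[OF z(1)] an[of z] z R_D[OF z(1)] nb_irrefl[of z] by blast
          have "card ?B = card (N - {a}) + card (R - {z})"
            by (rule card_Un_disjoint) (auto dest: R_D)
          then have "card ?B \<le> card N + card R - 2" using a z N4 r3 by simp
          moreover have "z \<noteq> a" using z ax by auto
          ultimately show "card ?B \<le> card (nb z) + 1" using big_deg[of z] z by auto
        qed (use v b bx in auto)
        then show ?thesis using z nb_commute[of b z] by auto
      qed
      have "dR b \<le> card (R - {y, z})" by (rule dR_mono) (use yb[OF b] z in auto)
      then have "2 \<le> dN b"
        using big_deg[of b] b b_y degN[OF b(1)] N4 \<open>card (R - {y, z}) = card R - 2\<close> r3 by simp
      then obtain b' where b': "b' \<in> N" "b' \<in> nb b" using ex_nb_N[of b] by auto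
      have "b' \<noteq> b" using b' by auto
      moreover have "card (insert b' (R - {y, z})) \<noteq> 1"
        using N_D[OF b'(1)] v by (auto simp: card_insert_if)
      ultimately show ?thesis
        by (intro HIST_by_expansions[of "{b'}" "[(b, insert b' (R - {y, z})), (v, {y, z})]"])
          (use N4 sub yx v R_D[OF v(1)] y(1,3) z R_D[OF z(1)] b bx b' N_D[OF b'(1)] nb_commute[of v y]
            nb_commute[of v z] \<open>v \<in> nb z\<close> in \<open>auto simp: card_insert_if dest: R_D\<close>)
    qed
  qed
qed

text \<open>\<open>y\<close> sees all of \<open>R\<close>, so it suffices to hang \<open>y\<close>
  below \<open>a\<close> with some companion and the rest of \<open>R\<close> below
  \<open>y\<close>. This fails only if \<open>a\<close> has no companion to offer (the previous
  lemma) or if exactly one vertex remains, which then goes below \<open>a\<close> or below another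
  vertex of \<open>N\<close> with its own companion.\<close>

lemma HIST_linked_covering:
  assumes linked: "\<And>w. w \<in> R \<Longrightarrow> 0 < dN w"
    and y: "y \<in> R" "nb y \<inter> N = {a}" "R - {y} \<subseteq> nb y" and r: "2 \<le> card R"
  shows "\<exists>T. HIST T G"
proof -
  have a: "a \<in> N" "a \<in> nb y" "y \<in> nb a" using y(2) nb_commute[of y a] by auto
  note yx = R_D[OF y(1)]
  note ax = N_D[OF a(1)]
  have "nb y \<subseteq> insert a (R - {y})" using nb_R[OF y(1)] y(2) nb_irrefl[of y] by blast
  then have "card (nb y) \<le> card (insert a (R - {y}))" by (intro card_mono) auto
  also have "\<dots> = card R" using ax y(1) r by (simp add: card_insert_if)
  finally have dy: "card (nb y) \<le> card R" .
  have yb: "y \<notin> nb b" if "b \<in> N" "b \<noteq> a" for b using y(2) that nb_commute[of y b] by auto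
  show ?thesis
  proof (cases "nb a = {x, y}")
    case True
    then show ?thesis using HIST_linked_degree_2[OF y a(1) _ r] by blast
  next
    case False
    then obtain t where t: "t \<in> nb a" "t \<noteq> x" "t \<noteq> y" using a by auto
    have ta: "t \<noteq> a" using t by auto
    show ?thesis
    proof (cases "\<exists>c\<in>N. c \<in> nb a")
      case True
      then obtain c where c: "c \<in> N" "c \<in> nb a" by blast
      have ca: "c \<noteq> a" using c by auto
      show ?thesis
      proof (cases "card R = 2")
        case True
        then obtain v where R: "R = {y, v}" "v \<noteq> y" using card_2_with y(1) by metis
        then have v: "v \<in> R" and RS: "R \<subseteq> {y, v}" by auto
        have N7: "7 \<le> card N" using big True by simp
        show ?thesis
        proof (cases "v \<in> nb a")
          case True
          then show ?thesis
            by (intro HIST_by_expansions[of "{}" "[(a, {y, v})]"])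
              (use N7 yx R_D[OF v] RS R(2) a ax in \<open>auto simp: card_insert_if\<close>)
        next
          case False
          obtain b where b: "b \<in> N" "b \<in> nb v" using ex_nb_N[OF linked[OF v]] by blast
          have ba: "b \<noteq> a" using False b nb_commute[of v a] by auto
          have "nb b \<inter> R \<subseteq> {v}" using yb[OF b(1) ba] RS by auto
          then have "dR b \<le> 1" using dR_mono[of b "{v}"] by auto
          moreover have "card N + card R \<le> card (nb y) + card (nb b) + 1"
            by (rule ore_NR) (use y b ba yx in auto)
          ultimately have "2 < dN b" using dy True N7 degN[OF b(1)] by simp
          then obtain b' where b': "b' \<in> N" "b' \<in> nb b" "b' \<noteq> a" "b' \<noteq> c" using ex_nb_N_ne2[of b a c] by auto
          have "b' \<noteq> b" using b' by auto
          then show ?thesis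
            by (intro HIST_by_expansions[of "{c, b'}" "[(a, {y, c}), (b, {v, b'})]"])
              (use N7 yx R_D[OF v] RS R(2) a ax b N_D[OF b(1)] ba c ca N_D[OF c(1)] b' N_D[OF b'(1)]
                nb_commute[of v b] in \<open>auto simp: card_insert_if\<close>)
        qed
      next
        case False
        then have "card (R - {y}) \<noteq> 1" using r y(1) by auto
        then show ?thesis
          by (intro HIST_by_expansions[of "{c}" "[(a, {y, c}), (y, R - {y})]"])
            (use N4 yx y a ax c ca N_D[OF c(1)] in \<open>auto simp: card_insert_if dest: R_D\<close>)
      qed
    next
      case noN: False
      then have tR: "t \<in> R" using t nb_N[of a] by blast
      note tx = R_D[OF tR]
      show ?thesis
      proof (cases "card R = 3")
        case True
        then obtain z where R: "R = {y, t, z}" "z \<noteq> y" "z \<noteq> t" using card_3_with[OF True y(1) tR] t by metis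
        then have z: "z \<in> R" and RS: "R \<subseteq> {y, t, z}" by auto
        have N6: "6 \<le> card N" using big True by simp
        show ?thesis
        proof (cases "z \<in> nb a")
          case True
          then show ?thesis
            by (intro HIST_by_expansions[of "{}" "[(a, {y, t, z})]"])
              (use N4 yx tx R_D[OF z] RS R(2,3) a ax t in \<open>auto simp: card_insert_if\<close>)
        next
          case False
          have "dN a = 0" using noN ex_nb_N[of a] by auto
          moreover have "nb a \<inter> R \<subseteq> {y, t}" using RS False by auto
          then have "dR a \<le> 2" using dR_mono[of a "{y, t}"] by (auto simp: card_insert_if split: if_splits)
          ultimately have da: "card (nb a) \<le> 3" using degN[OF a(1)] by simp
          have "card N + card R \<le> card (nb a) + card (nb z) + 1"
            by (rule ore_NR) (use a z False ax in auto)
          then have "0 < dN z" using da degR[OF z] dR_le[OF z] N6 True by simp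
          then obtain b where b: "b \<in> N" "b \<in> nb z" using ex_nb_N by blast
          have ba: "b \<noteq> a" using False b nb_commute[of z a] by auto
          have ban: "b \<notin> nb a" using noN b by blast
          have "nb b \<inter> R \<subseteq> {t, z}" using yb[OF b(1) ba] RS by auto
          then have "dR b \<le> 2" using dR_mono[of b "{t, z}"] by (auto simp: card_insert_if split: if_splits)
          moreover have "card N + card R \<le> card (nb a) + card (nb b) + 1"
            by (rule ore_NR) (use a b ba ban in auto)
          ultimately have "0 < dN b" using da degN[OF b(1)] N6 True by simp
          then obtain b' where b': "b' \<in> N" "b' \<in> nb b" using ex_nb_N by blast
          have "b' \<noteq> b" "b' \<noteq> a" using b' noN b ban nb_commute[of b a] by auto
          then show ?thesis
            by (intro HIST_by_expansions[of "{b'}" "[(a, {y, t}), (b, {z, b'})]"])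
              (use N6 yx tx t R_D[OF z] RS R(2,3) a ax b N_D[OF b(1)] ba b' N_D[OF b'(1)]
                nb_commute[of z b] in \<open>auto simp: card_insert_if\<close>)
        qed
      next
        case False
        have "card (R - {y, t}) = card R - 2" using y(1) tR t by (auto simp: card_Diff_subset)
        then have "card (R - {y, t}) \<noteq> 1" using False r by simp
        then show ?thesis
          by (intro HIST_by_expansions[of "{}" "[(a, {y, t}), (y, R - {y, t})]"])
            (use N4 yx y a ax t tx in \<open>auto simp: card_insert_if dest: R_D\<close>)
      qed
    qed
  qed
qed

end

text \<open>
  The vertices \<open>x\<close> and \<open>y\<close> have the single common neighbour \<open>a\<close>, and \<open>z\<close> is adjacent to neither; then
  \<open>z\<close> and all neighbours of \<open>x\<close> except possibly \<open>a\<close> have maximum degree.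
\<close>

locale missed_vertex = ore_graph G x for G :: "'a pair_pre_digraph" and x +
  fixes y z a :: 'a
  assumes linked: "\<And>w. w \<in> R \<Longrightarrow> 0 < dN w"
    and y: "y \<in> R" and z: "z \<in> R" "z \<noteq> y" "z \<notin> nb y"
    and nbyN: "nb y \<inter> N = {a}"
begin

abbreviation Y :: "'a set" where "Y \<equiv> R - {y, z}"

lemma a: "a \<in> N" "a \<in> nb y" "y \<in> nb a" "a \<noteq> y" "a \<noteq> z" "a \<noteq> x" "a \<notin> R"
  using nbyN nb_commute[of y a] y z N_D[of a] by auto

lemma yz: "y \<notin> N" "y \<noteq> x" "z \<notin> N" "z \<noteq> x" "y \<noteq> z" "y \<notin> nb z"
  using R_D[OF y] R_D[OF z(1)] z nb_commute[of y z] by auto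

lemma card_Y: "card Y = card R - 2" "2 \<le> card R"
  using y z card_mono[of R "{y, z}"] by (auto simp: card_Diff_subset)

text \<open>The only candidates for neighbours of \<open>y\<close> are \<open>a\<close> and
  \<open>Y\<close>, and \<open>deg_R_ge\<close> demands as many neighbours as there are candidates.
  The exact degree is what makes the degrees of the non-neighbours of \<open>y\<close> maximal in
  \<open>deg_b\<close> and \<open>deg_z\<close>.\<close>

lemma Y: "Y \<subseteq> nb y" "Suc (card (nb y)) = card R"
proof -
  have sub: "nb y \<subseteq> insert a Y" using nb_R[OF y] nbyN z nb_irrefl[of y] by blast
  have c: "Suc (card (insert a Y)) = card R" using card_Y a by (simp add: card_insert_if)
  have "card R \<le> Suc (card (nb y))" using deg_R_ge[OF y] degR[OF y] by simp
  then have "nb y = insert a Y" using sub c by (intro card_seteq) auto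
  then show "Y \<subseteq> nb y" "Suc (card (nb y)) = card R" using c by auto
qed

lemma Y_D: "w \<in> Y \<Longrightarrow> w \<in> R \<and> w \<notin> N \<and> w \<noteq> x \<and> w \<noteq> y \<and> w \<noteq> z \<and> w \<in> nb y \<and> y \<in> nb w \<and> w \<noteq> a"
  using R_D[of w] Y nb_commute[of y w] a by auto

lemma yb: "b \<in> N \<Longrightarrow> b \<noteq> a \<Longrightarrow> y \<notin> nb b"
  using nbyN nb_commute[of y b] by auto

lemma deg_b: "b \<in> N \<Longrightarrow> b \<noteq> a \<Longrightarrow> Suc (dN b + dR b) = card N"
proof -
  assume b: "b \<in> N" "b \<noteq> a"
  have "card N + card R \<le> card (nb y) + card (nb b) + 1"
    by (rule ore_NR) (use y b yz yb[OF b] nb_commute[of y b] in auto)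
  moreover have "card (nb b) \<le> card N" using deg_le b by blast
  ultimately show ?thesis using Y(2) degN[OF b(1)] by linarith
qed

lemma deg_z: "dN z + dR z = card N"
proof -
  have "card N + card R \<le> card (nb y) + card (nb z) + 1"
    by (rule ore_NR) (use y z yz in auto)
  moreover have "card (nb z) \<le> card N" using deg_le z by blast
  ultimately show ?thesis using Y(2) degR[OF z(1)] by linarith
qed

lemma nbzR: "nb z \<inter> R \<subseteq> Y" using yz nb_irrefl[of z] by auto

lemma dR_z: "dR z \<le> card R - 2"
  using dR_mono[OF nbzR] card_Y by simp

section \<open>Trees when \<open>y\<close> misses a vertex \<open>z\<close> of \<open>R\<close>, by
  the size of \<open>R\<close>\<close>

lemma HIST_card_2:
  assumes "card R = 2"
  shows "\<exists>T. HIST T G"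
proof -
  have "Y = {}" using assms card_Y by (metis card_0_eq diff_self_eq_0 finite_Diff finR)
  then have RS: "R \<subseteq> {y, z}" by blast
  have "N \<subseteq> nb z" using dN_full[of z N] deg_z dR_z assms by simp
  then have "z \<in> nb a" using a nb_commute[of z a] by auto
  then show ?thesis
    by (intro HIST_by_expansions[of "{}" "[(a, {y, z})]"]) (use N4 a yz RS in \<open>auto simp: card_insert_if\<close>)
qed

lemma HIST_card_3:
  assumes r: "card R = 3"
  shows "\<exists>T. HIST T G"
proof -
  obtain v where R: "R = {y, z, v}" "v \<noteq> y" "v \<noteq> z" using card_3_with[OF r y z(1)] z by metis
  have RS: "R \<subseteq> {y, z, v}" and vY: "v \<in> Y" using R by auto
  note v = Y_D[OF vY] R(2,3)
  have N6: "6 \<le> card N" using big r by simp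
  have dNb: "3 \<le> dN b" if "b \<in> N" "b \<noteq> a" for b
  proof -
    have "dR b \<le> card (R - {y})" by (rule dR_mono) (use yb[OF that] in auto)
    then show ?thesis using deg_b[OF that] N6 r y by simp
  qed
  note F = N6 a yz v RS
  show ?thesis
  proof (cases "z \<in> nb a")
    case az: True
    show ?thesis
    proof (cases "v \<in> nb a")
      case True
      then show ?thesis
        by (intro HIST_by_expansions[of "{}" "[(a, {y, z, v})]"]) (use F az in \<open>auto simp: card_insert_if\<close>)
    next
      case av: False
      show ?thesis
      proof (cases "v \<in> nb z")
        case True
        obtain t where t: "t \<in> N" "t \<in> nb z" "t \<noteq> a"
          using ex_nb_N_ne[of z a] deg_z dR_z r N6 by auto
        show ?thesis
          by (rule HIST_by_expansions[of "{t}" "[(a, {y, z}), (z, {v, t})]"])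
            (use F az True t N_D[OF t(1)] in \<open>auto simp: card_insert_if\<close>)
      next
        case False
        obtain b where b: "b \<in> N" "b \<in> nb v" using ex_nb_N[OF linked[of v]] v by blast
        have ba: "b \<noteq> a" using av b nb_commute[of a v] by auto
        obtain b' where b': "b' \<in> N" "b' \<in> nb b" "b' \<noteq> a" using ex_nb_N_ne[of b a] dNb[OF b(1) ba] by auto
        have "b' \<noteq> b" using b' by auto
        then show ?thesis
          by (intro HIST_by_expansions[of "{b'}" "[(a, {y, z}), (b, {v, b'})]"])
            (use F az ba b N_D[OF b(1)] b' N_D[OF b'(1)] nb_commute[of v b] in \<open>auto simp: card_insert_if\<close>)
      qed
    qed
  next
    case az: False
    \<comment> \<open>Having lost \<open>a\<close>, the vertex \<open>z\<close> reaches degree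
      \<open>card N\<close> only by seeing all of \<open>N - {a}\<close> and also
      \<open>v\<close>.\<close>
    have sub: "nb z \<inter> N \<subseteq> N - {a}" using az nb_commute[of z a] by auto
    have "dN z \<le> card N - 1" using dN_mono[OF sub] a by simp
    then have dz: "dR z = 1" "dN z = card N - 1" using deg_z dR_z r N6 by linarith+
    have zN: "N - {a} \<subseteq> nb z" using dN_full[OF sub] dz a by simp
    have "Y = {v}" using R yz by auto
    then have zv: "v \<in> nb z" using dR_full[OF nbzR] dz by auto
    have zb: "z \<in> nb b" if "b \<in> N" "b \<noteq> a" for b using zN that nb_commute[of z b] by auto
    show ?thesis
    proof (cases "\<exists>c\<in>N. c \<in> nb a")
      case True
      then obtain c where c: "c \<in> N" "c \<in> nb a" by blast
      have ca: "c \<noteq> a" using c by auto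
      obtain b where b: "b \<in> N" "b \<noteq> a" "b \<noteq> c" using ex_member_ne2[of N a c] N6 by auto
      obtain b' where b': "b' \<in> N" "b' \<in> nb b" "b' \<noteq> a" "b' \<noteq> c"
        using ex_nb_N_ne2[of b a c] dNb[OF b(1,2)] by auto
      have b'b: "b' \<noteq> b" using b' by auto
      obtain t where t: "t \<in> N" "t \<noteq> a" "t \<noteq> b" "t \<noteq> c" "t \<noteq> b'" using ex_member_ne4[of N a b c b'] N6 by auto
      have "t \<in> nb z" using zN t by blast
      then show ?thesis
        by (intro HIST_by_expansions[of "{c, b', t}" "[(a, {y, c}), (b, {z, b'}), (z, {v, t})]"])
          (use F c ca N_D[OF c(1)] b zb[OF b(1,2)] N_D[OF b(1)] b' b'b N_D[OF b'(1)] t N_D[OF t(1)] zv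
            in \<open>auto simp: card_insert_if\<close>)
    next
      case noN: False
      have b'ex: "\<exists>b\<in>N. \<exists>b'\<in>N. b \<noteq> a \<and> b' \<in> nb b \<and> b' \<noteq> a \<and> b' \<noteq> b"
      proof -
        obtain b where b: "b \<in> N" "b \<noteq> a" using ex_member_ne[of N a] N6 by auto
        obtain b' where b': "b' \<in> N" "b' \<in> nb b" "b' \<noteq> a" using ex_nb_N_ne[of b a] dNb[OF b] by auto
        have "b' \<noteq> b" using b' by auto
        then show ?thesis using b b' by blast
      qed
      then obtain b b' where b: "b \<in> N" "b \<noteq> a" and b': "b' \<in> N" "b' \<in> nb b" "b' \<noteq> a" "b' \<noteq> b" by blast
      show ?thesis
      proof (cases "v \<in> nb a")
        case True
        then show ?thesis
          by (intro HIST_by_expansions[of "{b'}" "[(a, {y, v}), (b, {z, b'})]"])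
            (use F b zb[OF b] N_D[OF b(1)] b' N_D[OF b'(1)] in \<open>auto simp: card_insert_if\<close>)
      next
        case False
        have "dN a = 0" using noN ex_nb_N[of a] by auto
        moreover have "nb a \<inter> R \<subseteq> {y}" using RS False az by auto
        then have "dR a \<le> 1" using dR_mono[of a "{y}"] by auto
        ultimately have da: "card (nb a) \<le> 2" using degN[OF a(1)] by simp
        have "card N + card R \<le> card (nb a) + card (nb v) + 1"
          by (rule ore_NR) (use a v False in auto)
        then have "2 < dN v" using da degR[of v] dR_le[of v] v r N6 by simp
        then obtain t2 where t2: "t2 \<in> N" "t2 \<in> nb v" "t2 \<noteq> b" "t2 \<noteq> b'" using ex_nb_N_ne2[of v b b'] by auto
        have t2a: "t2 \<noteq> a" using t2 False nb_commute[of a v] by auto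
        obtain t where t: "t \<in> N" "t \<noteq> a" "t \<noteq> b" "t \<noteq> b'" "t \<noteq> t2" using ex_member_ne4[of N a b b' t2] N6 by auto
        have "t \<in> nb z" using zN t by blast
        then show ?thesis
          by (intro HIST_by_expansions[of "{b', t, t2}" "[(b, {z, b'}), (z, {v, t}), (v, {y, t2})]"])
            (use F b zb[OF b] N_D[OF b(1)] b' N_D[OF b'(1)] t N_D[OF t(1)] t2 t2a N_D[OF t2(1)] zv
              in \<open>auto simp: card_insert_if\<close>)
      qed
    qed
  qed
qed

lemma HIST_adjacent:
  assumes r: "4 \<le> card R" and az: "z \<in> nb a"
  shows "\<exists>T. HIST T G"
proof -
  have "card Y \<noteq> 1" using card_Y r by simp
  then show ?thesis
    by (intro HIST_by_expansions[of "{}" "[(a, {y, z}), (y, Y)]"])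
      (use N4 a yz az Y in \<open>auto simp: card_insert_if dest: R_D\<close>)
qed

text \<open>The vertices \<open>y\<close> and \<open>z\<close> hang below different neighbours
  \<open>a\<close> and \<open>b\<close> of \<open>x\<close>, and what remains of \<open>Y\<close>
  goes below \<open>y\<close>. The companion of \<open>z\<close> comes from \<open>Y\<close>, where
  the remainder must not be a single vertex, or from \<open>N\<close>, at the price of a second move
  from \<open>x\<close>.\<close>

lemma HIST_two_branches:
  assumes c: "c \<in> N" "c \<in> nb a" and b: "b \<in> N" "b \<noteq> a" "b \<in> nb z"
  shows "w \<in> Y \<Longrightarrow> w \<in> nb b \<Longrightarrow> 5 \<le> card R \<Longrightarrow> \<exists>T. HIST T G"
    and "b' \<in> N \<Longrightarrow> b' \<in> nb b \<Longrightarrow> b' \<noteq> a \<Longrightarrow> b' \<noteq> c \<Longrightarrow> 5 \<le> card N \<Longrightarrow> 4 \<le> card R \<Longrightarrow> \<exists>T. HIST T G"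
proof -
  have zb: "z \<in> nb b" "c \<noteq> a" using b c nb_commute[of z b] by auto
  note F = N4 a yz c N_D[OF c(1)] b N_D[OF b(1)] zb
  show "\<exists>T. HIST T G" if w: "w \<in> Y" "w \<in> nb b" and r: "5 \<le> card R"
  proof -
    have "card (Y - {w}) \<noteq> 1" using card_Y w r by simp
    moreover have "w \<in> R" "w \<noteq> y" "w \<noteq> z" "w \<notin> N" "w \<noteq> x" "w \<in> nb y" "w \<noteq> a" "w \<noteq> b" "w \<noteq> c"
      using Y_D[OF w(1)] b c by auto
    ultimately show ?thesis
      by (intro HIST_by_expansions[of "{c}" "[(a, {y, c}), (b, {z, w}), (y, Y - {w})]"])
        (use F w Y in \<open>auto simp: card_insert_if dest: R_D\<close>)
  qed
  show "\<exists>T. HIST T G" if b': "b' \<in> N" "b' \<in> nb b" "b' \<noteq> a" "b' \<noteq> c" and r: "5 \<le> card N" "4 \<le> card R"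
  proof -
    have "card Y \<noteq> 1" using card_Y r by simp
    moreover have "b' \<noteq> b" using b' by auto
    ultimately show ?thesis
      by (intro HIST_by_expansions[of "{c, b'}" "[(a, {y, c}), (b, {z, b'}), (y, Y)]"])
        (use F b' N_D[OF b'(1)] r Y in \<open>auto simp: card_insert_if dest: R_D\<close>)
  qed
qed

lemma ex_b:
  assumes az: "z \<notin> nb a"
  shows "\<exists>b\<in>N. b \<noteq> a \<and> b \<in> nb z"
proof -
  have "0 < dN z" using deg_z dR_z N4 card_R_le by linarith
  then obtain b where "b \<in> N" "b \<in> nb z" using ex_nb_N by blast
  moreover from this have "b \<noteq> a" using az nb_commute[of z a] by auto
  ultimately show ?thesis by blast
qed

lemma deg_a_ge:
  assumes az: "z \<notin> nb a"
  shows "card R \<le> card (nb a) + 1"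
proof -
  have "card N + card R \<le> card (nb a) + card (nb z) + 1"
    by (rule ore_NR) (use a z az in auto)
  then show ?thesis using deg_z degR[OF z(1)] by simp
qed

lemma HIST_N_partner_4:
  assumes r: "card R = 4" and az: "z \<notin> nb a" and c: "c \<in> N" "c \<in> nb a"
  shows "\<exists>T. HIST T G"
proof -
  have N5: "5 \<le> card N" using big r by simp
  obtain b where b: "b \<in> N" "b \<noteq> a" "b \<in> nb z" using ex_b[OF az] by blast
  have zb: "z \<in> nb b" "c \<noteq> a" using b c nb_commute[of z b] by auto
  note F = N5 a yz c N_D[OF c(1)] b N_D[OF b(1)] zb
  have cY: "card Y = 2" using card_Y r by simp
  show ?thesis
  proof (cases "Y \<subseteq> nb b")
    case True
    have "card (insert z Y) \<noteq> 1" using cY by (simp add: card_insert_if)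
    then show ?thesis
      by (intro HIST_by_expansions[of "{c}" "[(a, {y, c}), (b, insert z Y)]"])
        (use F True in \<open>auto simp: card_insert_if dest: R_D\<close>)
  next
    case False
    then obtain w where w: "w \<in> Y" "w \<notin> nb b" by blast
    have "dR b \<le> card (insert z (Y - {w}))" by (rule dR_mono) (use w yb[OF b(1,2)] in auto)
    also have "\<dots> = 2" using cY w by (simp add: card_insert_if)
    finally have dNb: "2 \<le> dN b" using deg_b[OF b(1,2)] N5 by simp
    show ?thesis
    proof (cases "\<exists>b'\<in>N. b' \<in> nb b \<and> b' \<noteq> a \<and> b' \<noteq> c")
      case True
      then show ?thesis using HIST_two_branches(2)[OF c b] N5 r by auto
    next
      case False
      \<comment> \<open>The neighbours of \<open>b\<close> in \<open>N\<close> are exactly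
        \<open>a\<close> and \<open>c\<close>. So \<open>b\<close> itself can serve as the companion
        of \<open>y\<close> below \<open>a\<close>, which frees \<open>c\<close> for
        \<open>z\<close> below \<open>b\<close>.\<close>
      then have sub: "nb b \<inter> N \<subseteq> {a, c}" by blast
      have "{a, c} \<subseteq> nb b" using dN_full[OF sub] dNb zb by (simp add: card_insert_if)
      moreover have "b \<noteq> c" "b \<in> nb a" using calculation nb_commute[of b a] by auto
      moreover have "card Y \<noteq> 1" using cY by simp
      ultimately show ?thesis
        by (intro HIST_by_expansions[of "{b, c}" "[(a, {y, b}), (b, {z, c}), (y, Y)]"])
          (use F Y in \<open>auto simp: card_insert_if dest: R_D\<close>)
    qed
  qed
qed

text \<open>The two-branch trees leave only \<open>card N = 4\<close> and \<open>card R = 5\<close>.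
  There, the nonexistence of further trees forbids all edges from \<open>Y\<close> to
  \<open>a\<close>, to the neighbours of \<open>z\<close> in \<open>N\<close>, and to neighbours of
  \<open>z\<close> in \<open>Y\<close>. The vertices of \<open>Y\<close> then have just enough
  candidates for neighbours, so their neighbourhoods are determined, and a vertex of
  \<open>N\<close> adjacent to \<open>b\<close> exceeds the maximum degree.\<close>

lemma HIST_N_partner_ge5:
  assumes r: "5 \<le> card R" and az: "z \<notin> nb a" and c: "c \<in> N" "c \<in> nb a"
  shows "\<exists>T. HIST T G"
proof (rule ccontr)
  assume no: "\<nexists>T. HIST T G"
  have bY: "nb b \<inter> Y = {}" if b: "b \<in> N" "b \<noteq> a" "b \<in> nb z" for b
    using HIST_two_branches(1)[OF c b] no r by blast
  have dNb: "card N - 2 \<le> dN b" if b: "b \<in> N" "b \<noteq> a" "b \<in> nb z" for b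
  proof -
    have "nb b \<inter> R \<subseteq> {z}" using bY[OF b] yb[OF b(1,2)] by blast
    then show ?thesis using dR_mono[of b "{z}"] deg_b[OF b(1,2)] by simp
  qed
  obtain b where b: "b \<in> N" "b \<noteq> a" "b \<in> nb z" using ex_b[OF az] by blast
  have N: "card N = 4"
  proof (rule ccontr)
    assume "card N \<noteq> 4"
    then have N5: "5 \<le> card N" using N4 by simp
    then have "2 < dN b" using dNb[OF b] by linarith
    then obtain b' where "b' \<in> N" "b' \<in> nb b" "b' \<noteq> a" "b' \<noteq> c"
      using ex_nb_N_ne2[of b a c] by auto
    then show False using HIST_two_branches(2)[OF c b] N5 r no by simp
  qed
  then have R5: "card R = 5" using r card_R_le by simp
  then have cY: "card Y = 3" using card_Y by simp
  have ca: "c \<noteq> a" using c by auto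
  have wY: "nb w \<inter> Y = {}" if w: "w \<in> Y" "w \<in> nb z" for w
  proof (rule ccontr)
    assume "nb w \<inter> Y \<noteq> {}"
    then obtain s where s: "s \<in> Y" "s \<in> nb w" by blast
    have "s \<noteq> w" using s by auto
    moreover have "card (Y - {s}) \<noteq> 1" using cY s by simp
    ultimately have "\<exists>T. HIST T G"
      by (intro HIST_by_expansions[of "{c}" "[(a, {y, c}), (y, Y - {s}), (w, {z, s})]"])
        (use N4 a yz c ca N_D[OF c(1)] Y w s Y_D[OF w(1)] Y_D[OF s(1)] nb_commute[of w z]
          in \<open>auto simp: card_insert_if dest: R_D\<close>)
    then show False using no by blast
  qed
  have aY: "nb a \<inter> Y = {}"
  proof (rule ccontr)
    assume "nb a \<inter> Y \<noteq> {}"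
    then obtain s where s: "s \<in> Y" "s \<in> nb a" by blast
    obtain b' where b': "b' \<in> N" "b' \<in> nb b" "b' \<noteq> a" using ex_nb_N_ne[of b a] dNb[OF b] N by auto
    have "b' \<noteq> b" using b' by auto
    moreover have "card (Y - {s}) \<noteq> 1" using cY s by simp
    ultimately have "\<exists>T. HIST T G"
      by (intro HIST_by_expansions[of "{b'}" "[(a, {y, s}), (b, {z, b'}), (y, Y - {s})]"])
        (use N4 a yz b N_D[OF b(1)] Y s Y_D[OF s(1)] b' N_D[OF b'(1)] nb_commute[of b z]
          in \<open>auto simp: card_insert_if dest: R_D\<close>)
    then show False using no by blast
  qed
  define B where "B = nb z \<inter> N"
  have BN: "B \<subseteq> N - {a}" using az nb_commute[of z a] by (auto simp: B_def)
  have cB: "card B + dR z = 4" using deg_z N by (simp add: B_def dN_def)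
  have cNB: "card (N - {a} - B) + card B = 3"
  proof -
    have "card (N - {a} - B) = card (N - {a}) - card B"
      using BN by (intro card_Diff_subset) (auto simp: B_def)
    moreover have "card B \<le> card (N - {a})" using BN by (intro card_mono) auto
    ultimately show ?thesis using a N by simp
  qed
  have sub: "nb w \<subseteq> {y, z} \<union> (N - {a} - B)" if w: "w \<in> Y" "w \<in> nb z" for w
  proof
    fix u assume u: "u \<in> nb w"
    have wR: "w \<in> R" using w by blast
    have "u \<in> N \<or> u \<in> R" using nb_R[OF wR] u by blast
    moreover have "u \<noteq> a" using aY u w nb_commute[of w a] by blast
    moreover have "u \<notin> B" if "u \<in> N"
      using bY[of u] u w nb_commute[of w u] \<open>u \<noteq> a\<close> that by (auto simp: B_def)
    moreover have "u \<notin> Y" using wY[OF w] u by blast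
    ultimately show "u \<in> {y, z} \<union> (N - {a} - B)" by blast
  qed
  have dw: "4 \<le> card (nb w)" if w: "w \<in> Y" for w
    using deg_R_ge[of w] degR[of w] w R5 by simp
  have card_le: "card ({y, z} \<union> (N - {a} - B)) \<le> 2 + card (N - {a} - B)"
    using card_Un_le[of "{y, z}" "N - {a} - B"] yz by simp
  have "0 < dR z" using cB cNB by linarith
  then obtain w0 where w0: "w0 \<in> Y" "w0 \<in> nb z" using ex_member[of "nb z \<inter> R"] nbzR unfolding dR_def by blast
  \<comment> \<open>At least 4 neighbours among at most 2 + (3 - \<open>card B\<close>) candidates
    give \<open>card B \<le> 1\<close>; conversely \<open>card B = 4 - dR z\<close> and
    \<open>dR z \<le> 3\<close>.\<close>
  have "card (nb w0) \<le> card ({y, z} \<union> (N - {a} - B))" by (rule card_mono[OF _ sub[OF w0]]) auto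
  then have B1: "card B = 1" using dw[OF w0(1)] card_le cNB cB dR_z R5 by linarith
  then have "card Y \<le> dR z" using cB cY by simp
  then have Yz: "Y \<subseteq> nb z" using dR_full[OF nbzR] by simp
  have Yn: "N - {a} - B \<subseteq> nb w" if w: "w \<in> Y" for w
  proof -
    have wz: "w \<in> nb z" using Yz w by blast
    have "nb w = {y, z} \<union> (N - {a} - B)"
      by (rule card_seteq[OF _ sub[OF w wz]]) (use dw[OF w] card_le cNB B1 in auto)
    then show ?thesis by blast
  qed
  have bB: "b \<in> B" using b by (simp add: B_def)
  obtain e where e: "e \<in> N" "e \<in> nb b" "e \<noteq> a" using ex_nb_N_ne[of b a] dNb[OF b] N by auto
  have "e \<noteq> b" using e by auto
  then have "e \<notin> B" using bB B1 by (metis card_1_singletonE singletonD)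
  then have "Y \<subseteq> nb e" using Yn e nb_commute[of e] by blast
  then have "card Y \<le> dR e" unfolding dR_def by (intro card_mono) auto
  moreover have "0 < dN e" using dN_pos[of b e] b e nb_commute[of b e] by simp
  ultimately show False using deg_b[OF e(1,3)] N cY by simp
qed

text \<open>If \<open>a\<close> sees both vertices of \<open>Y\<close>, it takes them along with
  \<open>y\<close>. Otherwise it misses some \<open>w\<close>, and its degree 3 makes the degree of
  \<open>w\<close> so large that \<open>w\<close> and \<open>z\<close> share a neighbour
  \<open>b\<close> in \<open>N\<close>, below which they form a pair.\<close>

lemma HIST_no_N_partner_4:
  assumes r: "card R = 4" and az: "z \<notin> nb a" and noN: "dN a = 0"
  shows "\<exists>T. HIST T G"
proof -
  have N5: "5 \<le> card N" using big r by simp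
  have cY: "card Y = 2" using card_Y r by simp
  have an: "a \<notin> nb b" if "b \<in> N" for b
    using noN dN_pos[of b a] that nb_commute[of a b] by auto
  show ?thesis
  proof (cases "Y \<subseteq> nb a")
    case True
    obtain b where b: "b \<in> N" "b \<noteq> a" "b \<in> nb z" using ex_b[OF az] by blast
    have "dR b \<le> card (R - {y})" by (rule dR_mono) (use yb[OF b(1,2)] in auto)
    then have "0 < dN b" using deg_b[OF b(1,2)] N5 r y by simp
    then obtain b' where b': "b' \<in> N" "b' \<in> nb b" using ex_nb_N by blast
    have "b' \<noteq> b" "b' \<noteq> a" using b' an b by auto
    moreover have "card (insert y Y) \<noteq> 1" using cY by (simp add: card_insert_if)
    ultimately show ?thesis
      by (intro HIST_by_expansions[of "{b'}" "[(a, insert y Y), (b, {z, b'})]"])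
        (use N5 a yz True b N_D[OF b(1)] b' N_D[OF b'(1)] nb_commute[of b z]
          in \<open>auto simp: card_insert_if dest: R_D\<close>)
  next
    case False
    then obtain w where w: "w \<in> Y" "w \<notin> nb a" by blast
    obtain t where Yt: "Y = {w, t}" "t \<noteq> w" using card_2_with[OF cY w(1)] by blast
    have RS: "R \<subseteq> {y, z, w, t}" and tY: "t \<in> Y" using Yt(1) by auto
    have nbaR: "nb a \<inter> R \<subseteq> {y, t}" using RS w(2) az by auto
    have dRa: "dR a \<le> 2" using dR_mono[OF nbaR] by (auto simp: card_insert_if split: if_splits)
    then have da: "card (nb a) \<le> 3" using noN degN[OF a(1)] by simp
    have "card {y, t} \<le> dR a" using deg_a_ge[OF az] noN degN[OF a(1)] r by (simp add: card_insert_if)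
    then have ta: "t \<in> nb a" using dR_full[OF nbaR] by simp
    have wR: "w \<in> R" "w \<noteq> a" using Y_D[OF w(1)] by simp_all
    have "card N + card R \<le> card (nb a) + card (nb w) + 1"
      by (rule ore_NR) (use a w wR in auto)
    then have dNw: "card N - 3 \<le> dN w" using da degR[OF wR(1)] dR_le[OF wR(1)] r by simp
    have dNz: "card N - 2 \<le> dN z" using deg_z dR_z r by simp
    \<comment> \<open>Both sets lie in \<open>N - {a}\<close>, and their sizes add up to at least 2
      \<open>card N\<close> - 5, which exceeds \<open>card N - 1\<close> as
      \<open>5 \<le> card N\<close>.\<close>
    have "(nb w \<inter> N) \<inter> (nb z \<inter> N) \<noteq> {}"
    proof
      assume "(nb w \<inter> N) \<inter> (nb z \<inter> N) = {}"
      then have "card ((nb w \<inter> N) \<union> (nb z \<inter> N)) = dN w + dN z"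
        unfolding dN_def by (intro card_Un_disjoint) auto
      moreover have "card ((nb w \<inter> N) \<union> (nb z \<inter> N)) \<le> card (N - {a})"
        by (rule card_mono) (use w az nb_commute[of a w] nb_commute[of a z] in auto)
      ultimately show False using dNw dNz N5 a(1) by simp
    qed
    then obtain b where b: "b \<in> N" "b \<in> nb w" "b \<in> nb z" by blast
    have ba: "b \<noteq> a" using b az nb_commute[of a z] by auto
    show ?thesis
      by (rule HIST_by_expansions[of "{}" "[(a, {y, t}), (b, {z, w})]"])
        (use N5 a yz ta b ba N_D[OF b(1)] RS Y_D[OF w(1)] Y_D[OF tY] Yt(2) nb_commute[of b z] nb_commute[of b w]
          in \<open>auto simp: card_insert_if\<close>)
  qed
qed

text \<open>The companion of \<open>y\<close> below \<open>a\<close> must come from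
  \<open>Y\<close>. Any neighbour \<open>b\<close> of \<open>z\<close> in \<open>N\<close> has no
  neighbour in \<open>N\<close>, since such a vertex would be a companion for \<open>z\<close>; by
  its maximum degree \<open>b\<close> then sees \<open>card N - 2\<close> vertices of
  \<open>Y\<close>. The obvious trees leave \<open>card N = 4\<close> and \<open>card R = 5\<close>,
  where \<open>a\<close> and every such \<open>b\<close> miss the same single \<open>s\<close> of
  \<open>Y\<close>. This rigid configuration leaves some vertex of \<open>N\<close> with too few
  neighbours.\<close>

lemma HIST_no_N_partner_ge5:
  assumes r: "5 \<le> card R" and az: "z \<notin> nb a" and noN: "dN a = 0"
  shows "\<exists>T. HIST T G"
proof (rule ccontr)
  assume no: "\<nexists>T. HIST T G"
  have an: "a \<notin> nb b" if "b \<in> N" for b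
    using noN dN_pos[of b a] that nb_commute[of a b] by auto
  have daY: "card R - 3 \<le> card (nb a \<inter> Y)"
  proof -
    have "nb a \<inter> R \<subseteq> insert y (nb a \<inter> Y)" using az by blast
    then have "dR a \<le> card (insert y (nb a \<inter> Y))" by (rule dR_mono) auto
    also have "\<dots> = Suc (card (nb a \<inter> Y))" by (simp add: card_insert_if)
    finally show ?thesis using deg_a_ge[OF az] noN degN[OF a(1)] by simp
  qed
  then have "0 < card (nb a \<inter> Y)" using r by linarith
  then obtain t where t: "t \<in> Y" "t \<in> nb a" using ex_member[of "nb a \<inter> Y"] by blast
  have dN0: "dN b = 0" if b: "b \<in> N" "b \<noteq> a" "b \<in> nb z" for b
  proof (rule ccontr)
    assume "dN b \<noteq> 0"
    then obtain b' where b': "b' \<in> N" "b' \<in> nb b" using ex_nb_N[of b] by auto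
    have "b' \<noteq> b" "b' \<noteq> a" using b' an b by auto
    moreover have "card (Y - {t}) \<noteq> 1" using card_Y r t by simp
    ultimately have "\<exists>T. HIST T G"
      by (intro HIST_by_expansions[of "{b'}" "[(a, {y, t}), (b, {z, b'}), (y, Y - {t})]"])
        (use N4 a yz b N_D[OF b(1)] Y t Y_D[OF t(1)] b' N_D[OF b'(1)] nb_commute[of b z]
          in \<open>auto simp: card_insert_if dest: R_D\<close>)
    then show False using no by blast
  qed
  have dbY: "card (nb b \<inter> Y) = card N - 2" if b: "b \<in> N" "b \<noteq> a" "b \<in> nb z" for b
  proof -
    have "nb b \<inter> R = insert z (nb b \<inter> Y)" using b z yb[OF b(1,2)] nb_commute[of b z] by auto
    then have "dR b = Suc (card (nb b \<inter> Y))" by (simp add: dR_def card_insert_if)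
    then show ?thesis using deg_b[OF b(1,2)] dN0[OF b] by simp
  qed
  obtain b where b: "b \<in> N" "b \<noteq> a" "b \<in> nb z" using ex_b[OF az] by blast
  have R5: "card R = 5"
  proof (rule ccontr)
    assume "card R \<noteq> 5"
    then have r6: "6 \<le> card R" using r by simp
    have "1 < card (nb b \<inter> Y)" using dbY[OF b] card_R_le r6 by linarith
    then obtain w where w: "w \<in> Y" "w \<in> nb b" "w \<noteq> t" using ex_member_ne[of "nb b \<inter> Y" t] by blast
    have "card (Y - {t, w}) = card Y - 2" using t w by (auto simp: card_Diff_subset)
    then have "card (Y - {t, w}) \<noteq> 1" using card_Y r6 by simp
    then have "\<exists>T. HIST T G"
      by (intro HIST_by_expansions[of "{}" "[(a, {y, t}), (b, {z, w}), (y, Y - {t, w})]"])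
        (use N4 a yz b N_D[OF b(1)] Y t Y_D[OF t(1)] w Y_D[OF w(1)] nb_commute[of b z]
          in \<open>auto simp: card_insert_if dest: R_D\<close>)
    then show False using no by blast
  qed
  then have cY: "card Y = 3" using card_Y by simp
  have cover: False if b: "b \<in> N" "b \<noteq> a" "b \<in> nb z" and t: "t \<in> Y" "t \<in> nb a" and sub: "Y - {t} \<subseteq> nb b" for b t
  proof -
    have "card (insert z (Y - {t})) \<noteq> 1" using cY t by (simp add: card_insert_if)
    then have "\<exists>T. HIST T G"
      by (intro HIST_by_expansions[of "{}" "[(a, {y, t}), (b, insert z (Y - {t}))]"])
        (use N4 a yz b N_D[OF b(1)] sub t Y_D[OF t(1)] nb_commute[of b z]
          in \<open>auto simp: card_insert_if dest: R_D\<close>)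
    then show False using no by blast
  qed
  have N: "card N = 4"
  proof (rule ccontr)
    assume "card N \<noteq> 4"
    then have "card Y \<le> card (nb b \<inter> Y)" using dbY[OF b] N4 cY by simp
    then have "nb b \<inter> Y = Y" by (intro card_seteq) auto
    then show False using cover[OF b t] by blast
  qed
  have "card (nb a \<inter> Y) \<le> 2"
  proof (rule ccontr)
    assume "\<not> ?thesis"
    then have "nb a \<inter> Y = Y" using cY by (intro card_seteq) auto
    moreover have "\<exists>t\<in>Y. Y - {t} \<subseteq> nb b"
    proof -
      have "card (Y - nb b) = 1" using dbY[OF b] N cY card_Diff_subset_Int[of Y "nb b"] by (simp add: Int_commute)
      then obtain t where "Y - nb b = {t}" by (meson card_1_singletonE)
      then show ?thesis by blast
    qed
    ultimately show False using cover[OF b] by blast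
  qed
  then have aY2: "card (nb a \<inter> Y) = 2" using daY R5 by simp
  then have "card (Y - nb a) = 1" using cY card_Diff_subset_Int[of Y "nb a"] by (simp add: Int_commute)
  then obtain s where s: "Y - nb a = {s}" by (meson card_1_singletonE)
  have sY: "s \<in> Y" "s \<notin> nb a" and Ys: "Y - {s} \<subseteq> nb a" using s by auto
  have nbb: "nb b \<inter> Y = Y - {s}" if b: "b \<in> N" "b \<noteq> a" "b \<in> nb z" for b
  proof -
    have "card (Y - nb b) = 1" using dbY[OF b] N cY card_Diff_subset_Int[of Y "nb b"] by (simp add: Int_commute)
    then obtain t where t: "Y - nb b = {t}" by (meson card_1_singletonE)
    have "t \<notin> nb a" using cover[OF b, of t] t by blast
    then have "t = s" using t s by blast
    then show ?thesis using t by blast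
  qed
  define B where "B = nb z \<inter> N"
  have B: "e \<in> N" "e \<noteq> a" "e \<in> nb z" if "e \<in> B" for e
    using that az nb_commute[of z a] by (auto simp: B_def)
  have cB: "card B + dR z = 4" using deg_z N by (simp add: B_def dN_def)
  have finB: "finite B" by (simp add: B_def)
  have bB: "b \<in> B" using b by (simp add: B_def)
  have tsub: "{y, a} \<union> B \<subseteq> nb t" if t: "t \<in> Y - {s}" for t
  proof -
    have "t \<in> nb e" if "e \<in> B" for e using nbb[OF B[OF that]] t by blast
    then show ?thesis using Y_D[of t] t Ys nb_commute[of t] by blast
  qed
  have dt: "card (nb t) \<le> 4" if "t \<in> Y" for t using deg_le[of t] that N by auto
  have cyaB: "card ({y, a} \<union> B) = 2 + card B"
  proof -
    have "{y, a} \<inter> B = {}" using B yz by (auto simp: B_def)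
    then show ?thesis using finB a by (subst card_Un_disjoint) auto
  qed
  \<comment> \<open>With two vertices in \<open>B\<close>, the neighbours \<open>y\<close>,
    \<open>a\<close> and \<open>B\<close> already exhaust the maximum degree 4 of each
    \<open>t\<close> in \<open>Y - {s}\<close>. So \<open>z\<close> sees at most \<open>s\<close> in
    \<open>R\<close>, and \<open>card B + dR z\<close> is at most 3 instead of 4.\<close>
  have "card B = 1"
  proof (rule ccontr)
    assume "card B \<noteq> 1"
    then have B2: "2 \<le> card B" using bB finB by (metis One_nat_def Suc_1 card_0_eq emptyE less_2_cases not_less)
    have "z \<notin> nb t" if t: "t \<in> Y - {s}" for t
    proof
      assume "z \<in> nb t"
      then have "insert z ({y, a} \<union> B) \<subseteq> nb t" using tsub[OF t] by blast
      then have "card (insert z ({y, a} \<union> B)) \<le> card (nb t)" by (intro card_mono) auto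
      moreover have "z \<notin> {y, a} \<union> B" using yz a by (auto simp: B_def)
      ultimately show False using cyaB B2 dt[of t] t finB by simp
    qed
    then have "nb z \<inter> R \<subseteq> {s}" using nbzR nb_commute[of z] by blast
    then have "dR z \<le> 1" using dR_mono[of z "{s}"] by simp
    moreover have "card B \<le> 2"
    proof -
      obtain t where t: "t \<in> Y - {s}" using cY sY ex_member_ne[of Y s] by auto
      have "card ({y, a} \<union> B) \<le> card (nb t)" by (rule card_mono[OF _ tsub[OF t]]) simp
      then show ?thesis using cyaB dt[of t] t by simp
    qed
    ultimately show False using cB by simp
  qed
  then have Beq: "B = {b}" using bB by (metis card_1_singletonE singletonD)
  have "card Y \<le> dR z" using cB \<open>card B = 1\<close> cY by simp
  then have Yz: "Y \<subseteq> nb z" using dR_full[OF nbzR] by simp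
  have nbt: "nb t = {y, a, b, z}" if t: "t \<in> Y - {s}" for t
  proof (rule card_seteq[symmetric])
    show "{y, a, b, z} \<subseteq> nb t" using tsub[OF t] Beq Yz t nb_commute[of z t] by blast
    have "b \<noteq> y" "b \<noteq> z" using b yz by auto
    then have "card {y, a, b, z} = 4" using a b yz by (simp add: card_insert_if)
    then show "card (nb t) \<le> card {y, a, b, z}" using dt[of t] t by simp
  qed simp
  have sR: "s \<in> R" using sY by blast
  have sx: "s \<noteq> y" "s \<noteq> z" "s \<noteq> a" "s \<noteq> b" using sY a N_D[OF b(1)] by auto
  have subs: "nb s \<subseteq> {y, z} \<union> (N - {a, b})"
  proof
    fix u assume u: "u \<in> nb s"
    have "u \<in> N \<or> u \<in> R" using nb_R[OF sR] u by blast
    moreover have "u \<noteq> a" using u sY nb_commute[of a s] by auto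
    moreover have "u \<noteq> b" using u nbb[OF b] sY nb_commute[of b s] by auto
    moreover have "u \<notin> Y - {s}" using nbt[of u] u nb_commute[of u s] sx by auto
    moreover have "u \<noteq> s" using u by auto
    ultimately show "u \<in> {y, z} \<union> (N - {a, b})" by blast
  qed
  have cab: "card (N - {a, b}) = 2" using a b N by (auto simp: card_Diff_subset)
  have "card ({y, z} \<union> (N - {a, b})) \<le> 4"
    using card_Un_le[of "{y, z}" "N - {a, b}"] cab yz by simp
  moreover have "4 \<le> card (nb s)" using deg_R_ge[OF sR] degR[OF sR] R5 by simp
  ultimately have "nb s = {y, z} \<union> (N - {a, b})" using subs by (intro card_seteq) auto
  then have sN: "N - {a, b} \<subseteq> nb s" by blast
  obtain e where e: "e \<in> N" "e \<noteq> a" "e \<noteq> b" using cab ex_member[of "N - {a, b}"] by auto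
  \<comment> \<open>Besides \<open>x\<close>, the vertex \<open>e\<close> can see only
    \<open>s\<close> and the one vertex of \<open>N\<close> outside \<open>a\<close>,
    \<open>b\<close>, \<open>e\<close>, but \<open>deg_b\<close> demands degree 4.\<close>
  have "nb e \<inter> R \<subseteq> {s}"
  proof
    fix u assume u: "u \<in> nb e \<inter> R"
    have "u \<noteq> y" using yb[OF e(1,2)] u by blast
    moreover have "u \<noteq> z" using Beq e u nb_commute[of e z] by (auto simp: B_def)
    moreover have "u \<notin> Y - {s}"
    proof
      assume "u \<in> Y - {s}"
      then have "e \<in> {y, a, b, z}" using nbt[of u] u nb_commute[of e u] by blast
      then show False using e yz by auto
    qed
    ultimately show "u \<in> {s}" using u by blast
  qed
  then have "dR e \<le> 1" using dR_mono[of e "{s}"] by simp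
  moreover have "nb e \<inter> N \<subseteq> N - {a, b, e}"
    using an[OF e(1)] dN0[OF b] dN_pos[of e b] e nb_commute[of e b] nb_irrefl[of e] by auto
  then have "dN e \<le> card (N - {a, b, e})" by (rule dN_mono) simp
  moreover have "card (N - {a, b, e}) = 1" using a b e N by (auto simp: card_Diff_subset)
  ultimately show False using deg_b[OF e(1,2)] N by simp
qed

lemma HIST_missed: "\<exists>T. HIST T G"
proof -
  consider "card R = 2" | "card R = 3" | "4 \<le> card R" "z \<in> nb a"
    | c where "4 \<le> card R" "z \<notin> nb a" "c \<in> N" "c \<in> nb a" | "4 \<le> card R" "z \<notin> nb a" "dN a = 0"
    using card_Y(2) ex_nb_N[of a] by (cases "z \<in> nb a"; cases "dN a = 0"; force)
  then show ?thesis
  proof cases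
    case (4 c)
    then show ?thesis using HIST_N_partner_4[of c] HIST_N_partner_ge5[of c] by (cases "card R = 4") auto
  next
    case 5
    then show ?thesis using HIST_no_N_partner_4 HIST_no_N_partner_ge5 by (cases "card R = 4") auto
  qed (use HIST_card_2 HIST_card_3 HIST_adjacent in auto)
qed

end

lemma (in ore_graph) HIST_few_common_nbs:
  assumes r: "2 \<le> card R" and y: "y \<in> R" "dN y \<le> 1"
  shows "\<exists>T. HIST T G"
proof (cases "\<exists>w\<in>R. dN w = 0")
  case True
  then show ?thesis using HIST_separated r by blast
next
  case False
  then have linked: "0 < dN w" if "w \<in> R" for w using that by auto
  have "card (nb y \<inter> N) = 1" using y linked[OF y(1)] by (simp add: dN_def)
  then obtain a where a: "nb y \<inter> N = {a}" by (meson card_1_singletonE)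
  show ?thesis
  proof (cases "R - {y} \<subseteq> nb y")
    case True
    then show ?thesis using HIST_linked_covering[of y a] linked y(1) a r by blast
  next
    case False
    then obtain z where z: "z \<in> R" "z \<noteq> y" "z \<notin> nb y" by blast
    interpret missed_vertex G x y z a
      by unfold_locales (use linked y z a in auto)
    show ?thesis by (rule HIST_missed)
  qed
qed

section \<open>Every vertex of \<open>R\<close> has two neighbours in \<open>N\<close>\<close>

context pair_graph
begin

text \<open>\<open>(v, w) \<in> (up S f x)\<^sup>*\<close> says that \<open>w\<close> is \<open>v\<close> or an ancestor of \<open>v\<close>.\<close>

definition up :: "'a set \<Rightarrow> ('a \<Rightarrow> 'a) \<Rightarrow> 'a \<Rightarrow> 'a rel" where
  "up S f x = {(v, f v) | v. v \<in> S - {x}}"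

text \<open>The leaf \<open>a\<close> receives two children at once, the new \<open>y\<close> and
  the old child \<open>c\<close> of \<open>x\<close>, which brings its whole subtree. The last
  assumption says that \<open>a\<close> is not in that subtree, as otherwise a cycle would
  arise.\<close>

lemma hit_rehang:
  assumes hit: "hit S f x" and D: "4 \<le> card (kids S f x x)"
    and a: "a \<in> S" "a \<noteq> x" "kids S f x a = {}"
    and y: "y \<notin> S" "y \<in> nb a" and c: "c \<in> kids S f x x" "c \<in> nb a" "(a, c) \<notin> (up S f x)\<^sup>*"
  shows "hit (insert y S) (f(c := a, y := a)) x"
proof -
  let ?f = "f(c := a, y := a)" and ?S = "insert y S"
  obtain h :: "'a \<Rightarrow> nat" where h: "\<forall>v\<in>S - {x}. h (f v) < h v"
    using hit by (auto simp: hit_def)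
  have par: "\<forall>v\<in>S - {x}. f v \<in> S \<and> v \<in> nb (f v)" and x: "x \<in> S" and SV: "S \<subseteq> pverts G"
    using hit by (auto simp: hit_def)
  have finS: "finite S" using SV pair_finite_verts by (rule finite_subset)
  have cS: "c \<in> S" "c \<noteq> x" "f c = x" "c \<noteq> y" "c \<noteq> a" using c y by (auto simp: kids_def)
  have ne: "y \<noteq> x" "y \<noteq> a" using y x a by auto
  define B where "B = {v. (v, c) \<in> (up S f x)\<^sup>*}"
  \<comment> \<open>The subtree \<open>B\<close> of \<open>c\<close> is lifted uniformly by
    \<open>Suc (h a)\<close>, so that \<open>c\<close> ranks above its new parent \<open>a\<close>
    while the order inside \<open>B\<close> is kept.\<close>
  define h' where "h' = (\<lambda>v. if v = y then Suc (h a) else if v \<in> B then h v + Suc (h a) else h v)"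
  have aB: "a \<notin> B" using c by (simp add: B_def)
  have cB: "c \<in> B" by (simp add: B_def)
  have B1: "f v \<in> B" if v: "v \<in> B" "v \<in> S - {x}" "v \<noteq> c" for v
  proof -
    have "(v, c) \<in> (up S f x)\<^sup>*" using v by (simp add: B_def)
    then obtain w where "(v, w) \<in> up S f x" "(w, c) \<in> (up S f x)\<^sup>*"
      using v(3) by (meson converse_rtranclE)
    then show ?thesis by (auto simp: B_def up_def)
  qed
  have B2: "v \<in> B" if "f v \<in> B" "v \<in> S - {x}" for v
    using that by (auto simp: B_def up_def intro: converse_rtrancl_into_rtrancl)
  have yS: "f v \<noteq> y" if "v \<in> S - {x}" for v using par that y by auto
  have rank: "\<forall>v\<in>?S - {x}. h' (?f v) < h' v"
  proof
    fix v assume v: "v \<in> ?S - {x}"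
    show "h' (?f v) < h' v"
    proof (cases "v = y \<or> v = c")
      case True
      then show ?thesis using aB cB ne cS by (auto simp: h'_def)
    next
      case False
      then have "v \<in> S - {x}" using v by simp
      then show ?thesis using False h yS[of v] B1[of v] B2[of v] by (auto simp: h'_def)
    qed
  qed
  have kids_x: "kids ?S ?f x x = kids S f x x - {c}"
    using ne cS a y(1) by (auto simp: kids_def)
  have kids_a: "kids ?S ?f x a = {c, y}"
    using a ne cS y by (auto simp: kids_def)
  have kids_o: "kids ?S ?f x u = kids S f x u" if "u \<noteq> a" "u \<noteq> x" for u
    using that cS y by (auto simp: kids_def)
  have kids_y: "kids S f x y = {}" using yS by (auto simp: kids_def)
  show ?thesis unfolding hit_def
  proof (intro conjI ballI)
    show "x \<in> ?S" using x by simp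
    show "?S \<subseteq> pverts G" using SV y(2) nb_subset[of a] by auto
    show "\<exists>h::'a \<Rightarrow> nat. \<forall>v\<in>?S - {x}. h (?f v) < h v" using rank by blast
    show "3 \<le> card (kids ?S ?f x x)"
      unfolding kids_x using D c(1) finS by (simp add: kids_def)
    fix u assume u: "u \<in> ?S - {x}"
    show "?f u \<in> ?S" "u \<in> nb (?f u)" using u par a y c by auto
    show "card (kids ?S ?f x u) \<noteq> 1"
    proof (cases "u = a")
      case True
      then show ?thesis using kids_a cS by simp
    next
      case False
      then show ?thesis using kids_o[of u] u kids_y hit by (auto simp: hit_def)
    qed
  qed
qed

text \<open>The ancestors of a vertex form a chain, and a chain contains at most one child of the
  root. So the cycle condition in \<open>hit_rehang\<close> excludes only one choice of
  \<open>c\<close>.\<close>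

lemma up_top_unique:
  assumes "(a, c) \<in> (up S f x)\<^sup>*" "(a, c') \<in> (up S f x)\<^sup>*" "f c = x" "f c' = x" "c \<noteq> x" "c' \<noteq> x"
  shows "c = c'"
proof -
  have sv: "single_valued (up S f x)" by (auto simp: single_valued_def up_def)
  have top: "d = e" if "(d, e) \<in> (up S f x)\<^sup>*" "f d = x" "e \<noteq> x" for d e
    using that(1)
  proof (cases rule: converse_rtranclE)
    case (step w)
    then have "w = x" using that(2) by (auto simp: up_def)
    then have "(x, e) \<in> (up S f x)\<^sup>*" using step(2) by simp
    then have "e = x" by (cases rule: converse_rtranclE) (auto simp: up_def)
    then show ?thesis using that(3) by simp
  qed
  have "(c, c') \<in> (up S f x)\<^sup>* \<or> (c', c) \<in> (up S f x)\<^sup>*"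
    using single_valued_confluent[OF sv assms(1,2)] .
  then show ?thesis using top[of c c'] top[of c' c] assms(3-6) by auto
qed

end

context ore_graph
begin

text \<open>
  Each vertex of \<open>D\<close> gets a parent in \<open>N\<close>, and nobody gets exactly one child. Together with the star
  at \<open>x\<close> this is a tree of depth 2 without vertices of degree 2.
\<close>

definition pure :: "'a set \<Rightarrow> ('a \<Rightarrow> 'a) \<Rightarrow> bool" where
  "pure D g \<longleftrightarrow> D \<subseteq> R \<and> (\<forall>v\<in>D. g v \<in> N \<and> v \<in> nb (g v)) \<and> (\<forall>p\<in>N. card {v \<in> D. g v = p} \<noteq> 1)"

lemma ex_max_pure: "\<exists>D g. pure D g \<and> (\<forall>D' g'. pure D' g' \<longrightarrow> card D' \<le> card D)"
proof -
  define K where "K = {m. \<exists>D g. pure D g \<and> card D = m}"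
  have "pure {} id" by (simp add: pure_def)
  then have "K \<noteq> {}" by (auto simp: K_def)
  moreover have "K \<subseteq> {..card R}" by (auto simp: K_def pure_def intro: card_mono)
  then have "finite K" by (rule finite_subset) simp
  ultimately have MK: "Max K \<in> K" by simp
  then obtain D g where D: "pure D g" "card D = Max K" by (auto simp: K_def)
  have "card D' \<le> card D" if "pure D' g'" for D' g'
  proof -
    have "card D' \<in> K" using that by (auto simp: K_def)
    then show ?thesis using \<open>finite K\<close> D(2) by simp
  qed
  then show ?thesis using D(1) by blast
qed

end

section \<open>Exchange arguments for a largest \<open>pure\<close> set\<close>

locale max_pure = ore_graph G x for G :: "'a pair_pre_digraph" and x +
  fixes D :: "'a set" and g :: "'a \<Rightarrow> 'a"
  assumes pureD: "pure D g"
    and maxD: "\<And>D' g'. pure D' g' \<Longrightarrow> card D' \<le> card D"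
    and dN2: "\<And>y. y \<in> R \<Longrightarrow> 2 \<le> dN y"
begin

definition fib :: "'a \<Rightarrow> 'a set" where "fib p = {v \<in> D. g v = p}"
text \<open>Fibres of size 2 and larger ones behave differently under exchange: from a pair no
  single vertex can be taken without leaving an only child, from a larger fibre any one can.\<close>

definition P2 :: "'a set" where "P2 = {p \<in> N. card (fib p) = 2}"
definition P3 :: "'a set" where "P3 = {p \<in> N. 3 \<le> card (fib p)}"
definition C :: "'a set" where "C = {p \<in> N. fib p = {}}"
definition U :: "'a set" where "U = R - D"
definition A :: "'a \<Rightarrow> 'a set" where "A y = nb y \<inter> N"

lemma DR: "D \<subseteq> R" and gN: "v \<in> D \<Longrightarrow> g v \<in> N" and gnb: "v \<in> D \<Longrightarrow> v \<in> nb (g v)"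
  and fib1: "p \<in> N \<Longrightarrow> card (fib p) \<noteq> 1"
  using pureD by (auto simp: pure_def fib_def)

lemma fins[simp]: "finite D" "finite U" "finite (fib p)" "finite C" "finite P2" "finite P3" "finite (A y)"
  using DR finite_subset[OF DR] by (auto simp: U_def fib_def C_def P2_def P3_def A_def)

text \<open>Rehang all of \<open>S\<close> below \<open>a\<close>. The last assumption ensures that
  no robbed fibre shrinks to one vertex, so \<open>D \<union> S\<close> is again
  \<open>pure\<close>, and maximality forbids that it grows.\<close>

lemma improve:
  assumes "a \<in> N" "S \<subseteq> nb a \<inter> R" "fib a \<subseteq> S" "2 \<le> card S"
    and "\<And>p. p \<in> N \<Longrightarrow> p \<noteq> a \<Longrightarrow> card (fib p - S) \<noteq> 1"
  shows "S \<subseteq> D"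
proof -
  let ?g = "\<lambda>v. if v \<in> S then a else g v"
  have "{v \<in> D \<union> S. ?g v = p} = (if p = a then S else fib p - S)" if "p \<in> N" for p
    using assms(3) by (auto simp: fib_def)
  then have "pure (D \<union> S) ?g"
    using assms DR gN gnb by (auto simp: pure_def)
  then have "card (D \<union> S) \<le> card D" by (rule maxD)
  moreover have "finite (D \<union> S)" using assms(2) finite_subset[of S R] by auto
  ultimately have "D = D \<union> S" by (intro card_seteq) auto
  then show ?thesis by blast
qed

lemma U_D: "y \<in> U \<Longrightarrow> y \<in> R \<and> y \<notin> D" by (simp add: U_def)

text \<open>If \<open>a\<close> already had children, \<open>y\<close> could simply join
  them.\<close>

lemma A_C:
  assumes y: "y \<in> U" and a: "a \<in> A y"
  shows "a \<in> C"
proof (rule ccontr)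
  have aN: "a \<in> N" "y \<in> nb a" using a nb_commute[of a y] by (auto simp: A_def)
  assume "a \<notin> C"
  then have ne: "fib a \<noteq> {}" using aN by (simp add: C_def)
  have "y \<notin> fib a" using y by (simp add: U_def fib_def)
  then have "2 \<le> card (insert y (fib a))" using ne by (simp add: Suc_le_eq card_gt_0_iff)
  moreover have "fib p - insert y (fib a) = fib p" if "p \<noteq> a" for p
    using that y by (auto simp: U_def fib_def)
  ultimately have "insert y (fib a) \<subseteq> D"
    using aN y DR gnb fib1 U_D by (intro improve[of a]) (auto simp: fib_def)
  then show False using y by (simp add: U_def)
qed

lemma A_U:
  assumes y: "y \<in> U" and y': "y' \<in> U" "y' \<noteq> y" and a: "a \<in> A y"
  shows "y' \<notin> nb a"
proof
  assume *: "y' \<in> nb a"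
  have aN: "a \<in> N" "y \<in> nb a" using a nb_commute[of a y] by (auto simp: A_def)
  have "fib a = {}" using A_C[OF y a] by (simp add: C_def)
  moreover have "fib p - {y, y'} = fib p" for p using y y' by (auto simp: U_def fib_def)
  ultimately have "{y, y'} \<subseteq> D"
    using aN y y' * fib1 U_D by (intro improve[of a]) auto
  then show False using y by (simp add: U_def)
qed

lemma A_disjoint: "y \<in> U \<Longrightarrow> y' \<in> U \<Longrightarrow> y \<noteq> y' \<Longrightarrow> A y \<inter> A y' = {}"
  using A_U[of y y'] nb_commute by (auto simp: A_def)

lemma A_D:
  assumes y: "y \<in> U" and a: "a \<in> A y" and v: "v \<in> nb a" "v \<in> D"
  shows "g v \<in> P2" and "v' \<in> nb a \<Longrightarrow> v' \<in> D \<Longrightarrow> g v' = g v \<Longrightarrow> v' = v"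
proof -
  have aN: "a \<in> N" "y \<in> nb a" using a nb_commute[of a y] by (auto simp: A_def)
  have fa: "fib a = {}" using A_C[OF y a] by (simp add: C_def)
  have yv: "y \<noteq> v" "y \<notin> D" "y \<in> R" "v \<in> R" using y v DR by (auto simp: U_def)
  have vf: "v \<in> fib (g v)" using v by (simp add: fib_def)
  have pos: "0 < card (fib (g v))" using vf by (auto simp: card_gt_0_iff)
  have "\<not> 3 \<le> card (fib (g v))"
  proof
    assume 3: "3 \<le> card (fib (g v))"
    have "{y, v} \<subseteq> D"
    proof (rule improve[OF aN(1)])
      fix p assume p: "p \<in> N"
      show "card (fib p - {y, v}) \<noteq> 1"
      proof (cases "p = g v")
        case True
        have "fib p - {y, v} = fib p - {v}" using yv by (auto simp: fib_def)
        then show ?thesis using 3 vf True by simp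
      next
        case False
        then have "fib p - {y, v} = fib p" using yv by (auto simp: fib_def)
        then show ?thesis using fib1 p by simp
      qed
    qed (use aN fa yv v in auto)
    then show False using yv by simp
  qed
  moreover have "card (fib (g v)) \<noteq> 1" using fib1 gN v by blast
  ultimately have c2: "card (fib (g v)) = 2" using pos by linarith
  then show "g v \<in> P2" using gN v by (simp add: P2_def)
  show "v' = v" if v': "v' \<in> nb a" "v' \<in> D" "g v' = g v"
  proof (rule ccontr)
    assume ne: "v' \<noteq> v"
    have "v' \<in> fib (g v)" using v' by (simp add: fib_def)
    then obtain q where "fib (g v) = {v, q}" using card_2_with[OF c2 vf] by blast
    then have fv: "fib (g v) = {v, v'}" using \<open>v' \<in> fib (g v)\<close> ne by auto
    have "{y, v, v'} \<subseteq> D"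
    proof (rule improve[OF aN(1)])
      fix p assume p: "p \<in> N"
      show "card (fib p - {y, v, v'}) \<noteq> 1"
      proof (cases "p = g v")
        case True
        then have "fib p - {y, v, v'} = {}" using fv by auto
        then show ?thesis by (metis card.empty zero_neq_one)
      next
        case False
        then have "fib p - {y, v, v'} = fib p" using yv v' by (auto simp: fib_def)
        then show ?thesis using fib1 p by simp
      qed
    qed (use aN fa yv v v' ne DR in \<open>auto simp: card_insert_if\<close>)
    then show False using yv by simp
  qed
qed

lemma card_nb_D: "y \<in> U \<Longrightarrow> a \<in> A y \<Longrightarrow> card (nb a \<inter> D) \<le> card P2"
proof (rule card_inj_on_le[of g])
  assume "y \<in> U" "a \<in> A y"
  then show "inj_on g (nb a \<inter> D)" "g ` (nb a \<inter> D) \<subseteq> P2"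
    using A_D[of y a] by (auto simp: inj_on_def)
qed simp

lemma nb_R_A: "y \<in> U \<Longrightarrow> a \<in> A y \<Longrightarrow> nb a \<inter> R = insert y (nb a \<inter> D)"
proof -
  assume y: "y \<in> U" "a \<in> A y"
  have "y \<in> nb a" "y \<in> R" using y nb_commute[of a y] by (auto simp: A_def U_def)
  then show ?thesis using A_U[of y _ a] y DR by (auto simp: U_def)
qed

text \<open>The constant 2 counts \<open>x\<close> and \<open>y\<close>, the latter being the only
  uncovered neighbour of \<open>a\<close>.\<close>

lemma deg_A:
  assumes y: "y \<in> U" "a \<in> A y"
  shows "card (nb a) = 2 + card (nb a \<inter> D) + dN a" "card (nb a) \<le> 2 + card P2 + dN a"
proof -
  have "a \<in> N" using y by (simp add: A_def)
  moreover have "dR a = Suc (card (nb a \<inter> D))"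
    unfolding dR_def nb_R_A[OF y] using y by (simp add: U_def)
  ultimately show "card (nb a) = 2 + card (nb a \<inter> D) + dN a" using degN by simp
  then show "card (nb a) \<le> 2 + card P2 + dN a" using card_nb_D[OF y] by simp
qed

lemma N_split: "N = C \<union> P2 \<union> P3"
proof -
  have "card (fib p) = 2 \<or> 3 \<le> card (fib p)" if "p \<in> N" "fib p \<noteq> {}" for p
  proof -
    have "0 < card (fib p)" using that(2) by (simp add: card_gt_0_iff)
    then show ?thesis using fib1[OF that(1)] by linarith
  qed
  then have "N \<subseteq> C \<union> P2 \<union> P3" unfolding C_def P2_def P3_def by blast
  moreover have "C \<union> P2 \<union> P3 \<subseteq> N" unfolding C_def P2_def P3_def by blast
  ultimately show ?thesis by (rule subset_antisym)
qed

lemma card_N: "card N = card C + card P2 + card P3"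
proof -
  have "C \<inter> P2 = {}" "(C \<union> P2) \<inter> P3 = {}" by (auto simp: C_def P2_def P3_def)
  then have "card (C \<union> P2 \<union> P3) = card C + card P2 + card P3"
    using card_Un_disjoint[of "C \<union> P2" P3] card_Un_disjoint[of C P2] by simp
  then show ?thesis using arg_cong[OF N_split, of card] by simp
qed

lemma card_D: "card D = (\<Sum>p\<in>P2 \<union> P3. card (fib p))"
proof -
  have "D = (\<Union>p\<in>P2 \<union> P3. fib p)"
  proof -
    have "g v \<in> P2 \<union> P3" if "v \<in> D" for v
    proof -
      have "g v \<in> C \<union> P2 \<union> P3" using gN[OF that] unfolding N_split[symmetric] .
      moreover have "g v \<notin> C" using that by (auto simp: C_def fib_def)
      ultimately show ?thesis by blast
    qed
    then show ?thesis by (auto simp: fib_def)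
  qed
  then have "card D = card (\<Union>p\<in>P2 \<union> P3. fib p)" by simp
  also have "\<dots> = (\<Sum>p\<in>P2 \<union> P3. card (fib p))"
    by (rule card_UN_disjoint) (auto simp: fib_def)
  finally show ?thesis .
qed

lemma card_D_ge: "2 * card P2 + 3 * card P3 \<le> card D"
proof -
  have "(\<Sum>p\<in>P2 \<union> P3. card (fib p)) = (\<Sum>p\<in>P2. card (fib p)) + (\<Sum>p\<in>P3. card (fib p))"
    by (rule sum.union_disjoint) (auto simp: P2_def P3_def)
  moreover have "(\<Sum>p\<in>P2. card (fib p)) = 2 * card P2" by (simp add: P2_def)
  moreover have "3 * card P3 \<le> (\<Sum>p\<in>P3. card (fib p))"
    using sum_bounded_below[of P3 3 "\<lambda>p. card (fib p)"] by (simp add: P3_def)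
  ultimately show ?thesis using card_D by simp
qed

lemma card_R_split: "card R = card D + card U"
  using DR card_mono[OF finR DR] by (simp add: U_def card_Diff_subset)

lemma card_UN_A: "Y \<subseteq> U \<Longrightarrow> 2 * card Y \<le> card (\<Union>y\<in>Y. A y)"
proof -
  assume Y: "Y \<subseteq> U"
  then have "finite Y" by (rule finite_subset) simp
  then have "card (\<Union>y\<in>Y. A y) = (\<Sum>y\<in>Y. card (A y))"
    using Y A_disjoint by (intro card_UN_disjoint) auto
  moreover have "2 \<le> card (A y)" if "y \<in> Y" for y
    using dN2[of y] that Y by (auto simp: U_def A_def dN_def)
  then have "card Y * 2 \<le> (\<Sum>y\<in>Y. card (A y))" using sum_bounded_below[of Y 2 "\<lambda>y. card (A y)"] by simp
  ultimately show ?thesis by simp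
qed

lemma card_C_ge: "2 * card U \<le> card C"
proof -
  have "2 * card U \<le> card (\<Union>y\<in>U. A y)" by (rule card_UN_A) simp
  also have "\<dots> \<le> card C" using A_C by (intro card_mono) auto
  finally show ?thesis .
qed

lemma nonadj_A:
  assumes "y \<in> U" "a \<in> A y" "y' \<in> U" "a' \<in> A y'" "a \<noteq> a'" "a' \<notin> nb a"
  shows "card N + card D + card U \<le> 5 + 2 * card P2 + dN a + dN a'"
proof -
  have "card N + card R \<le> card (nb a) + card (nb a') + 1"
    by (rule ore_NR) (use assms in \<open>auto simp: A_def\<close>)
  then show ?thesis using deg_A(2)[OF assms(1,2)] deg_A(2)[OF assms(3,4)] card_R_split by simp
qed

section \<open>Hanging the uncovered vertices\<close>

lemma hit_base: "hit (insert x (N \<union> D)) (\<lambda>v. if v \<in> D then g v else x) x"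
proof -
  let ?f = "\<lambda>v. if v \<in> D then g v else x" and ?S = "insert x (N \<union> D)"
  have ND: "v \<notin> D" if "v \<in> N" for v using that DR N_D[of v] by auto
  have xD: "x \<notin> D" using DR sep by blast
  have gx: "g v \<noteq> x" if "v \<in> D" for v using gN[OF that] N_D by blast
  have kx: "kids ?S ?f x x = N" using ND xD gx by (auto simp: kids_def dest: N_D)
  have kN: "kids ?S ?f x p = fib p" if "p \<in> N" for p
    using N_D[OF that] ND xD by (auto simp: kids_def fib_def)
  have kD: "kids ?S ?f x v = {}" if "v \<in> D" for v
  proof -
    have "v \<noteq> x" "v \<notin> N" using that xD ND by auto
    then show ?thesis using gN by (auto simp: kids_def)
  qed
  have "\<exists>h::'a \<Rightarrow> nat. \<forall>v\<in>?S - {x}. h (?f v) < h v"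
    by (rule exI[of _ "\<lambda>v. if v = x then 0 else if v \<in> N then 1 else 2"])
      (use ND gN in \<open>auto dest: N_D\<close>)
  moreover have "?S \<subseteq> pverts G" using V_eq DR by auto
  moreover have "?f v \<in> ?S \<and> v \<in> nb (?f v)" if "v \<in> ?S - {x}" for v
    using that gN gnb by auto
  moreover have "card (kids ?S ?f x u) \<noteq> 1" if "u \<in> ?S - {x}" for u
    using that kN[of u] kD[of u] fib1[of u] by auto
  ultimately show ?thesis using kx N4 unfolding hit_def by auto
qed

text \<open>
  A vertex \<open>y\<close> of \<open>Y\<close> is hung below \<open>\<alpha> y\<close> together with a child \<open>c\<close> of \<open>x\<close> adjacent to \<open>\<alpha> y\<close>. Processing
  the \<open>y\<close> in increasing order of \<open>dN (\<alpha> y)\<close>, the forbidden choices of \<open>c\<close> are those already moved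
  and the child of \<open>x\<close> above \<open>\<alpha> y\<close>, and Hall's condition leaves a free one.
\<close>

lemma hit_greedy:
  assumes sel: "\<And>y. y \<in> U \<Longrightarrow> \<alpha> y \<in> A y" and room: "card U + 3 \<le> card N"
    and Y: "Y \<subseteq> U" "\<And>j. card {y \<in> Y. dN (\<alpha> y) \<le> j} \<le> j"
  shows "\<exists>f. hit (insert x (N \<union> D) \<union> Y) f x \<and> (\<forall>v\<in>D. f v = g v) \<and> (\<forall>y\<in>Y. f y = \<alpha> y) \<and>
    (\<forall>c\<in>N. f c = x \<or> f c \<in> \<alpha> ` Y) \<and> card {c \<in> N. f c \<noteq> x} = card Y"
  using Y
proof (induction "card Y" arbitrary: Y)
  case 0
  then have "Y = {}" using finite_subset[of Y U] by auto
  moreover have "{c \<in> N. c \<in> D \<and> g c \<noteq> x} = {}" using DR N_D by auto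
  moreover have "c \<notin> D" if "c \<in> N" for c using that DR N_D[of c] by auto
  ultimately show ?case using hit_base
    by (intro exI[of _ "\<lambda>v. if v \<in> D then g v else x"]) auto
next
  case (Suc k)
  have finY: "finite Y" using Suc.prems(1) by (rule finite_subset) simp
  \<comment> \<open>For the largest value of \<open>dN (\<alpha> y)\<close>, Hall's condition counts
    all of \<open>Y\<close>, so the last vertex to be attached has at least \<open>card Y\<close>
    candidates.\<close>
  let ?H = "(\<lambda>y. dN (\<alpha> y)) ` Y"
  have "Y \<noteq> {}" using Suc.hyps(2) by auto
  then have "Max ?H \<in> ?H" using finY by (intro Max_in) auto
  then obtain y where y: "y \<in> Y" and ymax: "dN (\<alpha> y) = Max ?H" by auto
  have le: "dN (\<alpha> w) \<le> dN (\<alpha> y)" if "w \<in> Y" for w using ymax that finY by simp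
  have "{w \<in> Y. dN (\<alpha> w) \<le> dN (\<alpha> y)} = Y" using le by auto
  then have dNa: "Suc k \<le> dN (\<alpha> y)" using Suc.prems(2)[of "dN (\<alpha> y)"] Suc.hyps(2) by simp
  define Y' where "Y' = Y - {y}"
  have cY': "k = card Y'" using Suc.hyps(2) y finY by (simp add: Y'_def)
  have Y'U: "Y' \<subseteq> U" using Suc.prems(1) by (auto simp: Y'_def)
  have "card {w \<in> Y'. dN (\<alpha> w) \<le> j} \<le> j" for j
  proof -
    have "card {w \<in> Y'. dN (\<alpha> w) \<le> j} \<le> card {w \<in> Y. dN (\<alpha> w) \<le> j}"
      by (rule card_mono) (use finY in \<open>auto simp: Y'_def\<close>)
    then show ?thesis using Suc.prems(2)[of j] by linarith
  qed
  then obtain f where hit0: "hit (insert x (N \<union> D) \<union> Y') f x" and fD: "\<forall>v\<in>D. f v = g v"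
    and fY: "\<forall>w\<in>Y'. f w = \<alpha> w" and fN: "\<forall>c\<in>N. f c = x \<or> f c \<in> \<alpha> ` Y'"
    and cM: "card {c \<in> N. f c \<noteq> x} = card Y'"
    using Suc.hyps(1)[OF cY' Y'U] by blast
  define S where "S = insert x (N \<union> D) \<union> Y'"
  have hit: "hit S f x" using hit0 by (simp add: S_def)
  define M where "M = {c \<in> N. f c \<noteq> x}"
  define a where "a = \<alpha> y"
  have yU: "y \<in> U" using y Suc.prems(1) by blast
  have aA: "a \<in> A y" using sel[OF yU] by (simp add: a_def)
  have a: "a \<in> N" "a \<in> nb y" "y \<in> nb a" using aA nb_commute[of y a] by (auto simp: A_def)
  have aC: "a \<in> C" using A_C[OF yU aA] .
  have a_new: "a \<notin> \<alpha> ` Y'"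
  proof
    assume "a \<in> \<alpha> ` Y'"
    then obtain w where w: "w \<in> Y'" "a = \<alpha> w" by blast
    then have "a \<in> A w" "w \<in> U" "w \<noteq> y" using sel Y'U by (auto simp: Y'_def)
    then show False using A_disjoint[of w y] yU aA by blast
  qed
  have xaw: "x \<noteq> \<alpha> w" "\<alpha> w \<in> N" if "w \<in> Y'" for w
    using that sel[of w] Y'U N_D[of "\<alpha> w"] by (auto simp: A_def)
  have in_N: "v \<in> N" if "v \<in> S - {x}" "f v = x" for v
  proof -
    have "f v \<noteq> x" if "v \<in> D" using fD gN[OF that] N_D[of "g v"] that by auto
    moreover have "f v \<noteq> x" if "v \<in> Y'" using fY xaw[OF that] that by auto
    ultimately show ?thesis using that by (auto simp: S_def)
  qed
  have kx: "kids S f x x = N - M"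
    using in_N by (auto simp: kids_def M_def S_def dest: N_D)
  have ka: "kids S f x a = {}"
  proof -
    have "f v \<noteq> a" if v: "v \<in> S - {x}" for v
    proof -
      consider "v \<in> N" | "v \<in> D" | "v \<in> Y'" using v by (auto simp: S_def)
      then show ?thesis
      proof cases
        case 1
        then show ?thesis using fN a_new N_D[OF a(1)] by auto
      next
        case 2
        then show ?thesis using fD aC by (auto simp: C_def fib_def)
      next
        case 3
        then show ?thesis using fY a_new by auto
      qed
    qed
    then show ?thesis by (auto simp: kids_def)
  qed
  have MN: "M \<subseteq> N" by (auto simp: M_def)
  have cM': "card M = k" using cM cY' by (simp add: M_def)
  have "card Y \<le> card U" using Suc.prems(1) by (intro card_mono) auto
  then have "4 \<le> card (N - M)"
    using room Suc.hyps(2) cM' MN by (simp add: card_Diff_subset finite_subset[OF MN])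
  then have k4: "4 \<le> card (kids S f x x)" by (simp add: kx)
  have yS: "y \<notin> S" using yU U_D[OF yU] R_D[of y] by (auto simp: Y'_def S_def)
  define Q where "Q = {c \<in> N - M. (a, c) \<in> (up S f x)\<^sup>*}"
  have Q1: "card Q \<le> 1"
  proof -
    have "c = c'" if "c \<in> Q" "c' \<in> Q" for c c'
      using that up_top_unique[of a c S f x c'] N_D[of c] N_D[of c'] by (auto simp: Q_def M_def)
    then show ?thesis by (metis One_nat_def card_le_Suc0_iff_eq finite_subset Q_def finN Diff_subset Collect_subset subset_trans mem_Collect_eq subsetI DiffD1)
  qed
  have finM: "finite M" "finite Q" using finite_subset[OF MN] by (auto simp: Q_def)
  \<comment> \<open>Apparently \<open>k + 1\<close> choices are forbidden, the \<open>k\<close>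
    moved vertices \<open>M\<close> and the top \<open>Q\<close>. But \<open>a\<close> is no
    candidate for itself: either \<open>a\<close> lies in \<open>M\<close> and drops out there, or
    \<open>a\<close> is still a child of \<open>x\<close> and is itself the only element of
    \<open>Q\<close>.\<close>
  have "card ((M \<union> Q) - {a}) \<le> k"
  proof (cases "a \<in> M")
    case True
    have "card ((M \<union> Q) - {a}) \<le> card ((M - {a}) \<union> Q)" using finM by (intro card_mono) auto
    also have "\<dots> \<le> card (M - {a}) + card Q" by (rule card_Un_le)
    also have "\<dots> \<le> k"
      using True finM Q1 cM' card_gt_0_iff[of M] by auto
    finally show ?thesis .
  next
    case False
    have aQ: "a \<in> Q" using False a by (auto simp: Q_def)
    then have "Q = {a}" using Q1 finM by (metis card_le_Suc0_iff_eq One_nat_def empty_iff insertI1 singleton_iff subsetI subset_antisym)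
    then have "(M \<union> Q) - {a} = M" using False by auto
    then show ?thesis using cM' by simp
  qed
  then obtain c where c: "c \<in> nb a \<inter> N" "c \<notin> (M \<union> Q) - {a}"
    using ex_not_in_of_card_less[of "(M \<union> Q) - {a}" "nb a \<inter> N"] dNa finM
    unfolding dN_def a_def by fastforce
  have cMQ: "c \<notin> M" "c \<notin> Q" "c \<noteq> a" using c by auto
  then have ck: "c \<in> kids S f x x" "c \<in> nb a" "(a, c) \<notin> (up S f x)\<^sup>*"
    using c kx by (auto simp: Q_def)
  let ?f = "f(c := a, y := a)"
  have "hit (insert y S) ?f x"
    by (rule hit_rehang[OF hit k4 _ _ ka yS a(3) ck]) (use a N_D[OF a(1)] in \<open>auto simp: S_def\<close>)
  moreover have "insert y S = insert x (N \<union> D) \<union> Y" using y by (auto simp: Y'_def S_def)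
  moreover have cN: "c \<in> N" "c \<notin> D" "c \<notin> U" using c N_D[of c] DR by (auto simp: U_def)
  moreover have yN: "y \<notin> N" "y \<notin> D" using yS by (auto simp: S_def)
  moreover have "\<forall>v\<in>D. ?f v = g v" using fD cN yN by auto
  moreover have "\<forall>w\<in>Y. ?f w = \<alpha> w" using fY cN Suc.prems(1) by (auto simp: Y'_def a_def)
  moreover have "\<forall>d\<in>N. ?f d = x \<or> ?f d \<in> \<alpha> ` Y" using fN y by (auto simp: Y'_def a_def)
  moreover have "card {d \<in> N. ?f d \<noteq> x} = card Y"
  proof -
    have "{d \<in> N. ?f d \<noteq> x} = insert c M" using cN yN a N_D[OF a(1)] by (auto simp: M_def)
    then show ?thesis using cM' cMQ finM Suc.hyps(2) by simp
  qed
  ultimately show ?case by (intro exI[of _ ?f]) simp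
qed

lemma HIST_of_selection:
  assumes sel: "\<And>y. y \<in> U \<Longrightarrow> \<alpha> y \<in> A y" and room: "card U + 3 \<le> card N"
    and hall: "\<And>j. card {y \<in> U. dN (\<alpha> y) \<le> j} \<le> j"
  shows "\<exists>T. HIST T G"
proof -
  obtain f where "hit (insert x (N \<union> D) \<union> U) f x"
    using hit_greedy[OF sel room, of U] hall by auto
  moreover have "insert x (N \<union> D) \<union> U = pverts G" using V_eq DR by (auto simp: U_def)
  ultimately show ?thesis using HIST_of_hit by metis
qed

text \<open>
  The vertices adjacent to the members of a violating set would have small degree, hence form a
  clique by the degree sum condition, and this clique is too large.
\<close>

lemma hall_level:
  assumes sel: "\<And>y a. y \<in> U \<Longrightarrow> a \<in> A y \<Longrightarrow> dN a \<le> dN (\<alpha> y)"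
    and small: "2 * j + 5 + 2 * card P2 < card N + card D + card U"
  shows "card {y \<in> U. dN (\<alpha> y) \<le> j} \<le> j"
proof (rule ccontr)
  define Y where "Y = {y \<in> U. dN (\<alpha> y) \<le> j}"
  assume "\<not> ?thesis"
  then have j: "j < card Y" by (simp add: Y_def)
  define B where "B = (\<Union>y\<in>Y. A y)"
  have YU: "Y \<subseteq> U" by (auto simp: Y_def)
  have B2: "2 * card Y \<le> card B" unfolding B_def by (rule card_UN_A[OF YU])
  have low: "dN a \<le> j" if "a \<in> B" for a
    using that sel by (fastforce simp: B_def Y_def)
  have finB: "finite B" unfolding B_def using finite_subset[OF YU] by auto
  obtain a where a: "a \<in> B" using B2 j ex_member[of B] by auto
  have "a' \<in> nb a \<inter> N" if a': "a' \<in> B - {a}" for a'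
  proof -
    have "a' \<in> nb a"
    proof (rule ccontr)
      assume n: "a' \<notin> nb a"
      obtain y y' where "y \<in> U" "a \<in> A y" "y' \<in> U" "a' \<in> A y'"
        using a a' YU by (auto simp: B_def)
      then have "card N + card D + card U \<le> 5 + 2 * card P2 + dN a + dN a'"
        using nonadj_A[of y a y' a'] n a' by blast
      then show False using low[OF a] low[of a'] a' small by simp
    qed
    then show ?thesis using a' by (auto simp: B_def A_def)
  qed
  \<comment> \<open>\<open>B\<close> is a clique with at least 2(j+1) vertices, which contradicts
    \<open>dN a \<le> j\<close>.\<close>
  then have "card (B - {a}) \<le> dN a" unfolding dN_def by (intro card_mono) auto
  then have "card B - 1 \<le> j" using low[OF a] a finB by simp
  then show False using B2 j by linarith
qed

text \<open>Taking \<open>\<alpha> y\<close> with the largest \<open>dN\<close> turns a bound on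
  \<open>dN (\<alpha> y)\<close> into a bound for all of \<open>A y\<close>, as
  \<open>hall_level\<close> needs.\<close>

lemma ex_selection: "\<exists>\<alpha>. \<forall>y\<in>U. \<alpha> y \<in> A y \<and> (\<forall>a\<in>A y. dN a \<le> dN (\<alpha> y))"
proof -
  have "\<exists>a\<in>A y. \<forall>a'\<in>A y. dN a' \<le> dN a" if "y \<in> U" for y
  proof -
    have "0 < card (A y)" using dN2[of y] that by (simp add: U_def A_def dN_def)
    then have "Max (dN ` A y) \<in> dN ` A y" by (intro Max_in) (auto simp: card_gt_0_iff)
    then obtain a where "a \<in> A y" "dN a = Max (dN ` A y)" by auto
    then show ?thesis by (intro bexI[of _ a]) auto
  qed
  then show ?thesis by metis
qed

text \<open>\<open>C\<close> contains two vertices for each uncovered one, so failure leaves only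
  \<open>card N = 4\<close>, \<open>card U = 2\<close> and empty \<open>D\<close>, a graph with 7
  vertices.\<close>

lemma room: "card U + 3 \<le> card N"
proof (rule ccontr)
  assume "\<not> ?thesis"
  then have "card N < card U + 3" by simp
  moreover have "2 * card U + card P2 + card P3 \<le> card N" using card_C_ge card_N by simp
  ultimately have "card U = 2" "card P2 = 0" "card P3 = 0" "card N = 4" using N4 by linarith+
  moreover from this have "D = {}" using card_D by simp
  ultimately show False using big card_R_split by simp
qed

text \<open>The exceptional parameters force \<open>n = 10\<close>.\<close>

lemma HIST_or_tight:
  "(\<exists>T. HIST T G) \<or> (card N + card D + card U = 9 \<and> card P3 = 0 \<and> card U + card P2 = 3 \<and> 0 < card U \<and>
     (\<forall>y\<in>U. \<forall>a\<in>A y. dN a < card U))"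
proof -
  obtain \<alpha> where sel: "\<And>y. y \<in> U \<Longrightarrow> \<alpha> y \<in> A y"
    and selmax: "\<And>y a. y \<in> U \<Longrightarrow> a \<in> A y \<Longrightarrow> dN a \<le> dN (\<alpha> y)"
    using ex_selection by blast
  let ?h = "\<lambda>j. card {y \<in> U. dN (\<alpha> y) \<le> j}"
  have hU: "?h j \<le> card U" for j by (rule card_mono) auto
  show ?thesis
  proof (cases "\<forall>j. ?h j \<le> j")
    case True
    then show ?thesis using HIST_of_selection[OF sel room] by blast
  next
    case False
    then obtain j where j: "j < ?h j" by (auto simp: not_le)
    then have ju: "j < card U" using hU[of j] by linarith
    have le: "card N + card D + card U \<le> 2 * j + 5 + 2 * card P2"
      using hall_level[of \<alpha> j, OF selmax] j by (meson not_le)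
    have nums: "2 * card U + card P2 + card P3 \<le> card N" "2 * card P2 + 3 * card P3 \<le> card D"
      "9 \<le> card N + card D + card U"
      using card_C_ge card_N card_D_ge big card_R_split by linarith+
    \<comment> \<open>With \<open>j \<le> card U - 1\<close>, the bound \<open>le\<close> against
      the first two parts of \<open>nums\<close> gives
      \<open>card U + card P2 + 4 * card P3 \<le> 3\<close>, and against the third
      \<open>3 \<le> card U + card P2\<close>. So all these estimates are equalities.\<close>
    have tight: "card N + card D + card U = 9" "card P3 = 0" "card U + card P2 = 3" "Suc j = card U"
      using le nums ju by linarith+
    have "{y \<in> U. dN (\<alpha> y) \<le> j} = U"
      using hU[of j] j tight by (intro card_seteq) auto
    then have "dN (\<alpha> y) \<le> j" if "y \<in> U" for y using that by blast
    then have "dN a < card U" if "y \<in> U" "a \<in> A y" for y a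
      using selmax[OF that] tight(4) that(1) by fastforce
    then show ?thesis using tight ju by auto
  qed
qed

section \<open>The three exceptional parameter sets\<close>

lemma D_fibres: "P3 = {} \<Longrightarrow> v \<in> D \<Longrightarrow> \<exists>p\<in>P2. v \<in> fib p"
proof -
  assume *: "P3 = {}" "v \<in> D"
  then have "g v \<in> C \<union> P2" using gN[OF *(2)] N_split by simp
  moreover have "v \<in> fib (g v)" using * by (simp add: fib_def)
  ultimately show ?thesis by (auto simp: C_def)
qed

lemma fib_D: "v \<in> fib p \<Longrightarrow> v \<in> R \<and> v \<in> nb p \<and> v \<notin> N \<and> v \<noteq> x \<and> v \<in> D"
  using DR gnb[of v] R_D[of v] by (auto simp: fib_def)

lemma A_eq_C:
  assumes "card C = 2 * card U"
  shows "(\<Union>y\<in>U. A y) = C"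
  using card_UN_A[of U] assms A_C by (intro card_seteq) auto

lemma U_facts: "y \<in> U \<Longrightarrow> y \<in> R \<and> y \<notin> N \<and> y \<noteq> x \<and> y \<notin> D \<and> 2 \<le> card (A y)"
  using R_D[of y] dN2[of y] by (auto simp: U_def A_def dN_def)

text \<open>The two vertices of \<open>C\<close> are nonadjacent, and their degree sum forces
  \<open>a\<close> to see exactly two vertices of \<open>D\<close>; \<open>y\<close> sees at least
  two. If they share one, it takes \<open>y\<close> and \<open>a\<close> below its own parent.
  Otherwise they split \<open>D\<close> evenly: \<open>a\<close> takes \<open>y\<close> and its own
  two, \<open>y\<close> takes the other two, and \<open>p1\<close>, \<open>p2\<close> become
  leaves.\<close>

lemma HIST_tight_1:
  assumes u: "card U = 1" and N: "card N = 4" and D: "card D = 4" and P: "card P2 = 2" "P3 = {}"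
    and dead: "\<And>y a. y \<in> U \<Longrightarrow> a \<in> A y \<Longrightarrow> dN a = 0"
  shows "\<exists>T. HIST T G"
proof -
  obtain y where U: "U = {y}" using u by (meson card_1_singletonE)
  then have yU: "y \<in> U" by simp
  note yf = U_facts[OF yU]
  have cC: "card C = 2" using card_N N P by simp
  have AC: "A y = C" using A_eq_C U cC by simp
  obtain a a' where C: "C = {a, a'}" "a \<noteq> a'" using cC by (meson card_2_iff)
  have aA: "a \<in> A y" "a' \<in> A y" using AC C by auto
  have a: "a \<in> N" "y \<in> nb a" using aA nb_commute[of a y] by (auto simp: A_def)
  have a'n: "a' \<notin> nb a" using dead[OF yU aA(1)] dN_pos[of a' a] aA by (auto simp: A_def)
  have "card N + card R \<le> card (nb a) + card (nb a') + 1"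
    by (rule ore_NR) (use aA C a'n in \<open>auto simp: A_def\<close>)
  then have cD: "card (nb a \<inter> D) = 2"
    using deg_A[OF yU aA(1)] deg_A[OF yU aA(2)] dead[OF yU aA(1)] dead[OF yU aA(2)]
      card_nb_D[OF yU aA(1)] card_R_split N D u P by simp
  have RS: "R \<subseteq> insert y D" using U by (auto simp: U_def)
  have "dN y = 2" using AC cC by (simp add: A_def dN_def)
  then have "2 \<le> dR y" using deg_R_ge[of y] yf card_R_split D u by simp
  moreover have "nb y \<inter> R \<subseteq> nb y \<inter> D" using RS nb_irrefl[of y] by auto
  then have "dR y \<le> card (nb y \<inter> D)" by (rule dR_mono) simp
  ultimately have yD: "2 \<le> card (nb y \<inter> D)" by simp
  obtain p1 p2 where P2: "P2 = {p1, p2}" "p1 \<noteq> p2" using P(1) by (meson card_2_iff)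
  have p: "p1 \<in> N" "p2 \<in> N" "card (fib p1) = 2" "card (fib p2) = 2" "a \<noteq> p1" "a \<noteq> p2"
  proof -
    have "p1 \<in> P2" "p2 \<in> P2" "a \<in> C" using P2 C by auto
    then show "p1 \<in> N" "p2 \<in> N" "card (fib p1) = 2" "card (fib p2) = 2" "a \<noteq> p1" "a \<noteq> p2"
      by (auto simp: P2_def C_def)
  qed
  have Df: "D \<subseteq> fib p1 \<union> fib p2" using D_fibres[OF P(2)] P2 by auto
  have disj: "fib p1 \<inter> fib p2 = {}" using P2(2) by (auto simp: fib_def)
  show ?thesis
  proof (cases "\<exists>v\<in>D. v \<in> nb y \<and> v \<in> nb a")
    case True
    then obtain v where v: "v \<in> D" "v \<in> nb y" "v \<in> nb a" by blast
    have "y \<notin> fib p1" "y \<notin> fib p2" using yf by (auto simp: fib_def)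
    moreover have "x \<notin> fib p1" "x \<notin> fib p2" using fib_D[of x] by auto
    moreover have "v \<in> fib p1 \<union> fib p2" using Df v by blast
    ultimately show ?thesis
      by (intro HIST_by_expansions[of "{a}" "[(p1, fib p1), (p2, fib p2), (v, {y, a})]"])
        (use N a N_D[OF a(1)] p disj yf RS Df fib_D nb_commute[of v y] nb_commute[of v a] v
          in \<open>auto simp: card_insert_if\<close>)
  next
    case False
    have cDa: "card (D - nb a) = 2" using cD D card_Diff_subset_Int[of D "nb a"] by (simp add: Int_commute)
    have "nb y \<inter> D \<subseteq> D - nb a" using False by auto
    then have "D - nb a \<subseteq> nb y \<inter> D" using yD cDa card_seteq[of "D - nb a" "nb y \<inter> D"] by simp
    moreover have "card (insert y (nb a \<inter> D)) \<noteq> 1" using cD yf by (simp add: card_insert_if)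
    moreover have "D \<inter> N = {}" "x \<notin> D" using DR sep by blast+
    ultimately show ?thesis
      by (intro HIST_by_expansions[of "{}" "[(a, insert y (nb a \<inter> D)), (y, D - nb a)]"])
        (use N a N_D[OF a(1)] yf RS cDa in auto)
  qed
qed

text \<open>Each vertex of \<open>C\<close> has exactly one neighbour in \<open>N\<close>, its only
  possible companion. It suffices to choose \<open>a1\<close>, \<open>a2\<close> for the two
  uncovered vertices with different companions that are not each other's. An edge inside
  \<open>C\<close> makes such a choice possible; without one, all four vertices of \<open>C\<close>
  see \<open>p\<close>, which together with its two children exceeds the maximum degree.\<close>

lemma HIST_tight_2:
  assumes u: "card U = 2" and N: "card N = 5" and D: "card D = 2" and P: "card P2 = 1" "P3 = {}"
    and low: "\<And>y a. y \<in> U \<Longrightarrow> a \<in> A y \<Longrightarrow> dN a \<le> 1"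
  shows "\<exists>T. HIST T G"
proof -
  obtain p where P2: "P2 = {p}" using P(1) by (meson card_1_singletonE)
  have "p \<in> P2" using P2 by simp
  then have p: "p \<in> N" "card (fib p) = 2" "p \<notin> C" by (auto simp: P2_def C_def)
  have Df: "D = fib p" using D_fibres[OF P(2)] P2 fib_D by auto
  have cC: "card C = 4" using card_N N P by simp
  have AC: "(\<Union>y\<in>U. A y) = C" using A_eq_C u cC by simp
  have CN: "C \<subseteq> N" by (auto simp: C_def)
  have one: "dN a = 1" if a: "a \<in> C" for a
  proof (rule ccontr)
    assume "dN a \<noteq> 1"
    obtain y where y: "y \<in> U" "a \<in> A y" using AC a by auto
    then have a0: "dN a = 0" using low \<open>dN a \<noteq> 1\<close> by fastforce
    obtain a' where a': "a' \<in> C" "a' \<noteq> a" using ex_member_ne[of C a] cC by auto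
    then obtain y' where y': "y' \<in> U" "a' \<in> A y'" using AC by auto
    have "a' \<notin> nb a" using a0 dN_pos[of a' a] a' CN by auto
    then show False
      using nonadj_A[OF y y'] low[OF y'] a0 a' N D u P by simp
  qed
  have partner: "\<exists>c\<in>N. nb a \<inter> N = {c} \<and> c \<noteq> a" if a: "a \<in> C" for a
  proof -
    obtain c where "nb a \<inter> N = {c}" using one[OF a] unfolding dN_def by (meson card_1_singletonE)
    then show ?thesis using nb_irrefl[of a] by blast
  qed
  have main: "\<exists>T. HIST T G"
    if U: "U = {y1, y2}" "y1 \<noteq> y2" and a1: "a1 \<in> A y1" "nb a1 \<inter> N = {c1}"
      and a2: "a2 \<in> A y2" "nb a2 \<inter> N = {c2}" and ne: "c1 \<noteq> c2" "\<not> (c1 = a2 \<and> c2 = a1)" for y1 y2 a1 a2 c1 c2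
  proof -
    have yU: "y1 \<in> U" "y2 \<in> U" using U by auto
    have RS: "R \<subseteq> {y1, y2} \<union> D" using U by (auto simp: U_def)
    have a: "a1 \<in> N" "a2 \<in> N" "y1 \<in> nb a1" "y2 \<in> nb a2"
      using a1 a2 nb_commute[of a1 y1] nb_commute[of a2 y2] by (auto simp: A_def)
    have c: "c1 \<in> N" "c2 \<in> N" "c1 \<in> nb a1" "c2 \<in> nb a2" using a1 a2 by auto
    have "a1 \<noteq> a2" using A_disjoint[OF yU U(2)] a1 a2 by auto
    moreover have "c1 \<noteq> a1" "c2 \<noteq> a2" using c by auto
    moreover have "y1 \<notin> fib p" "y2 \<notin> fib p" using U_facts[OF yU(1)] U_facts[OF yU(2)] Df by auto
    moreover have "fib p \<inter> N = {}" "x \<notin> fib p" "fib p \<subseteq> nb p" using fib_D by auto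
    moreover note facts = calculation
    show ?thesis
    proof (cases "a1 = c2")
      case True
      \<comment> \<open>Here \<open>a1\<close> is the companion that moves below \<open>a2\<close>,
        so \<open>a2\<close> has to be expanded before \<open>a1\<close>.\<close>
      then have "a2 \<noteq> c1" using ne by auto
      then show ?thesis
        by (intro HIST_by_expansions[of "{c1, c2}" "[(a2, {y2, c2}), (a1, {y1, c1}), (p, fib p)]"])
          (use N facts a c p ne U True N_D[OF a(1)] N_D[OF a(2)] N_D[OF c(1)] N_D[OF c(2)] RS Df
            U_facts[OF yU(1)] U_facts[OF yU(2)] in \<open>auto simp: card_insert_if\<close>)
    next
      case False
      then show ?thesis
        by (intro HIST_by_expansions[of "{c1, c2}" "[(a1, {y1, c1}), (a2, {y2, c2}), (p, fib p)]"])
          (use N facts a c p ne U N_D[OF a(1)] N_D[OF a(2)] N_D[OF c(1)] N_D[OF c(2)] RS Df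
            U_facts[OF yU(1)] U_facts[OF yU(2)] in \<open>auto simp: card_insert_if\<close>)
    qed
  qed
  show ?thesis
  proof (cases "\<exists>a1\<in>C. \<exists>c1\<in>C. c1 \<in> nb a1")
    case True
    then obtain a1 c1 where ac: "a1 \<in> C" "c1 \<in> C" "c1 \<in> nb a1" by blast
    have sole: "nb a \<inter> N = {c}" if "a \<in> C" "c \<in> nb a" "c \<in> N" for a c
      by (rule card_seteq[symmetric]) (use that one[OF that(1)] in \<open>auto simp: dN_def\<close>)
    have nba: "nb a1 \<inter> N = {c1}" "nb c1 \<inter> N = {a1}"
      using sole[of a1 c1] sole[of c1 a1] ac CN nb_commute[of a1 c1] by auto
    have sat: "c \<noteq> a1 \<and> c \<noteq> c1" if "b \<in> C" "nb b \<inter> N = {c}" "b \<noteq> a1" "b \<noteq> c1" for b c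
    proof -
      have "b \<in> nb c" "b \<in> N" using that(1,2) CN nb_commute[of b c] by auto
      then show ?thesis using nba that(3,4) by auto
    qed
    obtain y1 where y1: "y1 \<in> U" "a1 \<in> A y1" using AC ac by auto
    obtain y2 where U: "U = {y1, y2}" "y2 \<noteq> y1" using card_2_with[OF u y1(1)] by blast
    have y2: "y2 \<in> U" using U by simp
    have "c1 \<in> A y1 \<or> c1 \<in> A y2" using AC ac U by auto
    then show ?thesis
    proof
      assume c1: "c1 \<in> A y1"
      obtain a2 where a2: "a2 \<in> A y2" using U_facts[OF y2] ex_member[of "A y2"] by auto
      have "a2 \<in> C" using A_C[OF y2 a2] .
      moreover have "a2 \<noteq> a1" "a2 \<noteq> c1" using A_disjoint[OF y1(1) y2] U c1 y1 a2 by auto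
      moreover obtain c2 where "nb a2 \<inter> N = {c2}" using partner[OF \<open>a2 \<in> C\<close>] by blast
      ultimately show ?thesis using main[of y1 y2 a1 c1 a2 c2] sat[of a2 c2] U y1 nba a2 by auto
    next
      assume c1: "c1 \<in> A y2"
      obtain b where b: "b \<in> A y1" "b \<noteq> a1" using U_facts[OF y1(1)] ex_member_ne[of "A y1" a1] by auto
      have "b \<in> C" using A_C[OF y1(1) b(1)] .
      moreover have "b \<noteq> c1" using A_disjoint[OF y1(1) y2] U c1 b by auto
      moreover obtain c2 where "nb b \<inter> N = {c2}" using partner[OF \<open>b \<in> C\<close>] by blast
      ultimately show ?thesis using main[of y1 y2 b c2 c1 a1] sat[of b c2] U b nba c1 by auto
    qed
  next
    case False
    have pn: "p \<in> nb a" if "a \<in> C" for a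
    proof -
      obtain c where c: "c \<in> N" "nb a \<inter> N = {c}" using partner[OF \<open>a \<in> C\<close>] by blast
      then have "c \<in> nb a" by auto
      then have "c \<notin> C" using False that by blast
      then have "c = p" using c(1) N_split P2 P(2) by auto
      then show ?thesis using c by auto
    qed
    then have "C \<subseteq> nb p \<inter> N" using CN nb_commute[of p] by blast
    then have "card C \<le> dN p" unfolding dN_def by (intro card_mono) auto
    moreover have "card (nb p) \<le> card N" using deg_le p by blast
    ultimately have "dR p = 0" using degN[OF p(1)] cC N by simp
    moreover have "card (fib p) \<le> dR p" unfolding dR_def using fib_D by (intro card_mono) auto
    ultimately show ?thesis using p by simp
  qed
qed

text \<open>Nothing is covered, and the three disjoint neighbourhoods in \<open>N\<close> have
  exactly two vertices each. The degree sum of \<open>y\<close> with a neighbour \<open>a'\<close>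
  of another \<open>w\<close> makes \<open>y\<close> adjacent to the rest of \<open>R\<close>, so
  \<open>y\<close> can carry it once hung below some \<open>a\<close> with a companion.\<close>

lemma HIST_tight_3:
  assumes u: "card U = 3" and N: "card N = 6" and D: "card D = 0" and P: "card P2 = 0" "P3 = {}"
    and low: "\<And>y a. y \<in> U \<Longrightarrow> a \<in> A y \<Longrightarrow> dN a \<le> 2"
  shows "\<exists>T. HIST T G"
proof -
  have "card D = 0 \<longleftrightarrow> D = {}" by simp
  then have UR: "U = R" unfolding U_def using D by blast
  obtain y where y: "y \<in> U" using u ex_member[of U] by auto
  note yf = U_facts[OF y]
  have "card (U - {y}) = 2" using u y by simp
  have "2 * card (U - {y}) \<le> card (\<Union>w\<in>U - {y}. A w)" by (rule card_UN_A) auto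
  also have "\<dots> \<le> card (N - A y)"
    using A_disjoint[of y] y by (intro card_mono) (fastforce simp: A_def)+
  also have "\<dots> = card N - card (A y)" by (intro card_Diff_subset) (auto simp: A_def)
  finally have "dN y \<le> 2" using \<open>card (U - {y}) = 2\<close> N by (simp add: A_def dN_def)
  obtain w where w: "w \<in> U" "w \<noteq> y" using ex_member_ne[of U y] u by auto
  obtain a' where a': "a' \<in> A w" using U_facts[OF w(1)] ex_member[of "A w"] by auto
  have "card N + card R \<le> card (nb y) + card (nb a') + 1"
  proof (rule ore_NR)
    show "a' \<notin> nb y" using A_U[OF w(1) y _ a'] w nb_commute[of a' y] by auto
  qed (use a' yf in \<open>auto simp: A_def\<close>)
  then have "card (R - {y}) \<le> dR y"
    using deg_A(2)[OF w(1) a'] low[OF w(1) a'] degR[of y] yf \<open>dN y \<le> 2\<close> N P u UR by simp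
  then have Ry: "R - {y} \<subseteq> nb y" by (intro dR_full) auto
  obtain a where a: "a \<in> A y" using yf ex_member[of "A y"] by auto
  have aN: "a \<in> N" "y \<in> nb a" using a nb_commute[of a y] by (auto simp: A_def)
  have "0 < dN a"
  proof (rule ccontr)
    assume "\<not> 0 < dN a"
    then have "a' \<notin> nb a" using dN_pos[of a' a] a' by (auto simp: A_def)
    moreover have "a \<noteq> a'" using A_disjoint[OF y w(1)] w a a' by auto
    ultimately show False using nonadj_A[OF y a w(1) a'] low[OF w(1) a'] \<open>\<not> 0 < dN a\<close> N D u P by simp
  qed
  then obtain c where c: "c \<in> N" "c \<in> nb a" using ex_nb_N by blast
  have "c \<noteq> a" using c by auto
  moreover have "card (R - {y}) \<noteq> 1" using u UR yf by simp
  ultimately show ?thesis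
    by (intro HIST_by_expansions[of "{c}" "[(a, {y, c}), (y, R - {y})]"])
      (use N aN N_D[OF aN(1)] c N_D[OF c(1)] yf Ry in \<open>auto simp: card_insert_if dest: R_D\<close>)
qed

lemma HIST_max_pure: "\<exists>T. HIST T G"
proof (rule ccontr)
  assume no: "\<nexists>T. HIST T G"
  then have t: "card N + card D + card U = 9" "card P3 = 0" "card U + card P2 = 3" "0 < card U"
    and low: "\<And>y a. y \<in> U \<Longrightarrow> a \<in> A y \<Longrightarrow> dN a < card U"
    using HIST_or_tight by auto
  have P3: "P3 = {}" using t by simp
  have nums: "2 * card U + card P2 \<le> card N" "2 * card P2 \<le> card D"
    using card_C_ge card_N card_D_ge by linarith+
  consider "card U = 1" | "card U = 2" | "card U = 3" using t by linarith
  then show False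
  proof cases
    case 1
    then have "card N = 4" "card D = 4" "card P2 = 2" using t nums by linarith+
    moreover have "dN a = 0" if "y \<in> U" "a \<in> A y" for y a using low[OF that] 1 by simp
    ultimately show False using HIST_tight_1 1 P3 no by blast
  next
    case 2
    then have "card N = 5" "card D = 2" "card P2 = 1" using t nums by linarith+
    moreover have "dN a \<le> 1" if "y \<in> U" "a \<in> A y" for y a using low[OF that] 2 by simp
    ultimately show False using HIST_tight_2 2 P3 no by blast
  next
    case 3
    then have "card N = 6" "card D = 0" "card P2 = 0" using t nums by linarith+
    moreover have "dN a \<le> 2" if "y \<in> U" "a \<in> A y" for y a using low[OF that] 3 by simp
    ultimately show False using HIST_tight_3 3 P3 no by blast
  qed
qed

end

lemma (in ore_graph) HIST_or_R_singleton: "(\<exists>T. HIST T G) \<or> card R = 1"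
proof (cases "2 \<le> card R \<and> (\<forall>y\<in>R. 2 \<le> dN y)")
  case True
  obtain D g where "pure D g" "\<forall>D' g'. pure D' g' \<longrightarrow> card D' \<le> card D" using ex_max_pure by blast
  then interpret max_pure G x D g by unfold_locales (use True in auto)
  show ?thesis using HIST_max_pure by blast
next
  case False
  show ?thesis
  proof (cases "2 \<le> card R")
    case True
    then obtain y where "y \<in> R" "dN y \<le> 1" using False by (auto simp: not_le)
    then show ?thesis using HIST_few_common_nbs True by blast
  next
    case F: False
    then have "card R = 0 \<or> card R = 1" by linarith
    then show ?thesis using HIST_if_R_empty by auto
  qed
qed

section \<open>The exceptional graph\<close>

text \<open>An isomorphism consists of maps for vertices, arcs, heads and tails; when arcs are
  pairs, the vertex map induces the others.\<close>

lemma digraph_iso_with_projI: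
  assumes "pair_wf_digraph G" "pair_wf_digraph H" and bij: "bij_betw h (pverts G) (pverts H)"
    and arcs: "\<And>u v. u \<in> pverts G \<Longrightarrow> v \<in> pverts G \<Longrightarrow> (u, v) \<in> parcs G \<longleftrightarrow> (h u, h v) \<in> parcs H"
  shows "digraph_iso (with_proj G) (with_proj H)"
proof -
  interpret G: pair_wf_digraph G by fact
  interpret H: pair_wf_digraph H by fact
  let ?f = "\<lparr>iso_verts = h, iso_arcs = map_prod h h, iso_head = snd, iso_tail = fst\<rparr>"
  have inj: "inj_on h (pverts G)" and img: "h ` pverts G = pverts H"
    using bij by (auto simp: bij_betw_def)
  have "inj_on (map_prod h h) (pverts G \<times> pverts G)" by (rule map_prod_inj_on[OF inj inj])
  moreover have sub: "parcs G \<subseteq> pverts G \<times> pverts G" using G.wellformed' by auto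
  ultimately have "inj_on (map_prod h h) (parcs G)" by (rule inj_on_subset)
  then have "G.digraph_isomorphism ?f"
    using inj G.wf_digraph by (simp add: G.digraph_isomorphism_def)
  moreover have "map_prod h h ` parcs G = parcs H"
  proof
    show "map_prod h h ` parcs G \<subseteq> parcs H" using arcs sub by auto
    show "parcs H \<subseteq> map_prod h h ` parcs G"
    proof
      fix e assume e: "e \<in> parcs H"
      then have "fst e \<in> h ` pverts G" "snd e \<in> h ` pverts G"
        using H.arc_fst_in_verts H.arc_snd_in_verts img by auto
      then obtain u v where uv: "u \<in> pverts G" "v \<in> pverts G" "e = (h u, h v)"
        by (metis imageE prod.collapse)
      then have "(u, v) \<in> parcs G" using arcs e by auto
      then show "e \<in> map_prod h h ` parcs G" using uv by force
    qed
  qed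
  then have "with_proj H = app_iso ?f (with_proj G)"
    using img by (simp add: app_iso_def with_proj_def)
  ultimately show ?thesis unfolding digraph_iso_def by blast
qed

lemma digraph_iso_with_projD:
  assumes "digraph_iso (with_proj G) (with_proj H)" "pair_wf_digraph G"
  shows "\<exists>h. bij_betw h (pverts G) (pverts H) \<and>
    (\<forall>u\<in>pverts G. \<forall>v\<in>pverts G. (u, v) \<in> parcs G \<longleftrightarrow> (h u, h v) \<in> parcs H)"
proof -
  interpret G: pair_wf_digraph G by fact
  obtain f where f: "pre_digraph.digraph_isomorphism (with_proj G) f"
    and H: "with_proj H = app_iso f (with_proj G)"
    using assms(1) by (auto simp: digraph_iso_def)
  let ?h = "iso_verts f"
  have pv: "pverts H = ?h ` pverts G" and pa: "parcs H = iso_arcs f ` parcs G"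
    and t: "iso_tail f = fst" and hd: "iso_head f = snd"
    using H by (auto simp: app_iso_def with_proj_def)
  have inj: "inj_on ?h (pverts G)" and e: "\<And>e. e \<in> parcs G \<Longrightarrow> iso_arcs f e = (?h (fst e), ?h (snd e))"
    using f t hd by (auto simp: G.digraph_isomorphism_def prod_eq_iff)
  have "(u, v) \<in> parcs G \<longleftrightarrow> (?h u, ?h v) \<in> parcs H" if uv: "u \<in> pverts G" "v \<in> pverts G" for u v
  proof
    assume "(u, v) \<in> parcs G"
    then show "(?h u, ?h v) \<in> parcs H" using e[of "(u, v)"] pa by force
  next
    assume "(?h u, ?h v) \<in> parcs H"
    then obtain d where d: "d \<in> parcs G" "?h (fst d) = ?h u" "?h (snd d) = ?h v"
      using pa e by auto
    then have "fst d = u" "snd d = v"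
      using inj uv G.arc_fst_in_verts G.arc_snd_in_verts by (auto dest: inj_onD)
    then show "(u, v) \<in> parcs G" using d by (metis prod.collapse)
  qed
  moreover have "bij_betw ?h (pverts G) (pverts H)" using inj pv by (simp add: bij_betw_def)
  ultimately show ?thesis by blast
qed

text \<open>The middle vertex \<open>b\<close> of the attached path has degree 2 in \<open>G\<close>
  and both its edges are bridges, so every spanning tree keeps degree 2 there.\<close>

lemma no_HIST_if_iso_D_graph:
  assumes G: "pair_graph G" and n: "3 \<le> n" and iso: "digraph_iso (with_proj G) (with_proj (D_graph n))"
    and T: "HIST T G"
  shows False
proof -
  interpret G: pair_graph G by fact
  interpret T: pair_graph T using T by (simp add: HIST_def undirected_tree_def)
  obtain h where bij: "bij_betw h (pverts G) {0..<n}"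
    and arcs: "\<forall>u\<in>pverts G. \<forall>v\<in>pverts G. (u, v) \<in> parcs G \<longleftrightarrow> (h u, h v) \<in> parcs (D_graph n)"
    using digraph_iso_with_projD[OF iso G.pair_wf_digraph_axioms] by (auto simp: D_graph_def)
  have inj: "u = v" if "h u = h v" "u \<in> pverts G" "v \<in> pverts G" for u v
    using that bij by (auto simp: bij_betw_def dest: inj_onD)
  have surj: "\<exists>v\<in>pverts G. h v = i" if "i < n" for i
  proof -
    have "i \<in> h ` pverts G" using that bij by (simp add: bij_betw_def)
    then show ?thesis by blast
  qed
  obtain e b r where V: "e \<in> pverts G" "b \<in> pverts G" "r \<in> pverts G"
    and hv: "h e = n - 1" "h b = n - 2" "h r = 0"
    using surj[of "n - 1"] surj[of "n - 2"] surj[of 0] n by auto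
  have ne: "e \<noteq> b" "e \<noteq> r" "b \<noteq> r" using hv n by auto
  have nbe: "v = b" if "(e, v) \<in> parcs G" for v
    using that arcs V hv n G.in_arcsD2[OF that] inj[of v b] by (auto simp: D_graph_def)
  have nbb: "v = e \<or> v = r" if "(b, v) \<in> parcs G" for v
    using that arcs V hv n G.in_arcsD2[OF that] inj[of v e] inj[of v r] by (auto simp: D_graph_def)
  have TG: "pverts T = pverts G" "parcs T \<subseteq> parcs G"
    and conn: "Digraph_Component.connected (with_proj T)"
    using T by (auto simp: HIST_def undirected_tree_def spanning_def subgraph_def)
  have "\<exists>u\<in>{e}. \<exists>v\<in>pverts T - {e}. (u, v) \<in> parcs T"
    by (rule T.connected_arc_leaving[OF conn]) (use V ne TG in auto)
  then have eb: "(b, e) \<in> parcs T" using nbe TG T.parcs_sym by blast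
  have "\<exists>u\<in>{e, b}. \<exists>v\<in>pverts T - {e, b}. (u, v) \<in> parcs T"
    by (rule T.connected_arc_leaving[OF conn]) (use V ne TG in auto)
  then have "(b, r) \<in> parcs T" using nbe nbb TG by blast
  then have "{w. (b, w) \<in> parcs T} = {e, r}" using eb nbb TG by blast
  then have "degree T b = 2" using ne by (simp add: degree_conv_card)
  then show False using T V TG by (auto simp: HIST_def)
qed

context ore_graph
begin

text \<open>\<open>x\<close> is the vertex shared by the clique on \<open>insert x (N - {a})\<close>
  and the path from \<open>x\<close> over \<open>a\<close> to \<open>y\<close>; this fixes its label
  0 and the labels of \<open>a\<close> and \<open>y\<close>, while the rest of the clique is
  numbered arbitrarily.\<close>

lemma iso_D_graph:
  assumes R: "R = {y}" and a: "a \<in> N" "nb y = {a}" "nb a = {x, y}"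
    and clique: "\<And>c. c \<in> N - {a} \<Longrightarrow> nb c = insert x (N - {a, c})"
  shows "digraph_iso (with_proj G) (with_proj (D_graph (card (pverts G))))"
proof -
  let ?n = "card (pverts G)"
  have yR: "y \<in> R" using R by simp
  note ne = R_D[OF yR] N_D[OF a(1)]
  have cn: "card (N - {a}) = card {1..<?n - 2}" using a R cardV by simp
  then obtain \<beta> where \<beta>: "bij_betw \<beta> (N - {a}) {1..<?n - 2}"
    using finite_same_card_bij[of "N - {a}" "{1..<?n - 2}"] by auto
  define h where "h = (\<lambda>v. if v = x then 0 else if v = a then ?n - 2 else if v = y then ?n - 1 else \<beta> v)"
  have V: "pverts G = {x, a, y} \<union> (N - {a})" using V_eq R a by auto
  have n: "10 \<le> ?n" by (rule ten)
  have h: "h x = 0" "h a = ?n - 2" "h y = ?n - 1" using ne R by (auto simp: h_def)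
  have hc: "h c = \<beta> c" "h c \<in> {1..<?n - 2}" if "c \<in> N - {a}" for c
  proof -
    have "c \<noteq> x" "c \<noteq> y" "c \<noteq> a" using that N_D[of c] yR by auto
    then show "h c = \<beta> c" by (simp add: h_def)
    then show "h c \<in> {1..<?n - 2}" using \<beta> that by (auto simp: bij_betw_def)
  qed
  have inj\<beta>: "c = d" if "c \<in> N - {a}" "d \<in> N - {a}" "h c = h d" for c d
    using that \<beta> hc by (auto simp: bij_betw_def dest: inj_onD)
  have xya: "x \<notin> N - {a}" "y \<notin> N - {a}" "a \<notin> N - {a}" using ne by auto
  have split: "w = x \<or> w = a \<or> w = y \<or> w \<in> N - {a}" if "w \<in> pverts G" for w
    using that V by blast
  have small: "h c < ?n - 2" "0 < h c" if "c \<in> N - {a}" for c using hc(2)[OF that] by auto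
  have lt: "h w < ?n" if "w \<in> pverts G" for w
    using split[OF that] h n small[of w] by (elim disjE) simp_all
  have "{0..<?n} \<subseteq> h ` pverts G"
  proof
    fix i assume i: "i \<in> {0..<?n}"
    have xay: "x \<in> pverts G" "a \<in> pverts G" "y \<in> pverts G" "N - {a} \<subseteq> pverts G" using V by auto
    have "i = 0 \<or> i = ?n - 2 \<or> i = ?n - 1 \<or> i \<in> {1..<?n - 2}" using i by auto
    then show "i \<in> h ` pverts G"
    proof (elim disjE)
      assume "i \<in> {1..<?n - 2}"
      then have "i \<in> \<beta> ` (N - {a})" using \<beta> by (simp add: bij_betw_def)
      then obtain c where c: "c \<in> N - {a}" "i = \<beta> c" by blast
      then have "i = h c" using hc(1) by simp
      then show ?thesis using c(1) xay(4) by blast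
    qed (use h xay in \<open>metis imageI\<close>)+
  qed
  moreover have "h ` pverts G \<subseteq> {0..<?n}" using lt by auto
  ultimately have himg: "h ` pverts G = {0..<?n}" by (rule subset_antisym[rotated])
  then have "inj_on h (pverts G)"
    using pair_finite_verts by (intro eq_card_imp_inj_on) simp_all
  then have "bij_betw h (pverts G) {0..<?n}" using himg by (simp add: bij_betw_def)
  moreover have "(u, v) \<in> parcs G \<longleftrightarrow> (h u, h v) \<in> parcs (D_graph ?n)"
    if uv: "u \<in> pverts G" "v \<in> pverts G" for u v
  proof -
    define K where "K = insert x (N - {a})"
    have xay: "x \<in> pverts G" "a \<in> pverts G" "y \<in> pverts G" using V by auto
    have heq: "h w = h w' \<longleftrightarrow> w = w'" if "w \<in> pverts G" "w' \<in> pverts G" for w w'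
      using inj_on_eq_iff[OF \<open>inj_on h (pverts G)\<close> that] .
    have val: "h w = 0 \<longleftrightarrow> w = x" "h w = ?n - 2 \<longleftrightarrow> w = a" "h w = ?n - 1 \<longleftrightarrow> w = y"
      if "w \<in> pverts G" for w
      using heq[OF that xay(1)] heq[OF that xay(2)] heq[OF that xay(3)] unfolding h by blast+
    have K: "h w < ?n - 2 \<longleftrightarrow> w \<in> K" if w: "w \<in> pverts G" for w
    proof
      assume "h w < ?n - 2"
      then have "w \<noteq> a" "w \<noteq> y" using h by auto
      then show "w \<in> K" using split[OF w] by (auto simp: K_def)
    next
      assume "w \<in> K"
      then have "w = x \<or> w \<in> N - {a}" by (simp add: K_def)
      then show "h w < ?n - 2"
      proof
        assume "w = x"
        then show ?thesis using h(1) n by simp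
      qed (rule small)
    qed
    have D: "(i, j) \<in> parcs (D_graph ?n) \<longleftrightarrow> i < ?n - 2 \<and> j < ?n - 2 \<and> i \<noteq> j \<or> i = 0 \<and> j = ?n - 2 \<or>
       i = ?n - 2 \<and> j = 0 \<or> i = ?n - 2 \<and> j = ?n - 1 \<or> i = ?n - 1 \<and> j = ?n - 2" for i j
      by (auto simp: D_graph_def)
    have "(h u, h v) \<in> parcs (D_graph ?n) \<longleftrightarrow> u \<in> K \<and> v \<in> K \<and> u \<noteq> v \<or> u = x \<and> v = a \<or>
       u = a \<and> v = x \<or> u = a \<and> v = y \<or> u = y \<and> v = a"
      unfolding D val[OF uv(1)] val[OF uv(2)] K[OF uv(1)] K[OF uv(2)] heq[OF uv] by (rule refl)
    moreover have "v \<in> nb u \<longleftrightarrow> u \<in> K \<and> v \<in> K \<and> u \<noteq> v \<or> u = x \<and> v = a \<or>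
       u = a \<and> v = x \<or> u = a \<and> v = y \<or> u = y \<and> v = a"
    proof -
      have K': "x \<in> K" "a \<notin> K" "y \<notin> K" using ne xya by (auto simp: K_def)
      have dist: "x \<noteq> a" "x \<noteq> y" "a \<noteq> y" using ne a(1) by auto
      have "nb x = (K - {x}) \<union> {a}" using a(1) xya by (auto simp: K_def)
      moreover have "nb c = K - {c}" if "c \<in> N - {a}" for c
        using clique[OF that] N_D[of c] that by (auto simp: K_def)
      moreover have "u = x \<or> u = a \<or> u = y \<or> u \<in> N - {a} \<and> u \<in> K \<and> u \<noteq> x"
        using split[OF uv(1)] xya by (auto simp: K_def)
      ultimately show ?thesis using a(2,3) K' dist by blast
    qed
    ultimately show ?thesis by (simp add: nb_def)
  qed
  ultimately show ?thesis
    using pair_graph_D_graph[of ?n] n pair_wf_digraph_axioms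
    by (intro digraph_iso_with_projI[of _ _ h])
      (auto simp: D_graph_def pair_graph_def pair_digraph_def pair_fin_digraph_def)
qed

lemma HIST_or_iso_D_graph: "(\<exists>T. HIST T G) \<or> digraph_iso (with_proj G) (with_proj (D_graph (card (pverts G))))"
proof (rule disjCI)
  assume no: "\<not> digraph_iso (with_proj G) (with_proj (D_graph (card (pverts G))))"
  show "\<exists>T. HIST T G"
  proof (rule ccontr)
    assume no_hist: "\<nexists>T. HIST T G"
    then have "card R = 1" using HIST_or_R_singleton by blast
    then obtain y where R: "R = {y}" by (meson card_1_singletonE)
    obtain a where "a \<in> N" "nb y = {a}" "nb a = {x, y}" "\<forall>c\<in>N - {a}. nb c = insert x (N - {a, c})"
      using structure_if_R_singleton[OF R no_hist] by blast
    then show False using iso_D_graph[OF R] no by blast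
  qed
qed

end

theorem theorem2:
  fixes G :: "'a pair_pre_digraph" and n :: nat
  assumes "pair_graph G"
    and "Digraph_Component.connected (with_proj G)"
    and "card (pverts G) = n"
    and "n \<ge> 10"
    and "sigma2 G \<ge> enat (n - 2)"
  shows "(\<exists>T. HIST T G) \<longleftrightarrow> \<not> digraph_iso (with_proj G) (with_proj (D_graph n))"
proof
  assume "\<exists>T. HIST T G"
  moreover have "3 \<le> n" using assms(4) by simp
  ultimately show "\<not> digraph_iso (with_proj G) (with_proj (D_graph n))"
    using no_HIST_if_iso_D_graph[OF assms(1)] by blast
next
  assume no: "\<not> digraph_iso (with_proj G) (with_proj (D_graph n))"
  interpret G: pair_graph G by fact
  let ?H = "(\<lambda>v. card (G.nb v)) ` pverts G"
  have "pverts G \<noteq> {}" using assms(3,4) by auto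
  then have "Max ?H \<in> ?H" using G.pair_finite_verts by (intro Max_in) auto
  then obtain x where x: "x \<in> pverts G" "card (G.nb x) = Max ?H" by auto
  interpret ore_graph G x
  proof
    fix u v assume uv: "u \<in> pverts G" "v \<in> pverts G" "u \<noteq> v" "v \<notin> G.nb u"
    then have "sigma2 G \<le> enat (degree G u + degree G v)"
      unfolding sigma2_def by (intro Inf_lower) (auto simp: G.nb_def)
    then have "enat (n - 2) \<le> enat (degree G u + degree G v)" using assms(5) by (rule order_trans[rotated])
    then show "card (pverts G) \<le> card (G.nb u) + card (G.nb v) + 2"
      using assms(3) by (simp add: G.degree_eq_card_nb)
  qed (use x assms G.pair_finite_verts in auto)
  show "\<exists>T. HIST T G" using HIST_or_iso_D_graph no assms(3) by auto
qed

end
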